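(* Let $r$ be a positive integer, $\sigma>0$ and $\mu\in\mathbb{R}$. Suppose that $h\in C_b^3(\mathbb{R})$, write $\tilde h=h-\mathrm{VG}^{r,0}_{\sigma,\mu}h$, and let $f$ be the solution (given in the context) of the $\mathrm{VG}_1(r,0,\sigma,\mu)$ Stein equation $$\sigma^2(x-\mu)f''(x)+\sigma^2rf'(x)-(x-\mu)f(x)=h(x)-\mathrm{VG}^{r,0}_{\sigma,\mu}h.$$ Then $f$ and its derivatives up to fourth order satisfy $\|f^{(k)}\|\le M^k_{r,\sigma}(h)$ for $k=0,1,2,3,4$ (with $f^{(0)}\equiv f$), where $$M^0_{r,\sigma}(h)=\frac1\sigma\left(\frac1r+\frac{\pi\Gamma(r/2)}{2\Gamma(r/2+1/2)}\right)\|\tilde h\|,\qquad M^1_{r,\sigma}(h)=\frac{2}{\sigma^2r}\|\tilde h\|,$$ $$M^2_{r,\sigma}(h)=\frac1{\sigma^2}\left(\sqrt{\frac{\pi}{2r}}+\frac1r\right)\left[3\|h'\|+\frac4\sigma\|\tilde h\|\right],$$ $$M^3_{r,\sigma}(h)=\frac1{\sigma^2}\left(\sqrt{\frac{\pi}{2r}}+\frac1r\right)\left[5\|h''\|+\frac{18}\sigma\|h'\|+\frac{19}{\sigma^2}\|\tilde h\|\right],$$ $$M^4_{r,\sigma}(h)=\frac1{\sigma^2}\left(\sqrt{\frac{\pi}{2r}}+\frac1r\right)\left[8\|h^{(3)}\|+\frac{52}\sigma\|h''\|+\frac{124}{\sigma^2}\|h'\|+\frac{124}{\sigma^3}\|\tilde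 h\|\right].$$
   Context: $\|\cdot\|$ is the supremum norm on $\mathbb{R}$. $C_b^3(\mathbb{R})$ is the set of bounded three times continuously differentiable functions $\mathbb{R}\to\mathbb{R}$ with bounded derivatives up to order three. $\mathrm{VG}_1(r,0,\sigma,\mu)$ is the distribution on $\mathbb{R}$ with density $$\frac{1}{\sigma\sqrt\pi\,\Gamma(\frac r2)}\left(\frac{|x-\mu|}{2\sigma}\right)^{\frac{r-1}2}K_{\frac{r-1}2}\left(\frac{|x-\mu|}\sigma\right),$$ and $\mathrm{VG}^{r,0}_{\sigma,\mu}h=\mathbb{E}h(X)$ for $X\sim\mathrm{VG}_1(r,0,\sigma,\mu)$. $I_\nu$ and $K_\nu$ are the modified Bessel functions of the first and second kind. The solution $f$ is, with $\nu=\frac{r-1}2$ and $u=\frac{x-\mu}\sigma$, $$f(x)=-\frac{K_\nu(|u|)}{\sigma|u|^\nu}\int_0^u|y|^\nu I_\nu(|y|)\,\tilde h(\sigma y+\mu)\,dy-\frac{I_\nu(|u|)}{\sigma|u|^\nu}\int_u^\infty|y|^\nu K_\nu(|y|)\,\tilde h(\sigma y+\mu)\,dy,$$ extended by continuity to $x=\mu$. *)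

theory Defs
  imports "HOL-Analysis.Analysis"
begin

text \<open>
  The modified Bessel functions, used only at arguments \<open>x > 0\<close> and orders \<open>\<nu> \<ge> 0\<close>. They are given
  by the power series of \<open>I\<^sub>\<nu>\<close> and by Schlaefli's integral definition
  \<open>K\<^sub>\<nu>(x) = \<integral>\<^sub>0\<^sup>\<infinity> exp(-x cosh t) cosh(\<nu> t) dt\<close>, which covers integer and non-integer
  orders uniformly. Neither is meaningful at \<open>x = 0\<close>; that point only ever occurs below as a null
  set of an integral.
\<close>

definition besselI :: "real \<Rightarrow> real \<Rightarrow> real" where
  "besselI \<nu> x =
     (\<Sum>k. (x / 2) powr (\<nu> + 2 * real k) / (fact k * Gamma (\<nu> + real k + 1)))"

definition besselK :: "real \<Rightarrow> real \<Rightarrow> real" where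
  "besselK \<nu> x = (LBINT t:{0..}. exp (- (x * cosh t)) * cosh (\<nu> * t))"

definition vg_density :: "real \<Rightarrow> real \<Rightarrow> real \<Rightarrow> real \<Rightarrow> real" where
  "vg_density r \<sigma> \<mu> x =
     1 / (\<sigma> * sqrt pi * Gamma (r / 2)) * (\<bar>x - \<mu>\<bar> / (2 * \<sigma>)) powr ((r - 1) / 2)
       * besselK ((r - 1) / 2) (\<bar>x - \<mu>\<bar> / \<sigma>)"

text \<open>\<open>VG\<^sub>1(r,0,\<sigma>,\<mu>)\<close>; the skewness parameter is \<open>0\<close> throughout.\<close>

definition vg_distr :: "real \<Rightarrow> real \<Rightarrow> real \<Rightarrow> real measure" where
  "vg_distr r \<sigma> \<mu> = density lborel (\<lambda>x. ennreal (vg_density r \<sigma> \<mu> x))"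

definition vg_expectation :: "real \<Rightarrow> real \<Rightarrow> real \<Rightarrow> (real \<Rightarrow> real) \<Rightarrow> real" where
  "vg_expectation r \<sigma> \<mu> h = (LINT x|vg_distr r \<sigma> \<mu>. h x)"

definition vg_centred :: "real \<Rightarrow> real \<Rightarrow> real \<Rightarrow> (real \<Rightarrow> real) \<Rightarrow> real \<Rightarrow> real" where
  "vg_centred r \<sigma> \<mu> h x = h x - vg_expectation r \<sigma> \<mu> h"

definition vg_stein_formula :: "real \<Rightarrow> real \<Rightarrow> real \<Rightarrow> (real \<Rightarrow> real) \<Rightarrow> real \<Rightarrow> real" where
  "vg_stein_formula r \<sigma> \<mu> h x =
     (let \<nu> = (r - 1) / 2; u = (x - \<mu>) / \<sigma> in
        - besselK \<nu> \<bar>u\<bar> / (\<sigma> * \<bar>u\<bar> powr \<nu>)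
            * (LBINT y=0..ereal u. \<bar>y\<bar> powr \<nu> * besselI \<nu> \<bar>y\<bar> * vg_centred r \<sigma> \<mu> h (\<sigma> * y + \<mu>))
        - besselI \<nu> \<bar>u\<bar> / (\<sigma> * \<bar>u\<bar> powr \<nu>)
            * (LBINT y=ereal u..\<infinity>. \<bar>y\<bar> powr \<nu> * besselK \<nu> \<bar>y\<bar> * vg_centred r \<sigma> \<mu> h (\<sigma> * y + \<mu>)))"

definition vg_stein_solution :: "real \<Rightarrow> real \<Rightarrow> real \<Rightarrow> (real \<Rightarrow> real) \<Rightarrow> real \<Rightarrow> real" where
  "vg_stein_solution r \<sigma> \<mu> h x =
     (if x = \<mu> then Lim (at \<mu>) (vg_stein_formula r \<sigma> \<mu> h) else vg_stein_formula r \<sigma> \<mu> h x)"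

text \<open>Being a supremum in \<open>real\<close>, this is the supremum norm for bounded \<open>g\<close> only.\<close>

definition sup_norm :: "(real \<Rightarrow> real) \<Rightarrow> real" where
  "sup_norm g = (SUP x. \<bar>g x\<bar>)"

definition Cb3 :: "(real \<Rightarrow> real) set" where
  "Cb3 = {h. (\<forall>k<3. \<forall>x. (deriv ^^ k) h differentiable (at x)) \<and>
             continuous_on UNIV ((deriv ^^ 3) h) \<and>
             (\<forall>k\<le>3. bounded (range ((deriv ^^ k) h)))}"

end

theory Submission
  imports Defs
begin

text \<open>
  In the variable \<open>u = (x - \<mu>) / \<sigma>\<close> the Stein equation reads \<open>u g'' + r g' - u g = H\<close>. Its homogeneous
  solutions are \<open>vgP r = u\<^sup>-\<^sup>\<nu> I\<^sub>\<nu>\<close> and \<open>vgQ r = u\<^sup>-\<^sup>\<nu> K\<^sub>\<nu>\<close> with \<open>\<nu> = (r - 1) / 2\<close>, and any bounded solution that is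
  regular at \<open>0\<close> satisfies \<open>|g'| \<le> (2 / r) sup |H|\<close>. Differentiating the equation \<open>k\<close> times shows that
  the \<open>k\<close>-th derivative solves the same equation with \<open>r + k\<close> in place of \<open>r\<close> and right-hand side
  the \<open>k\<close>-th derivative of \<open>H\<close> plus \<open>k\<close> times the \<open>(k - 1)\<close>-st derivative of \<open>g\<close>, so the gradient
  bound alone controls all higher derivatives. Smoothness at the singular point comes from
  \<open>g'(u) = u \<integral>\<^sub>0\<^sup>1 s\<^sup>r g(s u) ds + \<integral>\<^sub>0\<^sup>1 s\<^sup>r\<^sup>-\<^sup>1 H(s u) ds\<close>; the two half-line solutions fit together at \<open>0\<close>
  precisely because \<open>H\<close> is centred.
\<close>

section \<open>The modified Bessel function of the second kind\<close>

text \<open>The difficulty sits at u = 0, where \<open>vgQ\<close> and the solved form of the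
  equation are singular. The behaviour of K there is read off from two exact moments rather than
  from expansions: that of y^(\<nu>+1) K_\<nu>(y) gives the limit of u^r times the derivative of
  \<open>vgQ r\<close>, hence the Wronskian; that of y^\<nu> K_\<nu>(y) gives the normalising
  constant and the sup bound on the solution. Bessel's equation itself never appears: the
  recurrences in the order, with r + 2 standing for \<nu> + 1, put the homogeneous equation into the
  form (u^r y')' = u^r y, and the estimates compare integrals with explicit barriers built from
  \<open>vgP\<close> and \<open>vgQ\<close>. The gradient bound presupposes that the function and
  its derivative are bounded, so every differentiation must supply boundedness before it yields a
  constant. The recursion starts from sup |g| \<le> (pi/2) sup |H|. Its constants lie below the
  stated ones, and 2/r \<le> sqrt(pi/(2 r)) + 1/r converts the prefactor.\<close>

lemma cosh_ge_quarter_square: "0 \<le> t \<Longrightarrow> t\<^sup>2 / 4 \<le> cosh (t::real)"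
proof -
  assume "0 \<le> t"
  then have "1 + t + t\<^sup>2 / 2 \<le> exp t" by (rule exp_lower_Taylor_quadratic)
  moreover have "exp t \<le> 2 * cosh t" by (simp add: cosh_field_def)
  ultimately show ?thesis using \<open>0 \<le> t\<close> by simp
qed

lemma cosh_mult_le_exp: "0 \<le> t \<Longrightarrow> cosh (a * t) \<le> exp (\<bar>a\<bar> * t)" for a t :: real
proof -
  assume "0 \<le> t"
  have "cosh (a * t) = cosh (\<bar>a\<bar> * t)"
    using \<open>0 \<le> t\<close> cosh_real_abs[of "a * t"] by (simp add: abs_mult)
  also have "\<dots> \<le> exp (\<bar>a\<bar> * t)"
    using \<open>0 \<le> t\<close> by (simp add: cosh_field_def)
  finally show ?thesis .
qed

text \<open>After cosh t is bounded below by t^2/4, completing the square absorbs exp(b t) and one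
  further factor exp(t). The surplus exp(-t) is the integrable majorant behind the integrability
  claims for K.\<close>

lemma exp_cosh_decay:
  fixes x b t :: real
  assumes "x > 0" "0 \<le> t"
  shows "exp (- (x * cosh t)) * exp (b * t) \<le> exp ((b + 1)\<^sup>2 / x) * exp (- t)"
proof -
  have "0 \<le> (x * t / 2 - (b + 1))\<^sup>2 / x" using assms by simp
  also have "\<dots> = x * (t\<^sup>2 / 4) - (b + 1) * t + (b + 1)\<^sup>2 / x"
    using assms by (simp add: power2_eq_square field_simps)
  also have "\<dots> \<le> x * cosh t - (b + 1) * t + (b + 1)\<^sup>2 / x"
    using assms cosh_ge_quarter_square[of t] by simp
  finally have "- (x * cosh t) + b * t \<le> (b + 1)\<^sup>2 / x + - t" by (simp add: algebra_simps)
  then show ?thesis unfolding exp_add[symmetric] by simp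
qed

text \<open>Because the integrand is nonnegative, integrability is a conclusion: the limit of the
  antiderivative bounds the integral. Integrands of changing sign are left to
  \<open>set_integral_FTC_atLeast\<close>, where integrability is assumed.\<close>

lemma set_integral_FTC_atLeast_nonneg:
  fixes f F :: "real \<Rightarrow> real"
  assumes meas: "set_borel_measurable lborel {a..} f"
    and F: "\<And>x. a \<le> x \<Longrightarrow> (F has_real_derivative f x) (at x)"
    and nonneg: "\<And>x. a \<le> x \<Longrightarrow> 0 \<le> f x"
    and lim: "(F \<longlongrightarrow> T) at_top"
  shows "set_integrable lborel {a..} f" "(LBINT x:{a..}. f x) = T - F a"
proof -
  let ?g = "\<lambda>x. indicator {a..} x *\<^sub>R f x"
  have F_le: "F a \<le> F x" if "a \<le> x" for x
    using F nonneg that by (intro DERIV_nonneg_imp_nondecreasing[of a x F]) (auto intro: order_trans)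
  have T: "F a \<le> T"
    by (rule tendsto_lowerbound[OF lim]) (auto intro: F_le eventually_mono[OF eventually_ge_at_top[of a]])
  have "(\<integral>\<^sup>+x. ennreal (?g x) * indicator {a..} x \<partial>lborel) = ennreal (T - F a)"
    using meas F nonneg by (intro nn_integral_FTC_atLeast lim) (auto simp: set_borel_measurable_def)
  also have "(\<integral>\<^sup>+x. ennreal (?g x) * indicator {a..} x \<partial>lborel) = (\<integral>\<^sup>+x. ennreal (?g x) \<partial>lborel)"
    by (intro nn_integral_cong) (auto split: split_indicator)
  finally have "has_bochner_integral lborel ?g (T - F a)"
    using meas nonneg T
    by (intro has_bochner_integral_nn_integral) (auto simp: set_borel_measurable_def split: split_indicator)
  then show "set_integrable lborel {a..} f" "(LBINT x:{a..}. f x) = T - F a"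
    unfolding set_integrable_def set_lebesgue_integral_def
    by (rule integrable.intros, rule has_bochner_integral_integral_eq)
qed

lemma set_integral_FTC_atLeast:
  fixes f F :: "real \<Rightarrow> real"
  assumes int: "set_integrable lborel {a..} f" and cont: "continuous_on {a..} f"
    and F: "\<And>x. a \<le> x \<Longrightarrow> (F has_real_derivative f x) (at x)"
    and lim: "(F \<longlongrightarrow> T) at_top"
  shows "(LBINT x:{a..}. f x) = T - F a"
proof (rule tendsto_unique[OF trivial_limit_at_top_linorder])
  show "((\<lambda>b. LBINT x:{a..b}. f x) \<longlongrightarrow> (LBINT x:{a..}. f x)) at_top"
    by (rule tendsto_set_lebesgue_integral_at_top[OF _ int]) simp
  have "\<forall>\<^sub>F b in at_top. F b - F a = (LBINT x:{a..b}. f x)"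
    using eventually_ge_at_top[of a]
  proof eventually_elim
    case (elim b)
    show ?case unfolding set_lebesgue_integral_def
    proof (rule integral_FTC_atLeastAtMost[symmetric, OF elim])
      show "continuous_on {a..b} f" by (rule continuous_on_subset[OF cont]) auto
      show "(F has_vector_derivative f x) (at x within {a..b})" if "a \<le> x" "x \<le> b" for x
        using F[OF that(1)] 
        unfolding has_real_derivative_iff_has_vector_derivative by (rule has_vector_derivative_at_within)
    qed
  qed
  with tendsto_diff[OF lim tendsto_const]
  show "((\<lambda>b. LBINT x:{a..b}. f x) \<longlongrightarrow> T - F a) at_top"
    by (rule Lim_transform_eventually)
qed

lemma set_integrable_exp_minus: "set_integrable lborel {0::real..} (\<lambda>t. exp (- t))"
proof (rule set_integral_FTC_atLeast_nonneg(1))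
  show "((\<lambda>t. - exp (- t)) has_real_derivative exp (- t)) (at t)" for t :: real
    by (auto intro!: derivative_eq_intros)
  show "((\<lambda>t::real. - exp (- t)) \<longlongrightarrow> 0) at_top"
    using tendsto_minus[OF filterlim_compose[OF exp_at_bot filterlim_uminus_at_bot_at_top]] by simp
qed (auto simp: set_borel_measurable_def)

lemma set_integrable_exp_cosh_bound:
  fixes f :: "real \<Rightarrow> real"
  assumes "x > 0" and cont: "continuous_on {0..} f"
    and le: "\<And>t. 0 \<le> t \<Longrightarrow> \<bar>f t\<bar> \<le> C * (exp (- (x * cosh t)) * exp (b * t))"
  shows "set_integrable lborel {0..} f"
proof (rule set_integrable_bound)
  \<comment> \<open>The bound at t = 0 already forces C to be nonnegative.\<close>
  have "0 \<le> \<bar>f 0\<bar>" by simp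
  also have "\<dots> \<le> C * exp (- x)" using le[of 0] by simp
  finally have C: "C \<ge> 0" by (simp add: zero_le_mult_iff)
  show "set_integrable lborel {0..} (\<lambda>t. C * exp ((b + 1)\<^sup>2 / x) * exp (- t))"
    using set_integrable_exp_minus by (rule set_integrable_mult_right)
  show "set_borel_measurable lborel {0..} f"
    using borel_measurable_continuous_on_indicator[OF _ cont] by (simp add: set_borel_measurable_def)
  show "AE t in lborel. t \<in> {0..} \<longrightarrow> norm (f t) \<le> norm (C * exp ((b + 1)\<^sup>2 / x) * exp (- t))"
  proof (intro AE_I2 impI)
    fix t :: real assume "t \<in> {0..}"
    then have "\<bar>f t\<bar> \<le> C * (exp (- (x * cosh t)) * exp (b * t))" by (intro le) auto
    also have "\<dots> \<le> C * (exp ((b + 1)\<^sup>2 / x) * exp (- t))"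
      using exp_cosh_decay[of x t b] C \<open>x > 0\<close> \<open>t \<in> {0..}\<close> by (intro mult_left_mono) auto
    finally show "norm (f t) \<le> norm (C * exp ((b + 1)\<^sup>2 / x) * exp (- t))" using C by (simp add: mult.assoc)
  qed
qed

lemma besselK_integrable:
  fixes x a :: real
  assumes "x > 0"
  shows "set_integrable lborel {0..} (\<lambda>t. exp (- (x * cosh t)) * cosh (a * t))"
  using cosh_mult_le_exp[of _ a]
  by (intro set_integrable_exp_cosh_bound[where x = x and C = 1 and b = "\<bar>a\<bar>"] assms)
     (auto intro!: continuous_intros)

lemma exp_taylor_quadratic: "\<bar>exp z - 1 - z\<bar> \<le> z\<^sup>2 * exp \<bar>z\<bar>" for z :: real
proof -
  obtain t where t: "\<bar>t\<bar> \<le> \<bar>z\<bar>" "exp z = (\<Sum>m<2. z ^ m / fact m) + exp t / fact 2 * z ^ 2"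
    using Maclaurin_exp_le[of z 2] by blast
  have "\<bar>exp z - 1 - z\<bar> = exp t / 2 * z\<^sup>2"
    using t(2) by (simp add: lessThan_Suc numeral_2_eq_2)
  also have "\<dots> \<le> exp \<bar>z\<bar> * z\<^sup>2"
  proof (rule mult_right_mono)
    have "exp t \<le> exp \<bar>z\<bar>" using t(1) by simp
    then show "exp t / 2 \<le> exp \<bar>z\<bar>" using exp_gt_zero[of t] by linarith
  qed simp
  finally show ?thesis by (simp add: mult.commute)
qed

text \<open>A remainder quadratic in h survives integration over a parameter, so integrating a
  pointwise Taylor estimate is enough to differentiate under the integral sign.\<close>

lemma DERIV_quadratic_bound:
  fixes f :: "real \<Rightarrow> real"
  assumes "d > 0" and bd: "\<And>h. \<bar>h\<bar> \<le> d \<Longrightarrow> \<bar>f (x + h) - f x - D * h\<bar> \<le> C * h\<^sup>2"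
  shows "(f has_real_derivative D) (at x)"
proof -
  have "((\<lambda>h. (f (x + h) - f x) / h - D) \<longlongrightarrow> 0) (at 0)"
  proof (rule Lim_null_comparison)
    show "\<forall>\<^sub>F h in at 0. norm ((f (x + h) - f x) / h - D) \<le> C * \<bar>h\<bar>"
      unfolding eventually_at
    proof (intro exI[of _ d] conjI ballI impI)
      fix h :: real assume h: "h \<noteq> 0 \<and> dist h 0 < d"
      have "norm ((f (x + h) - f x) / h - D) = \<bar>f (x + h) - f x - D * h\<bar> / \<bar>h\<bar>"
        using h by (simp add: field_simps flip: abs_divide)
      also have "\<dots> \<le> C * h\<^sup>2 / \<bar>h\<bar>" using bd[of h] h by (intro divide_right_mono) auto
      also have "\<dots> = C * \<bar>h\<bar>" using h by (simp add: field_simps power2_eq_square)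
      finally show "norm ((f (x + h) - f x) / h - D) \<le> C * \<bar>h\<bar>" .
    qed fact
    show "((\<lambda>h. C * \<bar>h\<bar>) \<longlongrightarrow> 0) (at 0)" by (auto intro!: tendsto_eq_intros)
  qed
  then show ?thesis unfolding DERIV_def by (simp add: LIM_zero_iff)
qed


lemma besselK_cosh_integrable:
  fixes x a :: real
  assumes "x > 0"
  shows "set_integrable lborel {0..} (\<lambda>t. cosh t * (exp (- (x * cosh t)) * cosh (a * t)))"
proof (rule set_integrable_exp_cosh_bound[where x = x and C = 1 and b = "1 + \<bar>a\<bar>", OF assms])
  fix t :: real assume "0 \<le> t"
  then have "cosh t * cosh (a * t) \<le> exp t * exp (\<bar>a\<bar> * t)"
    using cosh_mult_le_exp[of t 1] cosh_mult_le_exp[of t a] by (intro mult_mono) auto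
  also have "\<dots> = exp ((1 + \<bar>a\<bar>) * t)" by (simp add: distrib_right exp_add)
  finally show "\<bar>cosh t * (exp (- (x * cosh t)) * cosh (a * t))\<bar>
      \<le> 1 * (exp (- (x * cosh t)) * exp ((1 + \<bar>a\<bar>) * t))"
    by (simp add: abs_mult mult_ac)
qed (auto intro!: continuous_intros)

text \<open>The left side is minus the formal x-derivative of the integral for K_a. The product
  formula for cosh t cosh(a t) rewrites it in the neighbouring orders.\<close>

lemma besselK_cosh:
  assumes "x > 0"
  shows "(LBINT t:{0..}. cosh t * (exp (- (x * cosh t)) * cosh (a * t))) = (besselK (a + 1) x + besselK (a - 1) x) / 2"
proof -
  have "(LBINT t:{0..}. cosh t * (exp (- (x * cosh t)) * cosh (a * t))) =
      (LBINT t:{0..}. 1 / 2 * (exp (- (x * cosh t)) * cosh ((a + 1) * t) + exp (- (x * cosh t)) * cosh ((a - 1) * t)))"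
    by (intro set_lebesgue_integral_cong)
       (auto simp: distrib_right left_diff_distrib cosh_add cosh_diff algebra_simps)
  then show ?thesis
    using besselK_integrable[OF assms] by (simp only: besselK_def set_integral_add set_integral_mult_right)
qed

lemma besselK_has_real_derivative:
  assumes "x > 0"
  shows "(besselK a has_real_derivative - (besselK (a + 1) x + besselK (a - 1) x) / 2) (at x)"
proof -
  define C where "C = (LBINT t:{0..}. (cosh t)\<^sup>2 * (exp (- (x / 2 * cosh t)) * cosh (a * t)))"
  have C_int: "set_integrable lborel {0..} (\<lambda>t. (cosh t)\<^sup>2 * (exp (- (x / 2 * cosh t)) * cosh (a * t)))"
  proof (rule set_integrable_exp_cosh_bound[where x = "x / 2" and C = 1 and b = "2 + \<bar>a\<bar>"])
    fix t :: real assume "0 \<le> t"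
    then have "(cosh t)\<^sup>2 * cosh (a * t) \<le> (exp t)\<^sup>2 * exp (\<bar>a\<bar> * t)"
      using cosh_mult_le_exp[of t 1] cosh_mult_le_exp[of t a] by (intro mult_mono power_mono) auto
    also have "\<dots> = exp ((2 + \<bar>a\<bar>) * t)" by (simp add: distrib_right exp_add exp_double)
    finally show "\<bar>(cosh t)\<^sup>2 * (exp (- (x / 2 * cosh t)) * cosh (a * t))\<bar>
        \<le> 1 * (exp (- (x / 2 * cosh t)) * exp ((2 + \<bar>a\<bar>) * t))"
      by (simp add: abs_mult mult_ac)
  qed (use assms in \<open>auto intro!: continuous_intros\<close>)
  show ?thesis
  proof (rule DERIV_quadratic_bound)
    \<comment> \<open>With |h| \<le> x/2 the factor exp(|h| cosh t) of the Taylor remainder uses up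
      half of the decay exp(-x cosh t), which is why \<open>C\<close> is an integral at x/2.\<close>
    show "x / 2 > 0" using assms by simp
    fix h :: real assume h: "\<bar>h\<bar> \<le> x / 2"
    let ?e = "\<lambda>y t. exp (- (y * cosh t)) * cosh (a * t)"
    let ?d = "\<lambda>t. ?e (x + h) t - ?e x t - (- h) * (cosh t * ?e x t)"
    have "x + h > 0" using h assms by linarith
    note int = besselK_integrable[OF assms, of a] besselK_integrable[OF \<open>x + h > 0\<close>, of a]
      besselK_cosh_integrable[OF assms, of a]
    have d_int: "set_integrable lborel {0..} ?d"
      by (intro set_integral_diff(1) set_integrable_mult_right int)
    have "besselK a (x + h) - besselK a x - - (besselK (a + 1) x + besselK (a - 1) x) / 2 * h = (LBINT t:{0..}. ?d t)"
    proof -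
      have D: "- (besselK (a + 1) x + besselK (a - 1) x) / 2 = - (LBINT t:{0..}. cosh t * (exp (- (x * cosh t)) * cosh (a * t)))"
        using besselK_cosh[OF assms, of a] by simp
      show ?thesis
        unfolding D using int by (simp add: besselK_def set_integral_diff set_integrable_mult_right)
    qed
    moreover have "\<bar>LBINT t:{0..}. ?d t\<bar> \<le> (LBINT t:{0..}. h\<^sup>2 * ((cosh t)\<^sup>2 * (exp (- (x / 2 * cosh t)) * cosh (a * t))))"
    proof -
      have "\<bar>LBINT t:{0..}. ?d t\<bar> \<le> (LBINT t:{0..}. \<bar>?d t\<bar>)"
        using set_integral_norm_bound[OF d_int] by simp
      also have "\<dots> \<le> (LBINT t:{0..}. h\<^sup>2 * ((cosh t)\<^sup>2 * (exp (- (x / 2 * cosh t)) * cosh (a * t))))"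
      proof (rule set_integral_mono)
        show "set_integrable lborel {0..} (\<lambda>t. \<bar>?d t\<bar>)" using d_int by (rule set_integrable_abs)
        show "set_integrable lborel {0..} (\<lambda>t. h\<^sup>2 * ((cosh t)\<^sup>2 * (exp (- (x / 2 * cosh t)) * cosh (a * t))))"
          by (intro set_integrable_mult_right C_int)
        fix t :: real
        let ?z = "- (h * cosh t)"
        have "?d t = ?e x t * (exp ?z - 1 - ?z)"
          by (simp add: algebra_simps flip: exp_add)
        then have "\<bar>?d t\<bar> = ?e x t * \<bar>exp ?z - 1 - ?z\<bar>"
          by (simp add: abs_mult)
        also have "\<dots> \<le> ?e x t * (?z\<^sup>2 * exp \<bar>?z\<bar>)"
          by (intro mult_left_mono exp_taylor_quadratic) auto
        also have "\<dots> \<le> ?e x t * (?z\<^sup>2 * exp (x / 2 * cosh t))"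
          using h by (intro mult_left_mono) (auto simp: abs_mult intro!: mult_right_mono)
        also have "\<dots> = h\<^sup>2 * ((cosh t)\<^sup>2 * (exp (- (x * cosh t) + x / 2 * cosh t) * cosh (a * t)))"
          unfolding exp_add by (simp add: power_mult_distrib mult_ac)
        also have "- (x * cosh t) + x / 2 * cosh t = - (x / 2 * cosh t)" by (simp add: field_simps)
        finally show "\<bar>?d t\<bar> \<le> h\<^sup>2 * ((cosh t)\<^sup>2 * (exp (- (x / 2 * cosh t)) * cosh (a * t)))" .
      qed
      finally show ?thesis .
    qed
    ultimately show "\<bar>besselK a (x + h) - besselK a x - - (besselK (a + 1) x + besselK (a - 1) x) / 2 * h\<bar> \<le> C * h\<^sup>2"
      by (simp add: C_def mult.commute)
  qed
qed

text \<open>Integration by parts: the outer cosh terms differ by 2 sinh(a t) sinh t, so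
  \<open>?f\<close> is the derivative of -exp(-x cosh t) sinh(a t), which vanishes at both
  ends.\<close>

lemma besselK_recurrence:
  assumes "x > 0"
  shows "2 * a * besselK a x = x * (besselK (a + 1) x - besselK (a - 1) x)"
proof -
  let ?e = "\<lambda>a t. exp (- (x * cosh t)) * cosh (a * t)"
  let ?f = "\<lambda>t. x / 2 * (?e (a + 1) t - ?e (a - 1) t) - a * ?e a t"
  let ?F = "\<lambda>t. - (exp (- (x * cosh t)) * sinh (a * t))"
  note int = besselK_integrable[OF assms]
  have f_int: "set_integrable lborel {0..} ?f"
    by (intro set_integral_diff(1) set_integrable_mult_right int)
  have "(LBINT t:{0..}. ?f t) = 0 - ?F 0"
  proof (rule set_integral_FTC_atLeast[OF f_int])
    show "continuous_on {0..} ?f" by (intro continuous_intros)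
    show "(?F has_real_derivative ?f t) (at t)" for t
      by (auto intro!: derivative_eq_intros simp: distrib_right left_diff_distrib cosh_add cosh_diff algebra_simps)
    show "(?F \<longlongrightarrow> 0) at_top"
    proof (rule Lim_null_comparison)
      show "\<forall>\<^sub>F t in at_top. norm (?F t) \<le> exp ((\<bar>a\<bar> + 1)\<^sup>2 / x) * exp (- t)"
        using eventually_ge_at_top[of 0]
      proof eventually_elim
        case (elim t)
        have "\<bar>sinh (a * t)\<bar> \<le> cosh (a * t)"
          using sinh_le_cosh_real[of "a * t"] sinh_le_cosh_real[of "- (a * t)"] by simp
        also have "\<dots> \<le> exp (\<bar>a\<bar> * t)" using elim by (rule cosh_mult_le_exp)
        finally have "norm (?F t) \<le> exp (- (x * cosh t)) * exp (\<bar>a\<bar> * t)"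
          by (simp add: abs_mult)
        also have "\<dots> \<le> exp ((\<bar>a\<bar> + 1)\<^sup>2 / x) * exp (- t)"
          using assms elim by (rule exp_cosh_decay)
        finally show ?case .
      qed
      show "((\<lambda>t. exp ((\<bar>a\<bar> + 1)\<^sup>2 / x) * exp (- t)) \<longlongrightarrow> 0) at_top"
        using tendsto_mult_left[OF filterlim_compose[OF exp_at_bot filterlim_uminus_at_bot_at_top],
            of "exp ((\<bar>a\<bar> + 1)\<^sup>2 / x)"] by simp
    qed
  qed
  moreover have "(LBINT t:{0..}. ?f t) = x / 2 * (besselK (a + 1) x - besselK (a - 1) x) - a * besselK a x"
    unfolding besselK_def using int
    by (simp add: set_integral_diff set_integrable_mult_right)
  ultimately show ?thesis by simp
qed

section \<open>Moments of the second-kind function\<close>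

text \<open>Substitution y to c y in Euler's integral. Nonnegative integrals are used so that the
  order of integration can later be exchanged with no integrability condition.\<close>

lemma nn_integral_Gamma_scaled:
  assumes "s > 0" "c > (0::real)"
  shows "(\<integral>\<^sup>+y. ennreal (indicator {0..} y * (y powr (s - 1) * exp (- (y * c)))) \<partial>lborel) = ennreal (Gamma s / c powr s)"
proof -
  let ?g = "\<lambda>t. ennreal (indicator {0..} t * t powr (s - 1) / exp t)"
  have "ennreal (Gamma s) = ennreal c * (\<integral>\<^sup>+x. ?g (c * x) \<partial>lborel)"
    using assms nn_integral_real_affine[of ?g c 0] by (simp add: Gamma_conv_nn_integral_real)
  also have "(\<integral>\<^sup>+x. ?g (c * x) \<partial>lborel) =
      (\<integral>\<^sup>+y. ennreal (c powr (s - 1)) * ennreal (indicator {0..} y * (y powr (s - 1) * exp (- (y * c)))) \<partial>lborel)"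
    using assms
    by (intro nn_integral_cong)
       (auto simp: indicator_def zero_le_mult_iff powr_mult exp_minus field_simps simp flip: ennreal_mult')
  also have "\<dots> = ennreal (c powr (s - 1)) * (\<integral>\<^sup>+y. ennreal (indicator {0..} y * (y powr (s - 1) * exp (- (y * c)))) \<partial>lborel)"
    by (rule nn_integral_cmult) simp
  finally have "ennreal (Gamma s) = ennreal (c powr s) * (\<integral>\<^sup>+y. ennreal (indicator {0..} y * (y powr (s - 1) * exp (- (y * c)))) \<partial>lborel)"
    using assms by (simp add: mult.assoc[symmetric] powr_diff flip: ennreal_mult')
  then have "ennreal (inverse (c powr s)) * ennreal (Gamma s) =
      (ennreal (inverse (c powr s)) * ennreal (c powr s)) * (\<integral>\<^sup>+y. ennreal (indicator {0..} y * (y powr (s - 1) * exp (- (y * c)))) \<partial>lborel)"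
    by (simp add: mult.assoc)
  then show ?thesis
    using assms by (simp add: divide_inverse mult.commute flip: ennreal_mult')
qed

lemma nn_integral_besselK:
  assumes "x > 0"
  shows "ennreal (besselK a x) = (\<integral>\<^sup>+t. ennreal (indicator {0..} t * (exp (- (x * cosh t)) * cosh (a * t))) \<partial>lborel)"
  using nn_integral_eq_integral[OF besselK_integrable[OF assms, of a, unfolded set_integrable_def]]
  by (simp add: besselK_def set_lebesgue_integral_def)

text \<open>Inserting the integral for K and integrating over y first leaves a Gamma integral with
  rate cosh t, so a moment of K reduces to an elementary integral in t.\<close>

lemma nn_integral_besselK_moment:
  assumes "p > -1"
  shows "(\<integral>\<^sup>+y. ennreal (indicator {0..} y * (y powr p * besselK a y)) \<partial>lborel) =
    ennreal (Gamma (p + 1)) * (\<integral>\<^sup>+t. ennreal (indicator {0..} t * (cosh (a * t) / cosh t powr (p + 1))) \<partial>lborel)"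
proof -
  let ?f = "\<lambda>y t. ennreal (indicator {0..} y * (indicator {0..} t * (y powr p * (exp (- (y * cosh t)) * cosh (a * t)))))"
  have "(\<integral>\<^sup>+y. ennreal (indicator {0..} y * (y powr p * besselK a y)) \<partial>lborel) = (\<integral>\<^sup>+y. \<integral>\<^sup>+t. ?f y t \<partial>lborel \<partial>lborel)"
  proof (rule nn_integral_cong)
    fix y :: real
    show "ennreal (indicator {0..} y * (y powr p * besselK a y)) = (\<integral>\<^sup>+t. ?f y t \<partial>lborel)"
    proof (cases "y > 0")
      case True
      then have "ennreal (indicator {0..} y * (y powr p * besselK a y)) = ennreal (y powr p) * ennreal (besselK a y)"
        by (simp add: ennreal_mult')
      also have "\<dots> = (\<integral>\<^sup>+t. ennreal (y powr p) * ennreal (indicator {0..} t * (exp (- (y * cosh t)) * cosh (a * t))) \<partial>lborel)"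
        unfolding nn_integral_besselK[OF True] by (rule nn_integral_cmult[symmetric]) (simp add: cosh_field_def)
      also have "\<dots> = (\<integral>\<^sup>+t. ?f y t \<partial>lborel)"
        using True by (intro nn_integral_cong) (auto simp: indicator_def simp flip: ennreal_mult')
      finally show ?thesis .
    qed (auto simp: indicator_def)
  qed
  also have "\<dots> = (\<integral>\<^sup>+t. \<integral>\<^sup>+y. ?f y t \<partial>lborel \<partial>lborel)"
    by (subst lborel_pair.Fubini') (auto simp: case_prod_unfold cosh_field_def)
  also have "\<dots> = (\<integral>\<^sup>+t. ennreal (Gamma (p + 1)) * ennreal (indicator {0..} t * (cosh (a * t) / cosh t powr (p + 1))) \<partial>lborel)"
  proof (rule nn_integral_cong)
    fix t :: real
    have "(\<integral>\<^sup>+y. ?f y t \<partial>lborel) = (\<integral>\<^sup>+y. ennreal (indicator {0..} t * cosh (a * t)) *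
        ennreal (indicator {0..} y * (y powr (p + 1 - 1) * exp (- (y * cosh t)))) \<partial>lborel)"
      by (intro nn_integral_cong) (auto simp: indicator_def mult_ac simp flip: ennreal_mult')
    also have "\<dots> = ennreal (indicator {0..} t * cosh (a * t)) * ennreal (Gamma (p + 1) / cosh t powr (p + 1))"
      using assms by (subst nn_integral_cmult) (simp_all only: nn_integral_Gamma_scaled cosh_real_pos, auto)
    also have "\<dots> = ennreal (Gamma (p + 1)) * ennreal (indicator {0..} t * (cosh (a * t) / cosh t powr (p + 1)))"
      using assms by (auto simp: indicator_def Gamma_real_nonneg simp flip: ennreal_mult')
    finally show "(\<integral>\<^sup>+y. ?f y t \<partial>lborel) = ennreal (Gamma (p + 1)) * ennreal (indicator {0..} t * (cosh (a * t) / cosh t powr (p + 1)))" .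
  qed
  also have "\<dots> = ennreal (Gamma (p + 1)) * (\<integral>\<^sup>+t. ennreal (indicator {0..} t * (cosh (a * t) / cosh t powr (p + 1))) \<partial>lborel)"
    by (rule nn_integral_cmult) (simp add: cosh_field_def)
  finally show ?thesis .
qed

lemma besselK_nonneg: "besselK a x \<ge> 0"
  unfolding besselK_def set_lebesgue_integral_def by (rule Bochner_Integration.integral_nonneg) (auto simp: indicator_def)

lemma besselK_measurable:
  "(\<lambda>y. indicator {0..} y * (y powr p * besselK a y)) \<in> borel_measurable borel"
proof -
  have "continuous_on {0<..} (\<lambda>y. y powr p * besselK a y)"
    using DERIV_isCont[OF besselK_has_real_derivative, of _ a]
    by (intro continuous_intros continuous_at_imp_continuous_on) auto
  then have "(\<lambda>y. indicator {0<..} y *\<^sub>R (y powr p * besselK a y)) \<in> borel_measurable borel"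
    by (intro borel_measurable_continuous_on_indicator) auto
  \<comment> \<open>The point 0 may be added to the domain because \<open>0 powr p = 0\<close> for
    every p.\<close>
  also have "(\<lambda>y. indicator {0<..} y *\<^sub>R (y powr p * besselK a y)) = (\<lambda>y. indicator {0..} y * (y powr p * besselK a y))"
    by (auto simp: indicator_def fun_eq_iff)
  finally show ?thesis .
qed

text \<open>\<open>F\<close> is the integral of cosh(a t) / cosh(t)^(p+1) from 0, and its limit at
  infinity supplies the missing factor. The positive integrand yields existence of the moment
  together with its value.\<close>

lemma has_bochner_integral_besselK_moment:
  assumes "p > -1"
    and F: "\<And>t. (F has_real_derivative cosh (a * t) / cosh t powr (p + 1)) (at t)" "F 0 = 0" "(F \<longlongrightarrow> L) at_top"
  shows "has_bochner_integral lborel (\<lambda>y. indicator {0..} y * (y powr p * besselK a y)) (Gamma (p + 1) * L)"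
proof (rule has_bochner_integral_nn_integral)
  have F_nonneg: "F 0 \<le> F x" if "0 \<le> x" for x
  proof (rule DERIV_nonneg_imp_nondecreasing[OF that])
    show "\<exists>y. (F has_real_derivative y) (at z) \<and> 0 \<le> y" for z
      using F(1)[of z] by (intro exI conjI) auto
  qed
  have L: "0 \<le> L"
    using F_nonneg F(2)
    by (intro tendsto_lowerbound[OF F(3)]) (auto intro: eventually_mono[OF eventually_ge_at_top[of 0]])
  then show "0 \<le> Gamma (p + 1) * L" using assms(1) by (simp add: Gamma_real_nonneg)
  have "(\<integral>\<^sup>+t. ennreal (indicator {0..} t * (cosh (a * t) / cosh t powr (p + 1))) \<partial>lborel) =
      (\<integral>\<^sup>+t. ennreal (cosh (a * t) / cosh t powr (p + 1)) * indicator {0..} t \<partial>lborel)"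
    by (intro nn_integral_cong) (auto simp: indicator_def)
  also have "\<dots> = ennreal (L - F 0)"
    using F by (intro nn_integral_FTC_atLeast) (auto simp: cosh_field_def)
  finally have *: "(\<integral>\<^sup>+t. ennreal (indicator {0..} t * (cosh (a * t) / cosh t powr (p + 1))) \<partial>lborel) = ennreal L"
    by (simp add: F(2))
  show "(\<integral>\<^sup>+y. ennreal (indicator {0..} y * (y powr p * besselK a y)) \<partial>lborel) = ennreal (Gamma (p + 1) * L)"
    unfolding nn_integral_besselK_moment[OF assms(1)] * using assms(1) L
    by (simp add: ennreal_mult' Gamma_real_nonneg)
qed (use besselK_measurable[of p a] besselK_nonneg in \<open>auto simp: indicator_def\<close>)

lemma exp_minus_mult_at_top: "0 < c \<Longrightarrow> ((\<lambda>t::real. exp (- (c * t))) \<longlongrightarrow> 0) at_top"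
  by (rule filterlim_compose[OF exp_at_bot])
     (auto intro!: filterlim_compose[OF filterlim_uminus_at_bot_at_top] filterlim_tendsto_pos_mult_at_top filterlim_ident)

lemma sinh_over_cosh_powr_limit:
  assumes "0 < (c::real)"
  shows "((\<lambda>t. sinh (c * t) / cosh t powr c) \<longlongrightarrow> 2 powr (c - 1)) at_top"
proof -
  have "sinh (c * t) / cosh t powr c = (1 - exp (- (2 * c * t))) / 2 * (2 powr c / (1 + exp (- (2 * t))) powr c)" for t
  proof -
    have "cosh t = exp t * (1 + exp (- (2 * t))) / 2"
      by (simp add: cosh_field_def distrib_left flip: exp_add)
    then have "cosh t powr c = (exp t * (1 + exp (- (2 * t))) / 2) powr c" by (rule arg_cong)
    also have "\<dots> = exp (c * t) * (1 + exp (- (2 * t))) powr c / 2 powr c"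
      by (simp add: powr_mult powr_divide add_pos_pos less_imp_le exp_powr_real mult.commute)
    finally have "cosh t powr c = exp (c * t) * (1 + exp (- (2 * t))) powr c / 2 powr c" .
    moreover have "sinh (c * t) = exp (c * t) * (1 - exp (- (2 * c * t))) / 2"
      by (simp add: sinh_field_def right_diff_distrib flip: exp_add)
    moreover have "E * X / 2 / (E * Y / p) = X / 2 * (p / Y)" if "E \<noteq> 0" for E X Y p :: real
      using that by (simp add: divide_simps)
    ultimately show ?thesis by (simp only: exp_not_eq_zero not_False_eq_True)
  qed
  moreover have "((\<lambda>t. (1 - exp (- (2 * c * t))) / 2 * (2 powr c / (1 + exp (- (2 * t))) powr c))
      \<longlongrightarrow> (1 - 0) / 2 * (2 powr c / (1 + 0) powr c)) at_top"
    using assms by (intro tendsto_intros exp_minus_mult_at_top) auto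
  ultimately show ?thesis by (simp add: powr_diff)
qed

lemma DERIV_sinh_over_cosh_powr:
  "((\<lambda>t. sinh (c * t) / cosh t powr c) has_real_derivative c * (cosh ((c - 1) * t) / cosh t powr (c + 1))) (at t)"
proof -
  have "cosh ((c - 1) * t) = cosh (c * t) * cosh t - sinh (c * t) * sinh t"
    by (simp add: left_diff_distrib cosh_diff)
  then show ?thesis
    by (simp only:) (auto intro!: derivative_eq_intros simp: powr_add powr_diff power2_eq_square field_simps)
qed

text \<open>For p = a + 1 the t-integrand has an elementary antiderivative by
  \<open>DERIV_sinh_over_cosh_powr\<close> with c = a + 1. This moment later fixes the singular
  behaviour of \<open>vgQ\<close> at 0.\<close>

lemma besselK_moment_succ:
  assumes "a > -1"
  shows "has_bochner_integral lborel (\<lambda>y. indicator {0..} y * (y powr (a + 1) * besselK a y)) (2 powr a * Gamma (a + 1))"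
proof -
  let ?F = "\<lambda>t. sinh ((a + 1) * t) / cosh t powr (a + 1) / (a + 1)"
  have "(?F has_real_derivative cosh (a * t) / cosh t powr (a + 1 + 1)) (at t)" for t
    using DERIV_cdivide[OF DERIV_sinh_over_cosh_powr[of "a + 1" t], of "a + 1"] assms by simp
  moreover have "(?F \<longlongrightarrow> 2 powr (a + 1 - 1) / (a + 1)) at_top"
    using assms by (intro tendsto_intros sinh_over_cosh_powr_limit) auto
  ultimately have "has_bochner_integral lborel (\<lambda>y. indicator {0..} y * (y powr (a + 1) * besselK a y))
      (Gamma (a + 1 + 1) * (2 powr (a + 1 - 1) / (a + 1)))"
    using assms by (intro has_bochner_integral_besselK_moment[where F = ?F]) auto
  moreover have "Gamma (a + 1 + 1) = (a + 1) * Gamma (a + 1)"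
    using assms by (intro Gamma_plus1) (auto elim!: nonpos_Ints_cases)
  ultimately show ?thesis using assms by (simp add: mult.commute)
qed

text \<open>For p = \<nu> = (r - 1)/2 the antiderivative is built by induction on r in steps of two,
  that is \<nu> to \<nu> + 1, from arctan(sinh t) at r = 1 and 2 sinh(t/2) / sqrt(cosh t) at r = 2.
  Integrality of r is what makes this possible.\<close>

lemma cosh_quotient_antiderivative:
  fixes r :: nat
  assumes "r \<ge> 1"
  shows "\<exists>F. (\<forall>t. (F has_real_derivative cosh ((real r - 1) / 2 * t) / cosh t powr ((real r - 1) / 2 + 1)) (at t)) \<and>
    F 0 = 0 \<and> (F \<longlongrightarrow> 2 powr ((real r - 1) / 2 - 1) * sqrt pi * Gamma (real r / 2) / Gamma (real r / 2 + 1 / 2)) at_top"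
  using assms
proof (induction r rule: less_induct)
  case (less r)
  consider "r = 1" | "r = 2" | n where "r = n + 2" "n \<ge> 1"
    using less.prems by (metis Suc_1 add_2_eq_Suc' le_SucE le_add1 One_nat_def add.commute le_Suc_ex not_less_eq_eq numeral_2_eq_2)
  then show ?case
  proof cases
    case 1
    have "((\<lambda>t. arctan (sinh t)) has_real_derivative 1 / cosh t) (at t)" for t :: real
    proof -
      have "1 / cosh t = inverse (1 + (sinh t)\<^sup>2) * cosh t"
        unfolding add.commute[of 1] cosh_square_eq[symmetric] by (simp add: power2_eq_square field_simps)
      then show ?thesis by (auto intro!: derivative_eq_intros)
    qed
    moreover have "((\<lambda>t. arctan (sinh t)) \<longlongrightarrow> pi / 2) at_top"
      by (rule filterlim_compose[OF tendsto_arctan_at_top sinh_real_at_top])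
    ultimately show ?thesis
      using 1 by (intro exI[of _ "\<lambda>t. arctan (sinh t)"]) (simp add: Gamma_one_half_real powr_minus_divide)
  next
    case 2
    let ?F = "\<lambda>t. sinh (1 / 2 * t) / cosh t powr (1 / 2) * 2 :: real"
    have "(?F has_real_derivative cosh (1 / 2 * t) / cosh t powr (1 / 2 + 1)) (at t)" for t
      using DERIV_cmult_right[OF DERIV_sinh_over_cosh_powr[of "1 / 2" t], of 2] cosh_minus[of "1 / 2 * t"] by simp
    moreover have lim: "(?F \<longlongrightarrow> 2 powr (1 / 2 - 1) * 2) at_top"
      by (intro tendsto_intros sinh_over_cosh_powr_limit) auto
    have G: "Gamma (3 / 2 :: real) = sqrt pi / 2"
    proof -
      have "Gamma (1 / 2 + 1 :: real) = 1 / 2 * Gamma (1 / 2)"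
        by (intro Gamma_plus1) (auto elim!: nonpos_Ints_cases)
      then show ?thesis by (simp add: Gamma_one_half_real)
    qed
    moreover have L: "2 powr ((real r - 1) / 2 - 1) * sqrt pi * Gamma (real r / 2) / Gamma (real r / 2 + 1 / 2) = 2 powr (1 / 2 - 1) * 2"
      using 2 by (simp add: G)
    ultimately show ?thesis
      unfolding L using 2 lim by (intro exI[of _ ?F]) simp
  next
    case 3
    define a where "a = (real n - 1) / 2"
    have a: "a \<ge> 0" "(real r - 1) / 2 = a + 1" "real r / 2 = a + 1 / 2 + 1" "real n / 2 = a + 1 / 2"
      using 3 by (auto simp: a_def field_simps)
    obtain F where F: "\<And>t. (F has_real_derivative cosh (a * t) / cosh t powr (a + 1)) (at t)" "F 0 = 0"
        "(F \<longlongrightarrow> 2 powr (a - 1) * sqrt pi * Gamma (a + 1 / 2) / Gamma (a + 1 / 2 + 1 / 2)) at_top"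
      using less.IH[of n] 3 by (auto simp: a a_def)
    \<comment> \<open>The addition formula splits cosh((a + 1) t) into a cosh cosh and a sinh sinh
      part. The derivative of sinh(a t) / cosh(t)^(a+1) produces the latter, and the coefficient of
      \<open>F\<close> corrects the former.\<close>
    define G where "G = (\<lambda>t. (2 * a + 1) / (a + 1) * F t - sinh (a * t) / cosh t powr (a + 1) / (a + 1))"
    have "(G has_real_derivative cosh ((a + 1) * t) / cosh t powr (a + 1 + 1)) (at t)" for t
    proof -
      let ?c = "cosh t powr (a + 1)"
      have "((\<lambda>t. sinh (a * t) / cosh t powr (a + 1)) has_real_derivative
          (a * cosh (a * t) * ?c - sinh (a * t) * ((a + 1) * (?c / cosh t) * sinh t)) / (?c * ?c)) (at t)"
      proof -
        have "?c / cosh t = cosh t powr a" by (simp add: powr_add)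
        then show ?thesis by (simp only:) (auto intro!: derivative_eq_intros)
      qed
      from DERIV_diff[OF DERIV_cmult[OF F(1), of "(2 * a + 1) / (a + 1)"] DERIV_cdivide[OF this, of "a + 1"]]
      have d: "(G has_real_derivative (2 * a + 1) / (a + 1) * (cosh (a * t) / ?c) -
          (a * cosh (a * t) * ?c - sinh (a * t) * ((a + 1) * (?c / cosh t) * sinh t)) / (?c * ?c) / (a + 1)) (at t)"
        unfolding G_def .
      have alg: "(2 * a + 1) / (a + 1) * (C / c) - (a * C * c - S * ((a + 1) * (c / h) * s)) / (c * c) / (a + 1) =
          (C * h + S * s) / (c * h)" if "c \<noteq> 0" "h \<noteq> 0" for C S s c h :: real
      proof -
        have "a + 1 \<noteq> 0" using a(1) by simp
        then show ?thesis using that by (simp add: divide_simps) (simp add: algebra_simps)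
      qed
      have "(G has_real_derivative (cosh (a * t) * cosh t + sinh (a * t) * sinh t) / (?c * cosh t)) (at t)"
        by (rule DERIV_cong[OF d alg]) auto
      then show ?thesis by (rule DERIV_cong) (simp add: distrib_right cosh_add powr_add power2_eq_square)
    qed
    moreover have "G 0 = 0" by (simp add: G_def F(2))
    moreover have "(G \<longlongrightarrow> (2 * a + 1) / (a + 1) * (2 powr (a - 1) * sqrt pi * Gamma (a + 1 / 2) / Gamma (a + 1 / 2 + 1 / 2)) - 0 / (a + 1)) at_top"
      unfolding G_def
    proof (intro tendsto_intros F(3))
      have inv: "((\<lambda>t::real. inverse (cosh t)) \<longlongrightarrow> 0) at_top"
        by (rule tendsto_inverse_0_at_top[OF cosh_real_at_top])
      show "((\<lambda>t. sinh (a * t) / cosh t powr (a + 1)) \<longlongrightarrow> 0) at_top"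
      proof (cases "a = 0")
        case False
        then show ?thesis
          using tendsto_mult[OF sinh_over_cosh_powr_limit[of a] inv] a(1) by (simp add: powr_add divide_inverse mult.assoc)
      qed simp
    qed (use a in auto)
    moreover have "(2 * a + 1) / (a + 1) * (2 powr (a - 1) * sqrt pi * Gamma (a + 1 / 2) / Gamma (a + 1 / 2 + 1 / 2)) =
        2 powr a * sqrt pi * Gamma (a + 1 / 2 + 1) / Gamma (a + 1 / 2 + 1 + 1 / 2)"
    proof -
      have G: "Gamma (a + 1 / 2 + 1) = (a + 1 / 2) * Gamma (a + 1 / 2)" "Gamma (a + 1 + 1) = (a + 1) * Gamma (a + 1)"
        using a(1) by (intro Gamma_plus1; auto elim!: nonpos_Ints_cases)+
      have e: "a + 1 / 2 + 1 + 1 / 2 = a + 1 + 1" "a + 1 / 2 + 1 / 2 = a + 1" by auto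
      have p: "(2::real) powr (a - 1) = 2 powr a / 2" by (simp add: powr_diff)
      have "(2 * a + 1) / (a + 1) * (p / 2 * s * X / Y) = p * s * ((a + 1 / 2) * X) / ((a + 1) * Y)" for p s X Y :: real
        by (simp add: field_simps)
      then show ?thesis unfolding e G p .
    qed
    ultimately show ?thesis unfolding a(2,3) by (intro exI[of _ G]) simp
  qed
qed

text \<open>The factor Gamma(r/2 + 1/2) from the y-integral cancels the denominator of the limit.
  The value is half the total mass of the kernel, hence the normalising constant of the
  density.\<close>

lemma besselK_moment:
  fixes r :: nat
  assumes "r \<ge> 1"
  shows "has_bochner_integral lborel (\<lambda>y. indicator {0..} y * (y powr ((real r - 1) / 2) * besselK ((real r - 1) / 2) y))
    (2 powr ((real r - 1) / 2 - 1) * sqrt pi * Gamma (real r / 2))"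
proof -
  obtain F where F: "\<And>t. (F has_real_derivative cosh ((real r - 1) / 2 * t) / cosh t powr ((real r - 1) / 2 + 1)) (at t)" "F 0 = 0"
    "(F \<longlongrightarrow> 2 powr ((real r - 1) / 2 - 1) * sqrt pi * Gamma (real r / 2) / Gamma (real r / 2 + 1 / 2)) at_top"
    using cosh_quotient_antiderivative[OF assms] by blast
  have eq: "(real r - 1) / 2 + 1 = real r / 2 + 1 / 2" by (simp add: field_simps)
  have "Gamma (real r / 2 + 1 / 2) \<noteq> 0"
    by (intro less_imp_neq[symmetric] Gamma_real_pos add_nonneg_pos) auto
  with has_bochner_integral_besselK_moment[OF _ F] show ?thesis
    unfolding eq using assms by simp
qed

section \<open>Rescaled Bessel functions and their differential equations\<close>

text \<open>Only the part near 0 moves; splitting off the tail beyond 1 reduces the claim to a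
  bounded interval.\<close>

lemma tendsto_set_integral_atLeast_at_right:
  fixes f :: "real \<Rightarrow> real"
  assumes "set_integrable lborel {0<..} f"
  shows "((\<lambda>u. LBINT y:{u..}. f y) \<longlongrightarrow> (LBINT y:{0<..}. f y)) (at_right 0)"
proof -
  have sub: "set_integrable lborel S f" if "S \<in> sets borel" "S \<subseteq> {0<..}" for S
    using assms that by (rule_tac set_integrable_subset) auto
  have "((\<lambda>u. (LBINT y:{u..1}. f y) + (LBINT y:{1<..}. f y)) \<longlongrightarrow> (LBINT y:{0<..1}. f y) + (LBINT y:{1<..}. f y)) (at_right 0)"
    by (intro tendsto_intros tendsto_set_lebesgue_integral_at_right sub) auto
  also have "(LBINT y:{0<..1}. f y) + (LBINT y:{1<..}. f y) = (LBINT y:{0<..1} \<union> {1<..}. f y)"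
    by (intro set_integral_Un[symmetric] sub) auto
  also have "{0<..1} \<union> {1<..} = {0::real<..}" by auto
  finally show ?thesis
  proof (rule Lim_transform_eventually)
    show "\<forall>\<^sub>F u in at_right 0. (LBINT y:{u..1}. f y) + (LBINT y:{1<..}. f y) = (LBINT y:{u..}. f y)"
      using eventually_at_right_less[of 0] eventually_at_right_real[OF zero_less_one]
    proof eventually_elim
      case (elim u)
      have "(LBINT y:{u..1} \<union> {1<..}. f y) = (LBINT y:{u..1}. f y) + (LBINT y:{1<..}. f y)"
        using elim by (intro set_integral_Un sub) auto
      also have "{u..1} \<union> {1<..} = {u..}" using elim by auto
      finally show ?case by simp
    qed
  qed
qed

section \<open>The entire factor of the first-kind Bessel function\<close>

definition besselI_series :: "real \<Rightarrow> real \<Rightarrow> real" where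
  "besselI_series \<nu> z = (\<Sum>k. 1 / (fact k * Gamma (\<nu> + real k + 1)) * z ^ k)"

text \<open>By the functional equation Gamma(\<nu> + k + 1) is nondecreasing in k, so an exponential
  series dominates.\<close>

lemma summable_besselI_series:
  assumes "\<nu> \<ge> 0"
  shows "summable (\<lambda>k. 1 / (fact k * Gamma (\<nu> + real k + 1)) * (z::real) ^ k)"
proof (rule summable_comparison_test')
  have pos: "Gamma (\<nu> + real k + 1) > 0" for k
    using assms by (intro Gamma_real_pos) auto
  have ge: "Gamma (\<nu> + real k + 1) \<ge> Gamma (\<nu> + 1)" for k
  proof (induction k)
    case (Suc k)
    have "Gamma (\<nu> + real k + 1 + 1) = (\<nu> + real k + 1) * Gamma (\<nu> + real k + 1)"
      using assms by (intro Gamma_plus1) (auto elim!: nonpos_Ints_cases)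
    also have "\<dots> \<ge> 1 * Gamma (\<nu> + real k + 1)"
      using assms pos[of k] by (intro mult_right_mono) auto
    finally show ?case using Suc by (simp add: add_ac)
  qed simp
  show "summable (\<lambda>k. 1 / Gamma (\<nu> + 1) * (inverse (fact k) * \<bar>z\<bar> ^ k))"
    by (intro summable_mult summable_exp)
  fix k :: nat
  have "1 / (fact k * Gamma (\<nu> + real k + 1)) \<le> 1 / (fact k * Gamma (\<nu> + 1))"
    using ge[of k] pos[of 0] by (intro divide_left_mono mult_left_mono mult_pos_pos) (auto simp: pos)
  then have "1 / (fact k * Gamma (\<nu> + real k + 1)) * \<bar>z\<bar> ^ k \<le> 1 / (fact k * Gamma (\<nu> + 1)) * \<bar>z\<bar> ^ k"
    by (rule mult_right_mono) simp
  then show "norm (1 / (fact k * Gamma (\<nu> + real k + 1)) * z ^ k) \<le> 1 / Gamma (\<nu> + 1) * (inverse (fact k) * \<bar>z\<bar> ^ k)"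
    using pos[of k] by (simp add: abs_mult power_abs field_simps)
qed

lemma besselI_series_has_real_derivative:
  assumes "\<nu> \<ge> 0"
  shows "(besselI_series \<nu> has_real_derivative besselI_series (\<nu> + 1) z) (at z)"
proof -
  have "diffs (\<lambda>k. 1 / (fact k * Gamma (\<nu> + real k + 1))) = (\<lambda>k. 1 / (fact k * Gamma (\<nu> + 1 + real k + 1)))"
  proof (rule ext)
    fix k
    have "Gamma (\<nu> + real (Suc k) + 1) = Gamma (\<nu> + 1 + real k + 1)" by (rule arg_cong) simp
    then show "diffs (\<lambda>k. 1 / (fact k * Gamma (\<nu> + real k + 1))) k = 1 / (fact k * Gamma (\<nu> + 1 + real k + 1))"
      unfolding diffs_def fact_Suc by (simp del: of_nat_Suc)
  qed
  with termdiffs_strong_converges_everywhere[OF summable_besselI_series[OF assms], of z]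
  show ?thesis by (simp add: besselI_series_def[abs_def])
qed

text \<open>Since differentiation raises \<nu> by one, this is the differential equation w = (\<nu>
  + 1) w' + z w''. Coefficientwise it is the functional equation of Gamma with \<nu> + k + 1 split
  as (\<nu> + 1) + k.\<close>

lemma besselI_series_recurrence:
  assumes "\<nu> \<ge> 0"
  shows "besselI_series \<nu> z = (\<nu> + 1) * besselI_series (\<nu> + 1) z + z * besselI_series (\<nu> + 2) z"
proof -
  let ?c = "\<lambda>\<nu> k. 1 / (fact k * Gamma (\<nu> + real k + 1))"
  have sums: "(\<lambda>k. ?c \<mu> k * z ^ k) sums besselI_series \<mu> z" if "\<mu> \<ge> 0" for \<mu>
    unfolding besselI_series_def using summable_besselI_series[OF that] by (rule summable_sums)
  let ?g = "\<lambda>k. real k * ?c (\<nu> + 1) k * z ^ k"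
  have "(\<lambda>k. ?g (Suc k)) sums (z * besselI_series (\<nu> + 2) z)"
  proof -
    have "?g (Suc k) = z * (?c (\<nu> + 2) k * z ^ k)" for k
    proof -
      have "Gamma (\<nu> + 1 + real (Suc k) + 1) = Gamma (\<nu> + 2 + real k + 1)" by (rule arg_cong) simp
      then show ?thesis unfolding fact_Suc by (simp del: of_nat_Suc)
    qed
    then show ?thesis using sums_mult[OF sums[of "\<nu> + 2"], of z] assms by simp
  qed
  \<comment> \<open>The term k = 0 carries the factor k, so shifting the index leaves the sum
    unchanged.\<close>
  then have "?g sums (z * besselI_series (\<nu> + 2) z)" by (subst (asm) sums_Suc_iff) simp
  from sums_add[OF sums_mult[OF sums[of "\<nu> + 1"], of "\<nu> + 1"] this] assms
  have "(\<lambda>k. (\<nu> + 1) * (?c (\<nu> + 1) k * z ^ k) + ?g k) sums ((\<nu> + 1) * besselI_series (\<nu> + 1) z + z * besselI_series (\<nu> + 2) z)"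
    by simp
  moreover have "(\<nu> + 1) * (?c (\<nu> + 1) k * z ^ k) + ?g k = ?c \<nu> k * z ^ k" for k
  proof -
    have "Gamma (\<nu> + real k + 1 + 1) = (\<nu> + real k + 1) * Gamma (\<nu> + real k + 1)"
      using assms by (intro Gamma_plus1) (auto elim!: nonpos_Ints_cases)
    then have "Gamma (\<nu> + 1 + real k + 1) = (\<nu> + real k + 1) * Gamma (\<nu> + real k + 1)" by (simp add: add_ac)
    moreover have "(\<nu> + 1) * (?c (\<nu> + 1) k * z ^ k) + ?g k = (\<nu> + real k + 1) * (?c (\<nu> + 1) k * z ^ k)"
      by (simp add: distrib_right add_divide_distrib)
    ultimately show ?thesis using assms by (simp add: add_ac) 
  qed
  ultimately show ?thesis using sums[OF assms] by (simp add: sums_unique2)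
qed

lemma besselI_conv_series:
  assumes "x > 0" "\<nu> \<ge> 0"
  shows "besselI \<nu> x = (x / 2) powr \<nu> * besselI_series \<nu> (x\<^sup>2 / 4)"
proof -
  have term_eq: "(x / 2) powr (\<nu> + 2 * real k) / (fact k * Gamma (\<nu> + real k + 1)) =
      (x / 2) powr \<nu> * (1 / (fact k * Gamma (\<nu> + real k + 1)) * (x\<^sup>2 / 4) ^ k)" for k
  proof -
    have "(x / 2) powr (2 * real k) = (x / 2) ^ (2 * k)"
      using assms powr_realpow[of "x / 2" "2 * k"] by simp
    also have "\<dots> = (x\<^sup>2 / 4) ^ k" by (simp add: power_mult power_divide)
    finally show ?thesis by (simp add: powr_add)
  qed
  show ?thesis unfolding besselI_def besselI_series_def term_eq
    by (rule suminf_mult[OF summable_besselI_series[OF assms(2)]])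
qed

lemma besselI_series_pos:
  assumes "\<nu> \<ge> 0" "z \<ge> 0"
  shows "besselI_series \<nu> z > 0"
proof -
  have pos: "Gamma (\<nu> + real k + 1) > 0" for k
    using assms by (intro Gamma_real_pos) auto
  show ?thesis unfolding besselI_series_def
    using assms pos
    by (intro suminf_pos2[where i = 0] summable_besselI_series) (auto simp: less_imp_le)
qed

lemma besselI_series_0: "besselI_series \<nu> 0 = 1 / Gamma (\<nu> + 1)"
  unfolding besselI_series_def by (subst powser_zero) simp

section \<open>The homogeneous solutions and their flux equations\<close>

definition vgP :: "nat \<Rightarrow> real \<Rightarrow> real" where
  "vgP r u = besselI_series ((real r - 1) / 2) (u\<^sup>2 / 4) / 2 powr ((real r - 1) / 2)"

definition vgQ :: "nat \<Rightarrow> real \<Rightarrow> real" where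
  "vgQ r u = besselK ((real r - 1) / 2) u / u powr ((real r - 1) / 2)"

lemma vgP_pos: "r \<ge> 1 \<Longrightarrow> vgP r u > 0"
  unfolding vgP_def by (intro divide_pos_pos besselI_series_pos) auto

text \<open>The classical rule (u^(-\<nu>) I_\<nu>)' = u^(-\<nu>) I_(\<nu>+1); the factor u appears
  because order r + 2 divides by u^(\<nu>+1). The series in u^2/4 makes it valid at every real u, 0
  included.\<close>

lemma vgP_has_real_derivative:
  assumes "r \<ge> 1"
  shows "(vgP r has_real_derivative u * vgP (r + 2) u) (at u)"
proof -
  define \<nu> where "\<nu> = (real r - 1) / 2"
  have \<nu>: "(real (r + 2) - 1) / 2 = \<nu> + 1" "\<nu> \<ge> 0" using assms by (auto simp: \<nu>_def field_simps)
  have "((\<lambda>u. besselI_series \<nu> (u\<^sup>2 / 4)) has_real_derivative besselI_series (\<nu> + 1) (u\<^sup>2 / 4) * (u / 2)) (at u)"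
    by (rule DERIV_chain2[OF besselI_series_has_real_derivative[OF \<nu>(2)]]) (auto intro!: derivative_eq_intros)
  from DERIV_cdivide[OF this, of "2 powr \<nu>"]
  show ?thesis unfolding vgP_def[abs_def] \<nu> \<nu>_def[symmetric] by (simp add: powr_add mult.commute)
qed

lemma vgP_recurrence:
  assumes "r \<ge> 1"
  shows "vgP r u = (real r + 1) * vgP (r + 2) u + u\<^sup>2 * vgP (r + 4) u"
proof -
  define \<nu> where "\<nu> = (real r - 1) / 2"
  have \<nu>: "(real (r + 2) - 1) / 2 = \<nu> + 1" "(real (r + 4) - 1) / 2 = \<nu> + 2" "\<nu> \<ge> 0" "real r + 1 = 2 * (\<nu> + 1)"
    using assms by (auto simp: \<nu>_def field_simps)
  show ?thesis unfolding vgP_def \<nu> \<nu>_def[symmetric] besselI_series_recurrence[OF \<nu>(3), of "u\<^sup>2 / 4"]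
    by (simp add: powr_add field_simps)
qed

lemma vgP_ge: "r \<ge> 1 \<Longrightarrow> (real r + 1) * vgP (r + 2) u \<le> vgP r u"
  using vgP_recurrence[of r u] vgP_pos[of "r + 4" u] by simp

lemma vgP_0: "vgP r 0 = 1 / (2 powr ((real r - 1) / 2) * Gamma ((real r - 1) / 2 + 1))"
  by (simp add: vgP_def besselI_series_0)

text \<open>The product is u^r times the derivative of \<open>vgP r\<close>, so this is u y'' + r y'
  = u y in the divergence form (u^r y')' = u^r y.\<close>

lemma vgP_flux_has_real_derivative:
  assumes "r \<ge> 1"
  shows "((\<lambda>u. u ^ (r + 1) * vgP (r + 2) u) has_real_derivative u ^ r * vgP r u) (at u)"
proof -
  have D: "(vgP (r + 2) has_real_derivative u * vgP (r + 4) u) (at u)"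
    using vgP_has_real_derivative[of "r + 2" u] assms by (simp add: eval_nat_numeral)
  have "((\<lambda>u. u ^ (r + 1) * vgP (r + 2) u) has_real_derivative
      real (r + 1) * u ^ (r + 1 - Suc 0) * vgP (r + 2) u + u * vgP (r + 4) u * u ^ (r + 1)) (at u)"
    by (rule DERIV_mult[OF DERIV_pow D])
  also have "real (r + 1) * u ^ (r + 1 - Suc 0) * vgP (r + 2) u + u * vgP (r + 4) u * u ^ (r + 1) =
      u ^ r * ((real r + 1) * vgP (r + 2) u + u\<^sup>2 * vgP (r + 4) u)"
    by (simp add: algebra_simps power2_eq_square)
  also have "\<dots> = u ^ r * vgP r u" unfolding vgP_recurrence[OF assms, of u] by simp
  finally show ?thesis .
qed

lemma vgQ_nonneg: "vgQ r u \<ge> 0"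
  by (simp add: vgQ_def besselK_nonneg)

lemma vgQ_recurrence:
  assumes "u > 0"
  shows "u\<^sup>2 * vgQ (r + 4) u = vgQ r u + (real r + 1) * vgQ (r + 2) u"
proof -
  define \<nu> where "\<nu> = (real r - 1) / 2"
  have \<nu>: "(real (r + 2) - 1) / 2 = \<nu> + 1" "(real (r + 4) - 1) / 2 = \<nu> + 2" "real r + 1 = 2 * (\<nu> + 1)"
    by (auto simp: \<nu>_def field_simps)
  have "besselK (\<nu> + 2) u * u = 2 * (\<nu> + 1) * besselK (\<nu> + 1) u + besselK \<nu> u * u"
    using besselK_recurrence[OF assms, of "\<nu> + 1"] by (simp add: algebra_simps)
  then have "u\<^sup>2 * (besselK (\<nu> + 2) u / (u powr \<nu> * u\<^sup>2)) = besselK \<nu> u / u powr \<nu> + 2 * (\<nu> + 1) * (besselK (\<nu> + 1) u / (u powr \<nu> * u))"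
    using assms by (simp add: field_simps)
  then show ?thesis unfolding vgQ_def \<nu> \<nu>_def[symmetric] using assms by (simp add: powr_add)
qed

lemma vgQ_has_real_derivative:
  assumes "u > 0"
  shows "(vgQ r has_real_derivative - (u * vgQ (r + 2) u)) (at u)"
proof -
  define \<nu> where "\<nu> = (real r - 1) / 2"
  have \<nu>: "(real (r + 2) - 1) / 2 = \<nu> + 1" by (auto simp: \<nu>_def field_simps)
  have K: "\<nu> * besselK \<nu> u = u * (besselK (\<nu> + 1) u - besselK (\<nu> - 1) u) / 2"
    using besselK_recurrence[OF assms, of \<nu>] by simp
  have "((\<lambda>u. besselK \<nu> u / u powr \<nu>) has_real_derivative
      (- (besselK (\<nu> + 1) u + besselK (\<nu> - 1) u) / 2 * u powr \<nu> - besselK \<nu> u * (\<nu> * u powr (\<nu> - 1))) / (u powr \<nu> * u powr \<nu>)) (at u)"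
    using assms by (auto intro!: derivative_eq_intros besselK_has_real_derivative)
  also have "besselK \<nu> u * (\<nu> * u powr (\<nu> - 1)) = u * (besselK (\<nu> + 1) u - besselK (\<nu> - 1) u) / 2 * u powr (\<nu> - 1)"
    unfolding K[symmetric] by simp
  also have "(- (besselK (\<nu> + 1) u + besselK (\<nu> - 1) u) / 2 * u powr \<nu> - \<dots>) / (u powr \<nu> * u powr \<nu>) = - (u * (besselK (\<nu> + 1) u / u powr (\<nu> + 1)))"
    using assms by (simp add: powr_add powr_diff field_simps)
  finally show ?thesis unfolding vgQ_def[abs_def] \<nu> \<nu>_def[symmetric] .
qed

text \<open>The divergence form again. As \<open>vgQ r\<close> decreases, the product is minus u^r
  times its derivative; this nonnegative quantity is the one used from here on.\<close>

lemma vgQ_flux_has_real_derivative: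
  assumes "u > 0"
  shows "((\<lambda>u. u ^ (r + 1) * vgQ (r + 2) u) has_real_derivative - (u ^ r * vgQ r u)) (at u)"
proof -
  have D: "(vgQ (r + 2) has_real_derivative - (u * vgQ (r + 4) u)) (at u)"
    using vgQ_has_real_derivative[OF assms, of "r + 2"] by (simp add: eval_nat_numeral)
  have "((\<lambda>u. u ^ (r + 1) * vgQ (r + 2) u) has_real_derivative
      real (r + 1) * u ^ (r + 1 - Suc 0) * vgQ (r + 2) u + - (u * vgQ (r + 4) u) * u ^ (r + 1)) (at u)"
    by (rule DERIV_mult[OF DERIV_pow D])
  also have "real (r + 1) * u ^ (r + 1 - Suc 0) * vgQ (r + 2) u + - (u * vgQ (r + 4) u) * u ^ (r + 1) =
      u ^ r * ((real r + 1) * vgQ (r + 2) u - u\<^sup>2 * vgQ (r + 4) u)"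
    by (simp add: algebra_simps power2_eq_square)
  also have "\<dots> = - (u ^ r * vgQ r u)" unfolding vgQ_recurrence[OF assms] by simp
  finally show ?thesis .
qed

section \<open>Wronskian and boundary behaviour\<close>

text \<open>Here u^(r-1) = u^(2\<nu>): the weight that belongs to the divergence form turns
  \<open>vgQ\<close> into the integrand u^\<nu> K_\<nu>(u) of the Stein formula.\<close>

lemma vgQ_eq: "u > 0 \<Longrightarrow> u ^ (r - 1) * vgQ r u = u powr ((real r - 1) / 2) * besselK ((real r - 1) / 2) u" if "r \<ge> 1"
proof -
  assume u: "u > 0"
  have "u ^ (r - 1) = u powr (real r - 1)"
    using u that powr_realpow[of u "r - 1"] by (simp add: of_nat_diff)
  also have "\<dots> = u powr ((real r - 1) / 2) * u powr ((real r - 1) / 2)"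
    by (simp flip: powr_add)
  finally show ?thesis using u by (simp add: vgQ_def)
qed

lemma vgQ_flux_eq:
  assumes "u > 0"
  shows "u ^ (r + 1) * vgQ (r + 2) u = u powr ((real r - 1) / 2 + 1) * besselK ((real r - 1) / 2 + 1) u"
proof -
  have "(real (r + 2) - 1) / 2 = (real r - 1) / 2 + 1" by (simp add: field_simps)
  with vgQ_eq[of "r + 2" u] assms
  have "u ^ (r + 2 - 1) * vgQ (r + 2) u = u powr ((real r - 1) / 2 + 1) * besselK ((real r - 1) / 2 + 1) u"
    by (metis le_add2 one_le_numeral order_trans)
  then show ?thesis by simp
qed

lemma besselK_mono:
  assumes "x > 0" "\<bar>a\<bar> \<le> \<bar>b\<bar>"
  shows "besselK a x \<le> besselK b x"
  unfolding besselK_def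
proof (rule set_integral_mono[OF besselK_integrable besselK_integrable])
  fix t :: real
  have "cosh (a * t) = cosh \<bar>a * t\<bar>" by simp
  also have "\<dots> \<le> cosh \<bar>b * t\<bar>"
    using assms(2) by (subst cosh_real_nonneg_le_iff) (auto simp: abs_mult intro!: mult_right_mono)
  finally show "exp (- (x * cosh t)) * cosh (a * t) \<le> exp (- (x * cosh t)) * cosh (b * t)"
    by (intro mult_left_mono) auto
qed fact+

text \<open>K increases with its order, so u^r \<open>vgQ r\<close> inherits the decay of the flux
  at infinity.\<close>

lemma vgQ_le_flux:
  assumes "r \<ge> 1" "u > 0"
  shows "vgQ r u \<le> u * vgQ (r + 2) u"
proof -
  define \<nu> where "\<nu> = (real r - 1) / 2"
  have \<nu>: "(real (r + 2) - 1) / 2 = \<nu> + 1" "\<nu> \<ge> 0" using assms by (auto simp: \<nu>_def field_simps)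
  have "besselK \<nu> u / u powr \<nu> \<le> besselK (\<nu> + 1) u / u powr \<nu>"
    using assms \<nu>(2) by (intro divide_right_mono besselK_mono) auto
  then show ?thesis unfolding vgQ_def \<nu> \<nu>_def[symmetric] using assms by (simp add: powr_add)
qed

text \<open>The integrand at x is the one at 1 times exp(-(x - 1) cosh t), and cosh t \<ge> 1. This
  crude rate suffices to beat the powers of u at infinity.\<close>

lemma besselK_decay:
  assumes "x \<ge> 1"
  shows "besselK a x \<le> exp (1 - x) * besselK a 1"
proof -
  have "besselK a x \<le> (LBINT t:{0..}. exp (1 - x) * (exp (- (1 * cosh t)) * cosh (a * t)))"
    unfolding besselK_def
  proof (rule set_integral_mono)
    fix t :: real
    have "- (x * cosh t) \<le> 1 - x + - (1 * cosh t)"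
      using mult_left_mono[of 1 "cosh t" "x - 1"] assms cosh_real_ge_1[of t] by (simp add: algebra_simps)
    then have "exp (- (x * cosh t)) \<le> exp (1 - x) * exp (- (1 * cosh t))"
      unfolding exp_add[symmetric] by simp
    then show "exp (- (x * cosh t)) * cosh (a * t) \<le> exp (1 - x) * (exp (- (1 * cosh t)) * cosh (a * t))"
      unfolding mult.assoc[symmetric] by (intro mult_right_mono) auto
    show "set_integrable lborel {0..} (\<lambda>t. exp (- (x * cosh t)) * cosh (a * t))"
      using assms by (intro besselK_integrable) auto
    show "set_integrable lborel {0..} (\<lambda>t. exp (1 - x) * (exp (- (1 * cosh t)) * cosh (a * t)))"
      by (intro set_integrable_mult_right besselK_integrable) auto
  qed
  also have "\<dots> = exp (1 - x) * besselK a 1"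
    by (simp add: besselK_def)
  finally show ?thesis .
qed

lemma vgQ_flux_tendsto_at_top:
  "((\<lambda>u. u ^ (r + 1) * vgQ (r + 2) u) \<longlongrightarrow> 0) at_top"
proof (rule Lim_null_comparison)
  let ?a = "(real r - 1) / 2 + 1"
  let ?C = "besselK ?a 1 * exp 1"
  show "\<forall>\<^sub>F u in at_top. norm (u ^ (r + 1) * vgQ (r + 2) u) \<le> ?C * (u ^ (r + 1) / exp u)"
    using eventually_ge_at_top[of 1]
  proof eventually_elim
    case (elim u)
    have "u powr ?a \<le> u powr real (r + 1)" using elim by (intro powr_mono) auto
    also have "\<dots> = u ^ (r + 1)" using elim by (intro powr_realpow) auto
    finally have "u powr ?a * besselK ?a u \<le> u ^ (r + 1) * (exp (1 - u) * besselK ?a 1)"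
      using besselK_decay[OF elim, of ?a] elim by (intro mult_mono) (auto simp: besselK_nonneg)
    moreover have "norm (u ^ (r + 1) * vgQ (r + 2) u) = u powr ?a * besselK ?a u"
      using vgQ_flux_eq[of u r] vgQ_nonneg[of "r + 2" u] elim by (simp add: abs_mult besselK_nonneg)
    ultimately show ?case by (simp add: exp_diff field_simps)
  qed
  show "((\<lambda>u. ?C * (u ^ (r + 1) / exp u)) \<longlongrightarrow> 0) at_top"
    by (rule tendsto_mult_right_zero[OF tendsto_power_div_exp_0])
qed

lemma has_bochner_integral_cong_greaterThan:
  fixes f g :: "real \<Rightarrow> real"
  assumes "has_bochner_integral lborel (\<lambda>y. indicator {0..} y * f y) I" "\<And>y. 0 < y \<Longrightarrow> f y = g y"
  shows "set_integrable lborel {0<..} g" "(LBINT y:{0<..}. g y) = I"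
proof -
  have "has_bochner_integral lborel (\<lambda>y. indicator {0<..} y *\<^sub>R g y) I"
    using assms(1)
  proof (rule has_bochner_integralI_AE)
    show "AE y in lborel. indicator {0..} y * f y = indicator {0<..} y *\<^sub>R g y"
      using AE_lborel_singleton[of 0] by eventually_elim (use assms(2) in \<open>auto simp: indicator_def\<close>)
    show "(\<lambda>y. indicator {0<..} y *\<^sub>R g y) \<in> borel_measurable lborel"
    proof -
      have "(\<lambda>y. indicator {0<..} y * (indicator {0..} y * f y)) \<in> borel_measurable lborel"
        by (rule borel_measurable_times[OF _ borel_measurable_has_bochner_integral[OF assms(1)]]) simp
      also have "(\<lambda>y. indicator {0<..} y * (indicator {0..} y * f y)) = (\<lambda>y. indicator {0<..} y *\<^sub>R g y)"
        using assms(2) by (auto simp: indicator_def fun_eq_iff)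
      finally show ?thesis .
    qed
  qed
  then show "set_integrable lborel {0<..} g" "(LBINT y:{0<..}. g y) = I"
    by (auto simp: set_integrable_def set_lebesgue_integral_def has_bochner_integral_iff)
qed

lemma vgQ_weighted_integral:
  assumes "r \<ge> 1"
  shows "set_integrable lborel {0<..} (\<lambda>y. y ^ (r - 1) * vgQ r y)"
    and "(LBINT y:{0<..}. y ^ (r - 1) * vgQ r y) = 2 powr ((real r - 1) / 2 - 1) * sqrt pi * Gamma (real r / 2)"
  using has_bochner_integral_cong_greaterThan[OF besselK_moment[OF assms] vgQ_eq[OF assms, symmetric]] by blast+

lemma vgQ_weighted_integral_succ:
  assumes "r \<ge> 1"
  shows "set_integrable lborel {0<..} (\<lambda>y. y ^ r * vgQ r y)"
    and "(LBINT y:{0<..}. y ^ r * vgQ r y) = 2 powr ((real r - 1) / 2) * Gamma ((real r - 1) / 2 + 1)"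
proof -
  define \<nu> where "\<nu> = (real r - 1) / 2"
  have "y powr (\<nu> + 1) * besselK \<nu> y = y ^ r * vgQ r y" if "y > 0" for y
    using vgQ_eq[OF assms that] that assms by (simp add: powr_add mult_ac \<nu>_def power_eq_if[of _ r])
  from has_bochner_integral_cong_greaterThan[OF besselK_moment_succ this] assms
  show "set_integrable lborel {0<..} (\<lambda>y. y ^ r * vgQ r y)"
    "(LBINT y:{0<..}. y ^ r * vgQ r y) = 2 powr ((real r - 1) / 2) * Gamma ((real r - 1) / 2 + 1)"
    by (auto simp: \<nu>_def)
qed

lemma vgQ_isCont: "u > 0 \<Longrightarrow> isCont (vgQ r) u"
  using DERIV_isCont[OF vgQ_has_real_derivative] .

text \<open>The flux is an antiderivative that vanishes at infinity. As an integral it gives both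
  its limit at 0 and, through y \<ge> u, the estimate of the upper integral.\<close>

lemma vgQ_flux_eq_integral:
  assumes "r \<ge> 1" "u > 0"
  shows "(LBINT y:{u..}. y ^ r * vgQ r y) = u ^ (r + 1) * vgQ (r + 2) u"
proof -
  have "(LBINT y:{u..}. y ^ r * vgQ r y) = - 0 - - (u ^ (r + 1) * vgQ (r + 2) u)"
  proof (rule set_integral_FTC_atLeast)
    show "set_integrable lborel {u..} (\<lambda>y. y ^ r * vgQ r y)"
      by (rule set_integrable_subset[OF vgQ_weighted_integral_succ(1)[OF assms(1)]]) (use assms in auto)
    show "continuous_on {u..} (\<lambda>y. y ^ r * vgQ r y)"
      using assms by (intro continuous_intros continuous_at_imp_continuous_on ballI vgQ_isCont) auto
    show "((\<lambda>u. - (u ^ (r + 1) * vgQ (r + 2) u)) has_real_derivative x ^ r * vgQ r x) (at x)" if "u \<le> x" for x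
      using DERIV_minus[OF vgQ_flux_has_real_derivative[of x r]] that assms by simp
    show "((\<lambda>u. - (u ^ (r + 1) * vgQ (r + 2) u)) \<longlongrightarrow> - 0) at_top"
      by (intro tendsto_minus vgQ_flux_tendsto_at_top)
  qed
  then show ?thesis by simp
qed

text \<open>Letting u tend to 0 in the integral for the flux gives the full moment; this stands in
  for the leading small-argument asymptotics of K.\<close>

lemma vgQ_flux_tendsto_at_right:
  assumes "r \<ge> 1"
  shows "((\<lambda>u. u ^ (r + 1) * vgQ (r + 2) u) \<longlongrightarrow> 2 powr ((real r - 1) / 2) * Gamma ((real r - 1) / 2 + 1)) (at_right 0)"
proof (rule Lim_transform_eventually)
  show "((\<lambda>u. LBINT y:{u..}. y ^ r * vgQ r y) \<longlongrightarrow> 2 powr ((real r - 1) / 2) * Gamma ((real r - 1) / 2 + 1)) (at_right 0)"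
    using tendsto_set_integral_atLeast_at_right[OF vgQ_weighted_integral_succ(1)[OF assms]]
    by (simp add: vgQ_weighted_integral_succ(2)[OF assms])
  show "\<forall>\<^sub>F u in at_right 0. (LBINT y:{u..}. y ^ r * vgQ r y) = u ^ (r + 1) * vgQ (r + 2) u"
    using eventually_at_right_less[of 0] by eventually_elim (rule vgQ_flux_eq_integral[OF assms])
qed

lemma vgQ_antimono:
  assumes "0 < x" "x \<le> y"
  shows "vgQ r y \<le> vgQ r x"
proof (rule DERIV_nonpos_imp_nonincreasing[OF assms(2)])
  show "\<exists>d. (vgQ r has_real_derivative d) (at z) \<and> d \<le> 0" if "x \<le> z" for z
    using vgQ_has_real_derivative[of z r] vgQ_nonneg[of "r + 2" z] that assms
    by (intro exI[of _ "- (z * vgQ (r + 2) z)"]) auto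
qed

text \<open>Since \<open>vgQ r\<close> decreases, \<open>u ^ r * vgQ r u\<close> is at most \<open>r\<close> times the part over \<open>(0, u)\<close> of the
  convergent integral of \<open>y ^ (r - 1) * vgQ r y\<close>.\<close>

lemma vgQ_power_tendsto_0:
  assumes "r \<ge> 1"
  shows "((\<lambda>u. u ^ r * vgQ r u) \<longlongrightarrow> 0) (at_right 0)"
proof (rule Lim_null_comparison)
  let ?f = "\<lambda>y. y ^ (r - 1) * vgQ r y"
  note int = vgQ_weighted_integral(1)[OF assms]
  let ?g = "\<lambda>u. real r * ((LBINT y:{0<..}. ?f y) - (LBINT y:{u..}. ?f y))"
  show "(?g \<longlongrightarrow> 0) (at_right 0)"
  proof -
    have "(?g \<longlongrightarrow> real r * ((LBINT y:{0<..}. ?f y) - (LBINT y:{0<..}. ?f y))) (at_right 0)"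
      by (intro tendsto_intros tendsto_set_integral_atLeast_at_right[OF int])
    then show ?thesis by simp
  qed
  show "\<forall>\<^sub>F u in at_right 0. norm (u ^ r * vgQ r u) \<le> ?g u"
    using eventually_at_right_less[of 0]
  proof eventually_elim
    case (elim u)
    have "(LBINT y:{0<..<u} \<union> {u..}. ?f y) = (LBINT y:{0<..<u}. ?f y) + (LBINT y:{u..}. ?f y)"
      using elim by (intro set_integral_Un set_integrable_subset[OF int]) auto
    also have "{0<..<u} \<union> {u..} = {0<..}" using elim by auto
    finally have g: "?g u = real r * (LBINT y:{0<..<u}. ?f y)" by simp
    have "(LBINT y:{0<..<u}. y ^ (r - 1) * vgQ r u) \<le> (LBINT y:{0<..<u}. ?f y)"
    proof (rule set_integral_mono)
      have "set_integrable lborel {0..u} (\<lambda>y. y ^ (r - 1) * vgQ r u)"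
        by (intro borel_integrable_atLeastAtMost' continuous_intros)
      then show "set_integrable lborel {0<..<u} (\<lambda>y. y ^ (r - 1) * vgQ r u)"
        by (rule set_integrable_subset) auto
      show "set_integrable lborel {0<..<u} ?f" by (rule set_integrable_subset[OF int]) auto
      show "y ^ (r - 1) * vgQ r u \<le> ?f y" if "y \<in> {0<..<u}" for y
        using that by (intro mult_left_mono vgQ_antimono) auto
    qed
    moreover have "(LBINT y:{0<..<u}. y ^ (r - 1) * vgQ r u) = u ^ r / r * vgQ r u"
    proof -
      have "(LBINT y=0..ereal u. y ^ (r - 1) * vgQ r u) = u ^ r / r * vgQ r u - 0 ^ r / r * vgQ r u"
        unfolding zero_ereal_def
        using assms elim
        by (intro interval_integral_FTC_finite)
           (auto intro!: continuous_intros derivative_eq_intros simp flip: has_real_derivative_iff_has_vector_derivative)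
      then show ?thesis
        using elim assms by (simp add: interval_lebesgue_integral_def einterval_def zero_ereal_def greaterThanLessThan_def greaterThan_def lessThan_def Int_def zero_power)
    qed
    ultimately have "real r * (u ^ r / r * vgQ r u) \<le> ?g u"
      unfolding g by (intro mult_left_mono) auto
    then show ?case using elim assms vgQ_nonneg[of r u] by (simp add: abs_mult)
  qed
qed

text \<open>The two flux equations make the expression constant. Its value is read off at 0: the
  first term tends to \<open>vgP r 0\<close> times the limit of the flux, where powers of 2 and
  Gamma cancel, and the second is u times a convergent factor.\<close>

lemma vg_wronskian:
  assumes "r \<ge> 1" "u > 0"
  shows "vgP r u * (u ^ (r + 1) * vgQ (r + 2) u) + u ^ (r + 1) * vgP (r + 2) u * vgQ r u = 1"
proof -
  let ?W = "\<lambda>u. vgP r u * (u ^ (r + 1) * vgQ (r + 2) u) + u ^ (r + 1) * vgP (r + 2) u * vgQ r u"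
  have der: "(?W has_real_derivative 0) (at x)" if "x > 0" for x
  proof -
    note DERIV_add[OF DERIV_mult[OF vgP_has_real_derivative[OF assms(1)] vgQ_flux_has_real_derivative[OF that]]
        DERIV_mult[OF vgP_flux_has_real_derivative[OF assms(1)] vgQ_has_real_derivative[OF that]]]
    then show ?thesis by (rule DERIV_cong) (simp add: algebra_simps)
  qed
  have const: "?W x = ?W u" if "0 < x" "x < u" for x
  proof -
    have "?W u = ?W x"
    proof (rule DERIV_isconst_end[OF that(2)])
      show "continuous_on {x..u} ?W"
        by (intro continuous_at_imp_continuous_on ballI DERIV_isCont[OF der]) (use that in simp)
      show "(?W has_real_derivative 0) (at y)" if "x < y" for y
        by (rule der) (use that \<open>0 < x\<close> in simp)
    qed
    then show ?thesis by simp
  qed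
  have cont: "isCont (vgP s) 0" if "s \<ge> 1" for s
    using DERIV_isCont[OF vgP_has_real_derivative[OF that]] .
  then have P: "(vgP s \<longlongrightarrow> vgP s 0) (at_right 0)" if "s \<ge> 1" for s
    using that by (auto simp: isCont_def intro: tendsto_mono[OF at_le])
  have "(?W \<longlongrightarrow> vgP r 0 * (2 powr ((real r - 1) / 2) * Gamma ((real r - 1) / 2 + 1)) + 0 * vgP (r + 2) 0 * 0) (at_right 0)"
  proof -
    have "((\<lambda>u. vgP r u * (u ^ (r + 1) * vgQ (r + 2) u) + u * vgP (r + 2) u * (u ^ r * vgQ r u)) \<longlongrightarrow>
      vgP r 0 * (2 powr ((real r - 1) / 2) * Gamma ((real r - 1) / 2 + 1)) + 0 * vgP (r + 2) 0 * 0) (at_right 0)"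
      using assms(1) by (intro tendsto_intros P vgQ_flux_tendsto_at_right vgQ_power_tendsto_0) auto
    then show ?thesis by (simp add: mult_ac)
  qed
  moreover have "vgP r 0 * (2 powr ((real r - 1) / 2) * Gamma ((real r - 1) / 2 + 1)) = 1"
  proof -
    have "Gamma ((real r - 1) / 2 + 1) > 0" using assms(1) by (intro Gamma_real_pos) (auto intro: add_nonneg_pos)
    then show ?thesis by (simp add: vgP_0)
  qed
  ultimately have "(?W \<longlongrightarrow> 1) (at_right 0)" by simp
  moreover have "(?W \<longlongrightarrow> ?W u) (at_right 0)"
    using eventually_at_right_real[OF assms(2)]
    by (intro tendsto_eventually) (auto elim!: eventually_mono dest: const)
  ultimately show ?thesis by (intro tendsto_unique[where F = "at_right 0"]) auto
qed

section \<open>The gradient bound\<close>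

text \<open>Comparison principle started at 0, applied to a barrier plus or minus the quantity to be
  bounded. \<open>nonneg_if_deriv_nonpos_at_top\<close> is the counterpart started at
  infinity.\<close>

lemma nonneg_if_deriv_nonneg_at_right:
  fixes G :: "real \<Rightarrow> real"
  assumes "\<And>u. u > 0 \<Longrightarrow> (G has_real_derivative G' u) (at u)" "\<And>u. u > 0 \<Longrightarrow> G' u \<ge> 0"
    and lim: "(G \<longlongrightarrow> 0) (at_right 0)" and "u > 0"
  shows "G u \<ge> 0"
proof (rule tendsto_upperbound[OF lim])
  show "\<forall>\<^sub>F x in at_right 0. G x \<le> G u"
    using eventually_at_right_real[OF \<open>u > 0\<close>]
  proof eventually_elim
    case (elim x)
    show ?case
    proof (rule DERIV_nonneg_imp_nondecreasing[of x u G])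
      show "\<exists>d. (G has_real_derivative d) (at z) \<and> 0 \<le> d" if "x \<le> z" for z
        using assms(1,2)[of z] elim that by (intro exI[of _ "G' z"] conjI) auto
    qed (use elim in simp)
  qed
qed simp

lemma nonneg_if_deriv_nonpos_at_top:
  fixes G :: "real \<Rightarrow> real"
  assumes "\<And>u. u > 0 \<Longrightarrow> (G has_real_derivative G' u) (at u)" "\<And>u. u > 0 \<Longrightarrow> G' u \<le> 0"
    and lim: "(G \<longlongrightarrow> 0) at_top" and "u > 0"
  shows "G u \<ge> 0"
proof (rule tendsto_upperbound[OF lim])
  show "\<forall>\<^sub>F x in at_top. G x \<le> G u"
    using eventually_ge_at_top[of u]
  proof eventually_elim
    case (elim x)
    show ?case
    proof (rule DERIV_nonpos_imp_nonincreasing[OF elim])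
      show "\<exists>d. (G has_real_derivative d) (at z) \<and> d \<le> 0" if "u \<le> z" for z
        using assms(1,2)[of z] \<open>u > 0\<close> that by (intro exI[of _ "G' z"] conjI) auto
    qed
  qed
qed simp

lemma abs_nonneg_combination_le:
  fixes b d e f :: real
  assumes "b \<ge> 0" "d \<ge> 0"
  shows "\<bar>b * e + d * f\<bar> \<le> b * \<bar>e\<bar> + d * \<bar>f\<bar>"
  by (rule order_trans[OF abs_triangle_ineq]) (use assms in \<open>simp add: abs_mult\<close>)

lemma vgP_tendsto: "r \<ge> 1 \<Longrightarrow> (vgP r \<longlongrightarrow> vgP r 0) (at_right 0)"
  using DERIV_isCont[OF vgP_has_real_derivative, of r 0] by (auto simp: isCont_def intro: tendsto_mono[OF at_le])

lemma vgQ_power_tendsto_at_top: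
  assumes "r \<ge> 1"
  shows "((\<lambda>u. u ^ r * vgQ r u) \<longlongrightarrow> 0) at_top"
proof (rule Lim_null_comparison[OF _ vgQ_flux_tendsto_at_top])
  show "\<forall>\<^sub>F u in at_top. norm (u ^ r * vgQ r u) \<le> u ^ (r + 1) * vgQ (r + 2) u"
    using eventually_gt_at_top[of 0]
  proof eventually_elim
    case (elim u)
    have "u ^ r * vgQ r u \<le> u ^ r * (u * vgQ (r + 2) u)"
      using elim vgQ_le_flux[OF assms elim] by (intro mult_left_mono) auto
    then show ?case using elim vgQ_nonneg[of r u] by (simp add: abs_mult mult_ac)
  qed
qed

lemma vgQ_flux_div_tendsto_at_top: "((\<lambda>u. u ^ r * vgQ (r + 2) u) \<longlongrightarrow> 0) at_top"
proof (rule Lim_null_comparison[OF _ vgQ_flux_tendsto_at_top])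
  show "\<forall>\<^sub>F u in at_top. norm (u ^ r * vgQ (r + 2) u) \<le> u ^ (r + 1) * vgQ (r + 2) u"
    using eventually_ge_at_top[of 1]
  proof eventually_elim
    case (elim u)
    have "u ^ r \<le> u ^ (r + 1)" using elim by (intro power_increasing) auto
    then have "u ^ r * vgQ (r + 2) u \<le> u ^ (r + 1) * vgQ (r + 2) u"
      using vgQ_nonneg by (rule mult_right_mono)
    then show ?case using elim vgQ_nonneg[of "r + 2" u] by (simp add: abs_mult)
  qed
qed

lemma vgQ_flux_div_has_real_derivative:
  assumes "u > 0"
  shows "((\<lambda>u. u ^ r * vgQ (r + 2) u) has_real_derivative - (u ^ r * vgQ r u) / u - u ^ r * vgQ (r + 2) u / u) (at u)"
proof -
  have "((\<lambda>u. u ^ (r + 1) * vgQ (r + 2) u / u) has_real_derivative - (u ^ r * vgQ r u) / u - u ^ r * vgQ (r + 2) u / u) (at u)"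
    by (rule DERIV_cong[OF DERIV_divide[OF vgQ_flux_has_real_derivative[OF assms] DERIV_ident]])
       (use assms in \<open>auto simp: field_simps\<close>)
  moreover have "\<forall>\<^sub>F x in nhds u. x \<in> {0<..}"
    using assms by (intro eventually_nhds_in_open) auto
  then have "\<forall>\<^sub>F x in nhds u. x ^ (r + 1) * vgQ (r + 2) x / x = x ^ r * vgQ (r + 2) x"
    by eventually_elim simp
  ultimately show ?thesis by (subst (asm) DERIV_cong_ev) auto
qed

lemma vgP_flux_div_has_real_derivative:
  assumes "r \<ge> 1" "u > 0"
  shows "((\<lambda>u. u ^ r * vgP (r + 2) u) has_real_derivative u ^ r * vgP r u / u - u ^ r * vgP (r + 2) u / u) (at u)"
proof -
  have "((\<lambda>u. u ^ (r + 1) * vgP (r + 2) u / u) has_real_derivative u ^ r * vgP r u / u - u ^ r * vgP (r + 2) u / u) (at u)"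
    by (rule DERIV_cong[OF DERIV_divide[OF vgP_flux_has_real_derivative[OF assms(1)] DERIV_ident]])
       (use assms in \<open>auto simp: field_simps\<close>)
  moreover have "\<forall>\<^sub>F x in nhds u. x \<in> {0<..}"
    using assms by (intro eventually_nhds_in_open) auto
  then have "\<forall>\<^sub>F x in nhds u. x ^ (r + 1) * vgP (r + 2) x / x = x ^ r * vgP (r + 2) x"
    by eventually_elim simp
  ultimately show ?thesis by (subst (asm) DERIV_cong_ev) auto
qed

text \<open>The derivative exceeds u^(r-1) \<open>vgP r u\<close> by a nonnegative term for u > 0,
  which makes this function an upper barrier for integrals of u^(r-1) \<open>vgP r u\<close> from
  0.\<close>

lemma vgP_power_has_real_derivative:
  fixes r :: nat
  assumes "r \<ge> 1" "u > 0"
  shows "((\<lambda>u. u ^ r * vgP r u / r) has_real_derivative u ^ r * vgP r u / u + u ^ (r + 1) * vgP (r + 2) u / r) (at u)"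
proof -
  have "u ^ r = u * u ^ (r - 1)" using assms by (simp add: power_eq_if)
  then show ?thesis
    by (intro DERIV_cong[OF DERIV_cdivide[OF DERIV_mult[OF DERIV_pow vgP_has_real_derivative[OF assms(1)]]]])
       (use assms in \<open>auto simp: field_simps\<close>)
qed

lemma vgP_vgQ_flux_le_1:
  assumes "r \<ge> 1" "u > 0"
  shows "vgP r u * (u ^ (r + 1) * vgQ (r + 2) u) \<le> 1"
proof -
  have "0 \<le> u ^ (r + 1) * vgP (r + 2) u * vgQ r u"
    using assms vgP_pos[of "r + 2" u] vgQ_nonneg[of r u] by simp
  then show ?thesis using vg_wronskian[OF assms] by linarith
qed

text \<open>The two terms are bounded by the Wronskian identity and \<open>vgP_ge\<close>, respectively.\<close>

lemma vg_gradient_weight_le: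
  fixes r :: nat
  assumes "r \<ge> 1" "u > 0"
  shows "u ^ (r + 1) * vgQ (r + 2) u * (vgP r u / r) + vgP (r + 2) u * (u ^ (r + 1) * vgQ (r + 2) u) \<le> 2 / r"
proof -
  let ?B = "u ^ (r + 1) * vgQ (r + 2) u"
  have B: "?B \<ge> 0" using assms vgQ_nonneg by (intro mult_nonneg_nonneg) auto
  have "vgP (r + 2) u \<le> vgP r u / (real r + 1)"
    using vgP_ge[OF assms(1), of u] by (simp add: field_simps)
  also have "\<dots> \<le> vgP r u / r" using assms vgP_pos[OF assms(1), of u] by (intro divide_left_mono) auto
  finally have "vgP (r + 2) u * ?B \<le> vgP r u / r * ?B" using B by (rule mult_right_mono)
  moreover have "vgP r u / r * ?B \<le> 1 / r"
    using divide_right_mono[OF vgP_vgQ_flux_le_1[OF assms], of "real r"] by simp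
  moreover have "vgP r u / r * ?B = ?B * (vgP r u / r)" "2 / real r = 1 / r + 1 / r" by auto
  ultimately show ?thesis by linarith
qed

text \<open>\<open>E\<close> and \<open>F\<close> are the Wronskians of \<open>\<phi>\<close> with \<open>vgP r\<close> and \<open>vgQ r\<close>; their derivatives are
  \<open>u ^ (r - 1) * R u\<close> times \<open>vgP r u\<close> and \<open>vgQ r u\<close>, so both can be compared with explicit barriers.
  By the Wronskian identity a positive combination of \<open>E\<close> and \<open>F\<close> is \<open>u ^ r * \<phi>1 u\<close>.\<close>

lemma vg_gradient_bound:
  fixes r :: nat and \<phi> \<phi>1 \<phi>2 R :: "real \<Rightarrow> real"
  assumes r: "r \<ge> 1"
    and d0: "\<And>u. u > 0 \<Longrightarrow> (\<phi> has_real_derivative \<phi>1 u) (at u)"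
    and d1: "\<And>u. u > 0 \<Longrightarrow> (\<phi>1 has_real_derivative \<phi>2 u) (at u)"
    and ode: "\<And>u. u > 0 \<Longrightarrow> u * \<phi>2 u + r * \<phi>1 u - u * \<phi> u = R u"
    and R: "\<And>u. u > 0 \<Longrightarrow> \<bar>R u\<bar> \<le> M"
    and bd: "\<And>u. u > 0 \<Longrightarrow> \<bar>\<phi> u\<bar> \<le> C" "\<And>u. u > 0 \<Longrightarrow> \<bar>\<phi>1 u\<bar> \<le> C"
    and u: "u > 0"
  shows "\<bar>\<phi>1 u\<bar> \<le> 2 / r * M"
proof -
  let ?B = "\<lambda>u. u ^ (r + 1) * vgQ (r + 2) u" and ?D = "\<lambda>u. u ^ (r + 1) * vgP (r + 2) u"
  let ?E = "\<lambda>u. u ^ r * vgP r u * \<phi>1 u - \<phi> u * ?D u"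
  let ?F = "\<lambda>u. u ^ r * vgQ r u * \<phi>1 u + \<phi> u * ?B u"
  have pow: "u ^ r = u * u ^ (r - 1)" for u :: real using r by (simp add: power_eq_if)
  have dE: "(?E has_real_derivative u ^ (r - 1) * vgP r u * R u) (at u)" if "u > 0" for u
    by (rule DERIV_cong[OF DERIV_diff[OF DERIV_mult[OF DERIV_mult[OF DERIV_pow vgP_has_real_derivative[OF r]] d1[OF that]]
          DERIV_mult[OF d0[OF that] vgP_flux_has_real_derivative[OF r]]]])
       (simp add: ode[OF that, symmetric] pow algebra_simps)
  have dF: "(?F has_real_derivative u ^ (r - 1) * vgQ r u * R u) (at u)" if "u > 0" for u
    by (rule DERIV_cong[OF DERIV_add[OF DERIV_mult[OF DERIV_mult[OF DERIV_pow vgQ_has_real_derivative[OF that]] d1[OF that]]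
          DERIV_mult[OF d0[OF that] vgQ_flux_has_real_derivative[OF that]]]])
       (simp add: ode[OF that, symmetric] pow algebra_simps)
  have C: "C \<ge> 0" using bd(1)[OF u] by simp
  \<comment> \<open>Boundedness of \<open>\<phi>\<close> and \<open>\<phi>1\<close> enters through
    this limit and that of \<open>?F\<close> at infinity; C leaves no trace in the final
    constant.\<close>
  have E0: "(?E \<longlongrightarrow> 0) (at_right 0)"
  proof (rule Lim_null_comparison)
    show "\<forall>\<^sub>F u in at_right 0. norm (?E u) \<le> C * (u ^ r * vgP r u + ?D u)"
      using eventually_at_right_less[of 0]
    proof eventually_elim
      case (elim u)
      have "norm (?E u) \<le> u ^ r * vgP r u * \<bar>\<phi>1 u\<bar> + \<bar>\<phi> u\<bar> * ?D u"
        using elim vgP_pos[OF r, of u] vgP_pos[of "r + 2" u]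
        by (intro order_trans[OF norm_triangle_ineq4]) (simp add: abs_mult)
      also have "\<dots> \<le> u ^ r * vgP r u * C + C * ?D u"
        using elim vgP_pos[OF r, of u] vgP_pos[of "r + 2" u] bd[OF elim]
        by (intro add_mono mult_mono) auto
      finally show ?case by (simp add: algebra_simps)
    qed
    have "((\<lambda>u. C * (u ^ r * vgP r u + ?D u)) \<longlongrightarrow> C * (0 ^ r * vgP r 0 + 0 ^ (r + 1) * vgP (r + 2) 0)) (at_right 0)"
      using r by (intro tendsto_intros vgP_tendsto) auto
    then show "((\<lambda>u. C * (u ^ r * vgP r u + ?D u)) \<longlongrightarrow> 0) (at_right 0)" using r by (simp add: power_0_left)
  qed
  have Finf: "(?F \<longlongrightarrow> 0) at_top"
  proof (rule Lim_null_comparison)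
    show "\<forall>\<^sub>F u in at_top. norm (?F u) \<le> C * (u ^ r * vgQ r u + ?B u)"
      using eventually_gt_at_top[of 0]
    proof eventually_elim
      case (elim u)
      have "norm (?F u) \<le> u ^ r * vgQ r u * \<bar>\<phi>1 u\<bar> + \<bar>\<phi> u\<bar> * ?B u"
        using elim vgQ_nonneg[of r u] vgQ_nonneg[of "r + 2" u]
        by (intro order_trans[OF norm_triangle_ineq]) (simp add: abs_mult)
      also have "\<dots> \<le> u ^ r * vgQ r u * C + C * ?B u"
        using elim vgQ_nonneg[of r u] vgQ_nonneg[of "r + 2" u] bd[OF elim]
        by (intro add_mono mult_mono) auto
      finally show ?case by (simp add: algebra_simps)
    qed
    show "((\<lambda>u. C * (u ^ r * vgQ r u + ?B u)) \<longlongrightarrow> 0) at_top"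
      using tendsto_mult[OF tendsto_const tendsto_add[OF vgQ_power_tendsto_at_top[OF r] vgQ_flux_tendsto_at_top[of r]], of C] by simp
  qed
  have P0: "((\<lambda>u. u ^ r * vgP r u / r) \<longlongrightarrow> 0) (at_right 0)"
  proof -
    have "((\<lambda>u. u ^ r * vgP r u / r) \<longlongrightarrow> 0 ^ r * vgP r 0 / r) (at_right 0)"
      using r by (intro tendsto_intros vgP_tendsto) auto
    then show ?thesis using r by (simp add: power_0_left)
  qed
  have E: "\<bar>?E u\<bar> \<le> M * (u ^ r * vgP r u / r)"
  proof -
    \<comment> \<open>The sign s treats both halves of the absolute value at once; the derivative is
      nonnegative because M dominates R.\<close>
    have "M * (u ^ r * vgP r u / r) + s * ?E u \<ge> 0" if s: "s = 1 \<or> s = -1" for s :: real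
    proof (rule nonneg_if_deriv_nonneg_at_right[OF _ _ _ u])
      show "((\<lambda>u. M * (u ^ r * vgP r u / r) + s * ?E u) has_real_derivative
          M * (x ^ r * vgP r x / x + x ^ (r + 1) * vgP (r + 2) x / r) + s * (x ^ (r - 1) * vgP r x * R x)) (at x)" if "x > 0" for x
        by (intro DERIV_add DERIV_cmult vgP_power_has_real_derivative dE r that)
      show "0 \<le> M * (x ^ r * vgP r x / x + x ^ (r + 1) * vgP (r + 2) x / r) + s * (x ^ (r - 1) * vgP r x * R x)" if "x > 0" for x
      proof -
        have M: "M \<ge> 0" "M + s * R x \<ge> 0" using R[OF that] s by auto
        have "M * (x ^ r * vgP r x / x + x ^ (r + 1) * vgP (r + 2) x / r) + s * (x ^ (r - 1) * vgP r x * R x) =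
            x ^ (r - 1) * vgP r x * (M + s * R x) + M * (x ^ (r + 1) * vgP (r + 2) x / r)"
          using that by (simp add: pow algebra_simps)
        also have "\<dots> \<ge> 0"
          by (intro add_nonneg_nonneg mult_nonneg_nonneg[OF _ M(2)] mult_nonneg_nonneg[OF M(1)])
             (use that vgP_pos[OF r, of x] vgP_pos[of "r + 2" x] in auto)
        finally show ?thesis .
      qed
      show "((\<lambda>u. M * (u ^ r * vgP r u / r) + s * ?E u) \<longlongrightarrow> 0) (at_right 0)"
        using tendsto_add[OF tendsto_mult[OF tendsto_const P0, of M] tendsto_mult[OF tendsto_const E0, of s]] by simp
    qed
    from this[of 1] this[of "-1"] show ?thesis by (simp add: abs_le_iff)
  qed
  have F: "\<bar>?F u\<bar> \<le> M * (u ^ r * vgQ (r + 2) u)"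
  proof -
    have "M * (u ^ r * vgQ (r + 2) u) + s * ?F u \<ge> 0" if s: "s = 1 \<or> s = -1" for s :: real
    proof (rule nonneg_if_deriv_nonpos_at_top[OF _ _ _ u])
      show "((\<lambda>u. M * (u ^ r * vgQ (r + 2) u) + s * ?F u) has_real_derivative
          M * (- (x ^ r * vgQ r x) / x - x ^ r * vgQ (r + 2) x / x) + s * (x ^ (r - 1) * vgQ r x * R x)) (at x)" if "x > 0" for x
        by (intro DERIV_add DERIV_cmult vgQ_flux_div_has_real_derivative dF that)
      show "M * (- (x ^ r * vgQ r x) / x - x ^ r * vgQ (r + 2) x / x) + s * (x ^ (r - 1) * vgQ r x * R x) \<le> 0" if "x > 0" for x
      proof -
        have M: "M \<ge> 0" "M - s * R x \<ge> 0" using R[OF that] s by auto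
        have "M * (- (x ^ r * vgQ r x) / x - x ^ r * vgQ (r + 2) x / x) + s * (x ^ (r - 1) * vgQ r x * R x) =
            - (x ^ (r - 1) * vgQ r x * (M - s * R x) + M * (x ^ r * vgQ (r + 2) x / x))"
          using that by (simp add: pow algebra_simps)
        also have "\<dots> \<le> 0"
          unfolding neg_le_0_iff_le
          by (intro add_nonneg_nonneg mult_nonneg_nonneg[OF _ M(2)] mult_nonneg_nonneg[OF M(1)])
             (use that vgQ_nonneg[of r x] vgQ_nonneg[of "r + 2" x] in auto)
        finally show ?thesis .
      qed
      show "((\<lambda>u. M * (u ^ r * vgQ (r + 2) u) + s * ?F u) \<longlongrightarrow> 0) at_top"
        using tendsto_add[OF tendsto_mult[OF tendsto_const vgQ_flux_div_tendsto_at_top[of r], of M] tendsto_mult[OF tendsto_const Finf, of s]] by simp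
    qed
    from this[of 1] this[of "-1"] show ?thesis by (simp add: abs_le_iff)
  qed
  have B: "?B u \<ge> 0" and D: "?D u \<ge> 0"
    using u vgQ_nonneg[of "r + 2" u] vgP_pos[of "r + 2" u] by auto
  have M: "M \<ge> 0" using R[OF u] by simp
  have "?B u * ?E u + ?D u * ?F u = u ^ r * \<phi>1 u * (vgP r u * ?B u + ?D u * vgQ r u)"
    by (simp add: algebra_simps)
  also have "\<dots> = u ^ r * \<phi>1 u" unfolding vg_wronskian[OF r u] by simp
  finally have "u ^ r * \<bar>\<phi>1 u\<bar> = \<bar>?B u * ?E u + ?D u * ?F u\<bar>" using u by (simp add: abs_mult)
  also have "\<dots> \<le> ?B u * \<bar>?E u\<bar> + ?D u * \<bar>?F u\<bar>"
    by (rule abs_nonneg_combination_le[OF B D])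
  also have "\<dots> \<le> ?B u * (M * (u ^ r * vgP r u / r)) + ?D u * (M * (u ^ r * vgQ (r + 2) u))"
    by (intro add_mono mult_left_mono E F B D)
  also have "\<dots> = u ^ r * (M * (?B u * (vgP r u / r) + vgP (r + 2) u * ?B u))"
    by (simp add: algebra_simps)
  also have "\<dots> \<le> u ^ r * (M * (2 / r))"
    using u M by (intro mult_left_mono vg_gradient_weight_le r) auto
  finally have "\<bar>\<phi>1 u\<bar> \<le> M * (2 / r)" using u by (subst (asm) mult_le_cancel_left_pos) auto
  then show ?thesis by (simp add: mult.commute)
qed

section \<open>The solution on the half-line\<close>

definition vg_lower :: "nat \<Rightarrow> (real \<Rightarrow> real) \<Rightarrow> real \<Rightarrow> real" where
  "vg_lower r R u = integral {0..u} (\<lambda>y. y ^ (r - 1) * vgP r y * R y)"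

definition vg_upper :: "nat \<Rightarrow> (real \<Rightarrow> real) \<Rightarrow> real \<Rightarrow> real" where
  "vg_upper r R u = (LBINT y:{u..}. y ^ (r - 1) * vgQ r y * R y)"

text \<open>Variation of parameters for (u^r y')' - u^r y = u^(r-1) R, the divergence form of u y''
  + r y' - u y = R. The Wronskian is normalised to 1, so no further factor occurs.\<close>

definition vg_half :: "nat \<Rightarrow> (real \<Rightarrow> real) \<Rightarrow> real \<Rightarrow> real" where
  "vg_half r R u = - (vgQ r u * vg_lower r R u) - vgP r u * vg_upper r R u"

text \<open>The derivative of \<open>vg_half\<close>: the terms from differentiating the two
  integrals cancel, which leaves only the derivatives of \<open>vgQ\<close> and
  \<open>vgP\<close>.\<close>

definition vg_half' :: "nat \<Rightarrow> (real \<Rightarrow> real) \<Rightarrow> real \<Rightarrow> real" where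
  "vg_half' r R u = u * vgQ (r + 2) u * vg_lower r R u - u * vgP (r + 2) u * vg_upper r R u"

lemma vgP_continuous_on: "r \<ge> 1 \<Longrightarrow> continuous_on A (vgP r)"
  by (intro continuous_at_imp_continuous_on ballI DERIV_isCont[OF vgP_has_real_derivative])

lemma vg_lower_has_real_derivative:
  assumes "r \<ge> 1" "continuous_on UNIV R" "u > 0"
  shows "(vg_lower r R has_real_derivative u ^ (r - 1) * vgP r u * R u) (at u)"
proof -
  have "continuous_on {0..u + 1} (\<lambda>y. y ^ (r - 1) * vgP r y * R y)"
    by (intro continuous_intros vgP_continuous_on assms(1) continuous_on_subset[OF assms(2)]) auto
  from integral_has_real_derivative[OF this, of u] assms(3)
  have "(vg_lower r R has_real_derivative u ^ (r - 1) * vgP r u * R u) (at u within {0..u + 1})"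
    by (simp add: vg_lower_def[abs_def])
  then show ?thesis using assms(3) by (subst (asm) at_within_interior) auto
qed

lemma vgQ_weighted_integrable:
  assumes "r \<ge> 1" "continuous_on UNIV R" "\<And>y. \<bar>R y\<bar> \<le> M"
  shows "set_integrable lborel {0<..} (\<lambda>y. y ^ (r - 1) * vgQ r y * R y)"
proof (rule set_integrable_bound)
  show "set_integrable lborel {0<..} (\<lambda>y. y ^ (r - 1) * vgQ r y * M)"
    by (intro set_integrable_mult_left vgQ_weighted_integral assms)
  have "continuous_on {0<..} (\<lambda>y. y ^ (r - 1) * vgQ r y * R y)"
    by (intro continuous_intros continuous_at_imp_continuous_on[of _ "vgQ r"] ballI vgQ_isCont continuous_on_subset[OF assms(2)]) auto
  from borel_measurable_continuous_on_indicator[OF _ this]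
  show "set_borel_measurable lborel {0<..} (\<lambda>y. y ^ (r - 1) * vgQ r y * R y)"
    by (simp add: set_borel_measurable_def)
  show "AE y in lborel. y \<in> {0<..} \<longrightarrow> norm (y ^ (r - 1) * vgQ r y * R y) \<le> norm (y ^ (r - 1) * vgQ r y * M)"
  proof (intro AE_I2 impI)
    fix y :: real
    have "\<bar>R y\<bar> \<le> \<bar>M\<bar>" using assms(3)[of y] by linarith
    then show "norm (y ^ (r - 1) * vgQ r y * R y) \<le> norm (y ^ (r - 1) * vgQ r y * M)"
      by (auto simp: abs_mult intro!: mult_left_mono)
  qed
qed

lemma vg_upper_has_real_derivative:
  assumes "r \<ge> 1" "continuous_on UNIV R" "\<And>y. \<bar>R y\<bar> \<le> M" "u > 0"
  shows "(vg_upper r R has_real_derivative - (u ^ (r - 1) * vgQ r u * R u)) (at u)"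
proof -
  let ?f = "\<lambda>y. y ^ (r - 1) * vgQ r y * R y"
  \<comment> \<open>A base point away from the singularity of \<open>vgQ\<close> at 0: near u the
    upper integral is a constant minus an integral of a continuous function.\<close>
  define c where "c = u / 2"
  have c: "0 < c" "c < u" using assms(4) by (auto simp: c_def)
  have cont: "continuous_on {c..u + 1} ?f"
    using c by (intro continuous_intros continuous_at_imp_continuous_on[of _ "vgQ r"] ballI vgQ_isCont continuous_on_subset[OF assms(2)]) auto
  have "((\<lambda>x. integral {c..x} ?f) has_real_derivative ?f u) (at u within {c..u + 1})"
    using c by (intro integral_has_real_derivative[OF cont]) auto
  then have "((\<lambda>x. integral {c..x} ?f) has_real_derivative ?f u) (at u)"
    using c by (subst (asm) at_within_interior) auto
  then have D: "((\<lambda>x. (LBINT y:{c..}. ?f y) - integral {c..x} ?f) has_real_derivative 0 - ?f u) (at u)"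
    by (intro DERIV_diff DERIV_const)
  have "\<forall>\<^sub>F x in nhds u. x \<in> {c<..<u + 1}"
    using c by (intro eventually_nhds_in_open) auto
  then have ev: "\<forall>\<^sub>F x in nhds u. (LBINT y:{c..}. ?f y) - integral {c..x} ?f = vg_upper r R x"
  proof eventually_elim
    case (elim x)
    have int: "set_integrable lborel S ?f" if "S \<in> sets borel" "S \<subseteq> {0<..}" for S
      using vgQ_weighted_integrable[OF assms(1-3)] that by (rule_tac set_integrable_subset) auto
    have "(LBINT y:{c..x} \<union> {x<..}. ?f y) = (LBINT y:{c..x}. ?f y) + (LBINT y:{x<..}. ?f y)"
      using elim c by (intro set_integral_Un int) auto
    also have "{c..x} \<union> {x<..} = {c..}" using elim by auto
    also have "(LBINT y:{c..x}. ?f y) = integral {c..x} ?f"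
      using elim c by (intro set_borel_integral_eq_integral int) auto
    also have "(LBINT y:{x<..}. ?f y) = vg_upper r R x"
      unfolding vg_upper_def set_lebesgue_integral_def
    proof (rule integral_cong_AE)
      show "(\<lambda>y. indicator {x<..} y *\<^sub>R ?f y) \<in> borel_measurable lborel" "(\<lambda>y. indicator {x..} y *\<^sub>R ?f y) \<in> borel_measurable lborel"
        by (intro borel_measurable_integrable int[unfolded set_integrable_def]; use elim c in force)+
      show "AE y in lborel. indicator {x<..} y *\<^sub>R ?f y = indicator {x..} y *\<^sub>R ?f y"
        using AE_lborel_singleton[of x] by eventually_elim (auto simp: indicator_def)
    qed
    finally show ?case by simp
  qed
  from D show ?thesis by (subst (asm) DERIV_cong_ev[OF refl ev refl]) simp
qed

lemma vg_lower_bound: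
  assumes "r \<ge> 1" "continuous_on UNIV R" "\<And>y. \<bar>R y\<bar> \<le> M" "u > 0"
  shows "\<bar>vg_lower r R u\<bar> \<le> M * vg_lower r (\<lambda>_. 1) u"
proof -
  have int: "(\<lambda>y. y ^ (r - 1) * vgP r y * R y) integrable_on {0..u}" if "continuous_on UNIV R" for R
    by (intro integrable_continuous_interval continuous_intros vgP_continuous_on assms(1) continuous_on_subset[OF that]) auto
  have "norm (integral {0..u} (\<lambda>y. y ^ (r - 1) * vgP r y * R y)) \<le> integral {0..u} (\<lambda>y. y ^ (r - 1) * vgP r y * M)"
  proof (rule integral_norm_bound_integral[OF int[OF assms(2)] int[OF continuous_on_const]])
    show "norm (y ^ (r - 1) * vgP r y * R y) \<le> y ^ (r - 1) * vgP r y * M" if "y \<in> {0..u}" for y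
      using that vgP_pos[OF assms(1), of y] assms(3)[of y] by (auto simp: abs_mult intro!: mult_left_mono)
  qed
  then show ?thesis by (simp add: vg_lower_def mult.commute)
qed

lemma vg_upper_bound:
  assumes "r \<ge> 1" "continuous_on UNIV R" "\<And>y. \<bar>R y\<bar> \<le> M" "u > 0"
  shows "\<bar>vg_upper r R u\<bar> \<le> M * vg_upper r (\<lambda>_. 1) u"
proof -
  have int: "set_integrable lborel {u..} (\<lambda>y. y ^ (r - 1) * vgQ r y * R y)"
    if "continuous_on UNIV R" "\<And>y. \<bar>R y\<bar> \<le> M" for R M
    using vgQ_weighted_integrable[OF assms(1) that] assms(4) by (rule_tac set_integrable_subset) auto
  have "norm (LBINT y:{u..}. y ^ (r - 1) * vgQ r y * R y) \<le> (LBINT y:{u..}. norm (y ^ (r - 1) * vgQ r y * R y))"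
    by (intro set_integral_norm_bound int[OF assms(2,3)])
  also have "\<dots> \<le> (LBINT y:{u..}. M * (y ^ (r - 1) * vgQ r y * 1))"
  proof (rule set_integral_mono)
    show "norm (y ^ (r - 1) * vgQ r y * R y) \<le> M * (y ^ (r - 1) * vgQ r y * 1)" if "y \<in> {u..}" for y
      using that assms(4) vgQ_nonneg[of r y] assms(3)[of y]
      by (subst mult.commute[of M]) (auto simp: abs_mult intro!: mult_left_mono)
    show "set_integrable lborel {u..} (\<lambda>y. norm (y ^ (r - 1) * vgQ r y * R y))"
      using set_integrable_abs[OF int[OF assms(2,3)]] by simp
    show "set_integrable lborel {u..} (\<lambda>y. M * (y ^ (r - 1) * vgQ r y * 1))"
      by (intro set_integrable_mult_right int[where M = 1]) auto
  qed
  finally show ?thesis by (simp add: vg_upper_def)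
qed

lemma vg_lower_tendsto:
  assumes "r \<ge> 1" "continuous_on UNIV R"
  shows "(vg_lower r R \<longlongrightarrow> 0) (at_right 0)"
proof -
  have "continuous_on {0..1} (\<lambda>u. integral {0..u} (\<lambda>y. y ^ (r - 1) * vgP r y * R y))"
    by (intro indefinite_integral_continuous_1 integrable_continuous_interval continuous_intros vgP_continuous_on assms(1)
        continuous_on_subset[OF assms(2)]) auto
  then have "((\<lambda>u. integral {0..u} (\<lambda>y. y ^ (r - 1) * vgP r y * R y)) \<longlongrightarrow>
      integral {0..0} (\<lambda>y. y ^ (r - 1) * vgP r y * R y)) (at 0 within {0..1})"
    unfolding continuous_on_def by (rule bspec) simp
  then show ?thesis by (simp add: at_within_Icc_at_right vg_lower_def[abs_def])
qed

lemma vg_lower_1_le: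
  assumes "r \<ge> 1" "u > 0"
  shows "vg_lower r (\<lambda>_. 1) u \<le> u ^ r * vgP r u / r"
proof -
  have "0 \<le> u ^ r * vgP r u / r - vg_lower r (\<lambda>_. 1) u"
  proof (rule nonneg_if_deriv_nonneg_at_right[OF _ _ _ assms(2)])
    show "((\<lambda>u. u ^ r * vgP r u / r - vg_lower r (\<lambda>_. 1) u) has_real_derivative
        (x ^ r * vgP r x / x + x ^ (r + 1) * vgP (r + 2) x / r) - x ^ (r - 1) * vgP r x * 1) (at x)" if "x > 0" for x
      by (intro DERIV_diff vgP_power_has_real_derivative vg_lower_has_real_derivative assms(1) that) auto
    show "0 \<le> (x ^ r * vgP r x / x + x ^ (r + 1) * vgP (r + 2) x / r) - x ^ (r - 1) * vgP r x * 1" if "x > 0" for x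
    proof -
      have "x ^ r = x * x ^ (r - 1)" using assms(1) by (simp add: power_eq_if[of x r])
      then show ?thesis using that vgP_pos[of "r + 2" x] by simp
    qed
    have "((\<lambda>u. u ^ r * vgP r u / r - vg_lower r (\<lambda>_. 1) u) \<longlongrightarrow> 0 ^ r * vgP r 0 / r - 0) (at_right 0)"
      using assms(1) by (intro tendsto_intros vgP_tendsto vg_lower_tendsto) auto
    then show "((\<lambda>u. u ^ r * vgP r u / r - vg_lower r (\<lambda>_. 1) u) \<longlongrightarrow> 0) (at_right 0)"
      using assms(1) by (simp add: power_0_left)
  qed
  then show ?thesis by simp
qed

text \<open>The barrier grows slower than the integral by the nonnegative term x^(r-1)
  \<open>vgP (r + 2) x\<close>. It is the partner of \<open>vg_upper_1_le\<close>: together they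
  decide the sign of \<open>vg_half'\<close> for R = 1.\<close>

lemma vg_lower_1_ge:
  assumes "r \<ge> 1" "u > 0"
  shows "u ^ r * vgP (r + 2) u \<le> vg_lower r (\<lambda>_. 1) u"
proof -
  have "0 \<le> vg_lower r (\<lambda>_. 1) u - u ^ r * vgP (r + 2) u"
  proof (rule nonneg_if_deriv_nonneg_at_right[OF _ _ _ assms(2)])
    show "((\<lambda>u. vg_lower r (\<lambda>_. 1) u - u ^ r * vgP (r + 2) u) has_real_derivative
        x ^ (r - 1) * vgP r x * 1 - (x ^ r * vgP r x / x - x ^ r * vgP (r + 2) x / x)) (at x)" if "x > 0" for x
      by (intro DERIV_diff vgP_flux_div_has_real_derivative vg_lower_has_real_derivative assms(1) that) auto
    show "0 \<le> x ^ (r - 1) * vgP r x * 1 - (x ^ r * vgP r x / x - x ^ r * vgP (r + 2) x / x)" if "x > 0" for x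
    proof -
      have "x ^ r = x * x ^ (r - 1)" using assms(1) by (simp add: power_eq_if[of x r])
      then show ?thesis using that vgP_pos[of "r + 2" x] by simp
    qed
    have "((\<lambda>u. vg_lower r (\<lambda>_. 1) u - u ^ r * vgP (r + 2) u) \<longlongrightarrow> 0 - 0 ^ r * vgP (r + 2) 0) (at_right 0)"
      using assms(1) by (intro tendsto_intros vgP_tendsto vg_lower_tendsto) auto
    then show "((\<lambda>u. vg_lower r (\<lambda>_. 1) u - u ^ r * vgP (r + 2) u) \<longlongrightarrow> 0) (at_right 0)"
      using assms(1) by (simp add: power_0_left)
  qed
  then show ?thesis by simp
qed

text \<open>On y \<ge> u one has u y^(r-1) \<le> y^r, and the integral of y^r \<open>vgQ r y\<close>
  is exactly the flux.\<close>

lemma vg_upper_1_le: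
  assumes "r \<ge> 1" "u > 0"
  shows "vg_upper r (\<lambda>_. 1) u \<le> u ^ r * vgQ (r + 2) u"
proof -
  have int: "set_integrable lborel {u..} (\<lambda>y. y ^ (r - 1) * vgQ r y)"
    using vgQ_weighted_integral(1)[OF assms(1)] assms(2) by (rule_tac set_integrable_subset) auto
  have int': "set_integrable lborel {u..} (\<lambda>y. y ^ r * vgQ r y)"
    using vgQ_weighted_integral_succ(1)[OF assms(1)] assms(2) by (rule_tac set_integrable_subset) auto
  have "u * vg_upper r (\<lambda>_. 1) u = (LBINT y:{u..}. u * (y ^ (r - 1) * vgQ r y))"
    by (simp add: vg_upper_def)
  also have "\<dots> \<le> (LBINT y:{u..}. y ^ r * vgQ r y)"
  proof (rule set_integral_mono[OF _ int'])
    show "set_integrable lborel {u..} (\<lambda>y. u * (y ^ (r - 1) * vgQ r y))"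
      by (intro set_integrable_mult_right int)
    show "u * (y ^ (r - 1) * vgQ r y) \<le> y ^ r * vgQ r y" if "y \<in> {u..}" for y
    proof -
      have "u * (y ^ (r - 1) * vgQ r y) \<le> y * (y ^ (r - 1) * vgQ r y)"
        using that assms(2) vgQ_nonneg by (intro mult_right_mono mult_nonneg_nonneg) auto
      then show ?thesis using assms(1) by (simp add: power_eq_if[of y r])
    qed
  qed
  also have "\<dots> = u * (u ^ r * vgQ (r + 2) u)"
    using vgQ_flux_eq_integral[OF assms] by simp
  finally show ?thesis using assms(2) by simp
qed

lemma vg_half_has_real_derivative:
  assumes "r \<ge> 1" "continuous_on UNIV R" "\<And>y. \<bar>R y\<bar> \<le> M" "u > 0"
  shows "(vg_half r R has_real_derivative vg_half' r R u) (at u)"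
  unfolding vg_half_def[abs_def] vg_half'_def
  by (rule DERIV_cong[OF DERIV_diff[OF DERIV_minus[OF DERIV_mult[OF vgQ_has_real_derivative[OF assms(4)]
          vg_lower_has_real_derivative[OF assms(1,2,4)]]]
        DERIV_mult[OF vgP_has_real_derivative[OF assms(1)] vg_upper_has_real_derivative[OF assms]]]])
     (simp add: algebra_simps)

text \<open>Multiplied by u^r, the derivative becomes a combination of fluxes. Differentiating it
  gives back u^r \<open>vg_half\<close>, while the Wronskian identity collapses the terms with R to
  u^(r-1) R.\<close>

lemma vg_half'_has_real_derivative:
  assumes "r \<ge> 1" "continuous_on UNIV R" "\<And>y. \<bar>R y\<bar> \<le> M" "u > 0"
  shows "(vg_half' r R has_real_derivative vg_half r R u + R u / u - r * vg_half' r R u / u) (at u)"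
proof -
  let ?B = "\<lambda>u. u ^ (r + 1) * vgQ (r + 2) u" and ?D = "\<lambda>u. u ^ (r + 1) * vgP (r + 2) u"
  let ?N = "\<lambda>u. ?B u * vg_lower r R u - ?D u * vg_upper r R u"
  have pow: "u ^ r = u * u ^ (r - 1)" using assms(1) by (simp add: power_eq_if[of u r])
  have N: "?N x = x ^ r * vg_half' r R x" for x
    by (simp add: vg_half'_def algebra_simps)
  have "(?N has_real_derivative u ^ r * vg_half r R u + u ^ (r - 1) * R u * (vgP r u * ?B u + ?D u * vgQ r u)) (at u)"
    by (rule DERIV_cong[OF DERIV_diff[OF DERIV_mult[OF vgQ_flux_has_real_derivative[OF assms(4)] vg_lower_has_real_derivative[OF assms(1,2,4)]]
          DERIV_mult[OF vgP_flux_has_real_derivative[OF assms(1)] vg_upper_has_real_derivative[OF assms]]]])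
       (simp add: vg_half_def algebra_simps)
  then have "(?N has_real_derivative u ^ r * vg_half r R u + u ^ (r - 1) * R u) (at u)"
    by (simp only: vg_wronskian[OF assms(1,4)] mult_1_right)
  from DERIV_divide[OF this DERIV_pow[of r]] assms(4)
  have "((\<lambda>x. x ^ r * vg_half' r R x / x ^ r) has_real_derivative
     ((u ^ r * vg_half r R u + u ^ (r - 1) * R u) * u ^ r - u ^ r * vg_half' r R u * (real r * u ^ (r - Suc 0))) / (u ^ r * u ^ r)) (at u)"
    unfolding N by simp
  then have "((\<lambda>x. x ^ r * vg_half' r R x / x ^ r) has_real_derivative vg_half r R u + R u / u - r * vg_half' r R u / u) (at u)"
    by (rule DERIV_cong) (use assms(4) in \<open>simp add: pow field_simps\<close>)
  moreover have "\<forall>\<^sub>F x in nhds u. x \<in> {0<..}"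
    using assms by (intro eventually_nhds_in_open) auto
  then have "\<forall>\<^sub>F x in nhds u. x ^ r * vg_half' r R x / x ^ r = vg_half' r R x"
    by eventually_elim simp
  ultimately show ?thesis by (subst (asm) DERIV_cong_ev) auto
qed

text \<open>\<open>vg_gradient_bound\<close> presupposes a bounded derivative; for this solution the
  bound is obtained from the representation, whose barriers lead to the same weight as in that
  argument.\<close>

lemma vg_half'_bound:
  assumes "r \<ge> 1" "continuous_on UNIV R" "\<And>y. \<bar>R y\<bar> \<le> M" "u > 0"
  shows "\<bar>vg_half' r R u\<bar> \<le> 2 / r * M"
proof -
  let ?B = "u ^ (r + 1) * vgQ (r + 2) u"
  have M: "M \<ge> 0" using assms(3)[of 0] by simp
  have Q: "0 \<le> u * vgQ (r + 2) u" and P: "0 \<le> u * vgP (r + 2) u"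
    using assms(4) vgQ_nonneg[of "r + 2" u] vgP_pos[of "r + 2" u] by auto
  have "\<bar>vg_half' r R u\<bar> \<le> u * vgQ (r + 2) u * \<bar>vg_lower r R u\<bar> + u * vgP (r + 2) u * \<bar>vg_upper r R u\<bar>"
    unfolding vg_half'_def
    using abs_nonneg_combination_le[OF Q P, of "vg_lower r R u" "- vg_upper r R u"] by simp
  also have "\<dots> \<le> u * vgQ (r + 2) u * (M * (u ^ r * vgP r u / r)) + u * vgP (r + 2) u * (M * (u ^ r * vgQ (r + 2) u))"
    using vg_lower_bound[OF assms] vg_upper_bound[OF assms]
      mult_left_mono[OF vg_lower_1_le[OF assms(1,4)] M] mult_left_mono[OF vg_upper_1_le[OF assms(1,4)] M]
    by (intro add_mono mult_left_mono[OF _ Q] mult_left_mono[OF _ P]) auto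
  also have "\<dots> = M * (?B * (vgP r u / r) + vgP (r + 2) u * ?B)"
    by (simp add: algebra_simps)
  also have "\<dots> \<le> M * (2 / r)"
    by (intro mult_left_mono vg_gradient_weight_le assms M)
  finally show ?thesis by (simp add: mult.commute)
qed

lemma vgQ_vg_lower_tendsto:
  assumes "r \<ge> 1" "continuous_on UNIV R" "\<And>y. \<bar>R y\<bar> \<le> M"
  shows "((\<lambda>u. vgQ r u * vg_lower r R u) \<longlongrightarrow> 0) (at_right 0)"
proof (rule Lim_null_comparison)
  have M: "M \<ge> 0" using assms(3)[of 0] by simp
  show "\<forall>\<^sub>F u in at_right 0. norm (vgQ r u * vg_lower r R u) \<le> M / r * vgP r u * (u ^ r * vgQ r u)"
    using eventually_at_right_less[of 0]
  proof eventually_elim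
    case (elim u)
    have "norm (vgQ r u * vg_lower r R u) = vgQ r u * \<bar>vg_lower r R u\<bar>"
      using vgQ_nonneg[of r u] by (simp add: abs_mult)
    also have "\<dots> \<le> vgQ r u * (M * (u ^ r * vgP r u / r))"
      using vg_lower_bound[OF assms elim] mult_left_mono[OF vg_lower_1_le[OF assms(1) elim] M]
      by (intro mult_left_mono vgQ_nonneg) auto
    finally show ?case by (simp add: mult_ac)
  qed
  show "((\<lambda>u. M / r * vgP r u * (u ^ r * vgQ r u)) \<longlongrightarrow> 0) (at_right 0)"
    using tendsto_mult[OF tendsto_mult[OF tendsto_const vgP_tendsto[OF assms(1)]] vgQ_power_tendsto_0[OF assms(1)], of "M / r"] by simp
qed

text \<open>The lower integral is O(u^r) and u^r \<open>vgQ r u\<close> tends to 0, so only the full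
  integral against \<open>vgQ\<close> survives.\<close>

lemma vg_half_tendsto:
  assumes "r \<ge> 1" "continuous_on UNIV R" "\<And>y. \<bar>R y\<bar> \<le> M"
  shows "(vg_half r R \<longlongrightarrow> - (vgP r 0 * (LBINT y:{0<..}. y ^ (r - 1) * vgQ r y * R y))) (at_right 0)"
proof -
  have "(vg_half r R \<longlongrightarrow> - 0 - vgP r 0 * (LBINT y:{0<..}. y ^ (r - 1) * vgQ r y * R y)) (at_right 0)"
    unfolding vg_half_def[abs_def] vg_upper_def
    by (intro tendsto_diff tendsto_minus vgQ_vg_lower_tendsto[OF assms] tendsto_mult vgP_tendsto assms(1)
        tendsto_set_integral_atLeast_at_right vgQ_weighted_integrable[OF assms])
  then show ?thesis by simp
qed

text \<open>\<open>- vg_half r (\<lambda>_. 1)\<close> decreases, so its supremum is its limit at 0.\<close>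

lemma vg_half_bound:
  assumes "r \<ge> 1" "continuous_on UNIV R" "\<And>y. \<bar>R y\<bar> \<le> M" "u > 0"
  shows "\<bar>vg_half r R u\<bar> \<le> sqrt pi / 2 * Gamma (real r / 2) / Gamma (real r / 2 + 1 / 2) * M"
proof -
  let ?c = "vgP r 0 * (LBINT y:{0<..}. y ^ (r - 1) * vgQ r y * 1)"
  have M: "M \<ge> 0" using assms(3)[of 0] by simp
  have one: "continuous_on UNIV (\<lambda>_::real. 1::real)" "\<And>y::real. \<bar>1::real\<bar> \<le> 1" by auto
  have "0 \<le> vg_half r (\<lambda>_. 1) u - - ?c"
  proof (rule nonneg_if_deriv_nonneg_at_right[OF _ _ _ assms(4)])
    show "((\<lambda>u. vg_half r (\<lambda>_. 1) u - - ?c) has_real_derivative vg_half' r (\<lambda>_. 1) x - 0) (at x)" if "x > 0" for x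
      by (intro DERIV_diff vg_half_has_real_derivative[OF assms(1) one that] DERIV_const)
    show "vg_half' r (\<lambda>_. 1) x - 0 \<ge> 0" if "x > 0" for x
    proof -
      \<comment> \<open>For R = 1 each integral is compared with x^r times its own function of order
        r + 2. Both comparisons meet in the same product, so \<open>vg_half'\<close> is
        nonnegative.\<close>
      have "x * vgP (r + 2) x * vg_upper r (\<lambda>_. 1) x \<le> x * vgP (r + 2) x * (x ^ r * vgQ (r + 2) x)"
        using that vgP_pos[of "r + 2" x] by (intro mult_left_mono vg_upper_1_le assms(1)) auto
      also have "\<dots> = x * vgQ (r + 2) x * (x ^ r * vgP (r + 2) x)" by simp
      also have "\<dots> \<le> x * vgQ (r + 2) x * vg_lower r (\<lambda>_. 1) x"
        using that vgQ_nonneg[of "r + 2" x] by (intro mult_left_mono vg_lower_1_ge assms(1)) auto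
      finally show ?thesis by (simp add: vg_half'_def)
    qed
    show "((\<lambda>u. vg_half r (\<lambda>_. 1) u - - ?c) \<longlongrightarrow> 0) (at_right 0)"
      using vg_half_tendsto[OF assms(1) one] by (simp only: LIM_zero_iff)
  qed
  then have c: "vgQ r u * vg_lower r (\<lambda>_. 1) u + vgP r u * vg_upper r (\<lambda>_. 1) u \<le> ?c"
    by (simp add: vg_half_def)
  have "\<bar>vg_half r R u\<bar> \<le> vgQ r u * \<bar>vg_lower r R u\<bar> + vgP r u * \<bar>vg_upper r R u\<bar>"
    unfolding vg_half_def
    using abs_nonneg_combination_le[OF vgQ_nonneg[of r u] less_imp_le[OF vgP_pos[OF assms(1), of u]], of "- vg_lower r R u" "- vg_upper r R u"] by simp
  also have "\<dots> \<le> vgQ r u * (M * vg_lower r (\<lambda>_. 1) u) + vgP r u * (M * vg_upper r (\<lambda>_. 1) u)"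
    using vg_lower_bound[OF assms] vg_upper_bound[OF assms] vgQ_nonneg[of r u] vgP_pos[OF assms(1), of u]
    by (intro add_mono mult_left_mono) auto
  also have "\<dots> = M * (vgQ r u * vg_lower r (\<lambda>_. 1) u + vgP r u * vg_upper r (\<lambda>_. 1) u)"
    by (simp add: algebra_simps)
  also have "\<dots> \<le> M * ?c" using c M by (rule mult_left_mono)
  also have "?c = sqrt pi / 2 * Gamma (real r / 2) / Gamma (real r / 2 + 1 / 2)"
  proof -
    have e: "(real r - 1) / 2 + 1 = real r / 2 + 1 / 2" by (simp add: field_simps)
    show ?thesis
      unfolding mult_1_right vgQ_weighted_integral(2)[OF assms(1)] vgP_0 e by (simp add: powr_diff)
  qed
  finally show ?thesis by (simp add: mult.commute)
qed

section \<open>Regularity at the singular point\<close>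

text \<open>For u > 0 this is u^(-n-1) times the integral of y^n \<phi>(y) over [0, u]. The rescaled
  form is also defined at 0 and on the negative axis and inherits the smoothness of \<phi>.\<close>

definition vg_average :: "nat \<Rightarrow> (real \<Rightarrow> real) \<Rightarrow> real \<Rightarrow> real" where
  "vg_average n \<phi> u = integral {0..1} (\<lambda>s. s ^ n * \<phi> (s * u))"

lemma continuous_on_UNIV_compose:
  fixes \<phi> :: "real \<Rightarrow> real"
  assumes "continuous_on UNIV \<phi>" "continuous_on A f"
  shows "continuous_on A (\<lambda>x. \<phi> (f x))"
  using assms continuous_on_compose2[of UNIV \<phi> A f] by auto

lemma vg_average_integrable:
  fixes \<phi> :: "real \<Rightarrow> real"
  assumes "continuous_on UNIV \<phi>"
  shows "(\<lambda>s. s ^ n * \<phi> (s * u)) integrable_on {0..1}"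
  by (intro integrable_continuous_interval continuous_intros continuous_on_UNIV_compose[OF assms])

lemma vg_average_add:
  assumes "continuous_on UNIV \<phi>" "continuous_on UNIV \<psi>"
  shows "vg_average n (\<lambda>u. \<phi> u + \<psi> u) u = vg_average n \<phi> u + vg_average n \<psi> u"
  using vg_average_integrable[OF assms(1), of n u] vg_average_integrable[OF assms(2), of n u]
  by (simp add: vg_average_def distrib_left integral_add)

lemma vg_average_0: "vg_average n \<phi> 0 = \<phi> 0 / (n + 1)"
proof -
  have "((\<lambda>s::real. s ^ n) has_integral 1 ^ (n + 1) / (n + 1) - 0 ^ (n + 1) / (n + 1)) {0..1}"
    by (rule fundamental_theorem_of_calculus)
       (auto intro!: derivative_eq_intros simp flip: has_real_derivative_iff_has_vector_derivative simp del: power_Suc)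
  then have "integral {0..1} (\<lambda>s::real. s ^ n) = 1 / (n + 1)" by (auto dest: integral_unique)
  then show ?thesis by (simp add: vg_average_def)
qed

lemma continuous_on_vg_average:
  assumes "continuous_on UNIV \<phi>"
  shows "continuous_on UNIV (vg_average n \<phi>)"
proof -
  have "continuous_on UNIV (\<lambda>u. integral (cbox 0 1) (\<lambda>s. s ^ n * \<phi> (s * u)))"
    by (rule integral_continuous_on_param)
       (auto simp: case_prod_unfold intro!: continuous_intros continuous_on_UNIV_compose[OF assms])
  then show ?thesis by (simp add: vg_average_def[abs_def])
qed

text \<open>Differentiating under the integral brings out one factor s, so n goes up by one; this is
  the source of the growing order of the equation.\<close>

lemma vg_average_has_real_derivative:
  assumes "\<And>u. (\<phi> has_real_derivative \<phi>1 u) (at u)" "continuous_on UNIV \<phi>1"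
  shows "(vg_average n \<phi> has_real_derivative vg_average (n + 1) \<phi>1 u) (at u)"
proof -
  have cont: "continuous_on UNIV \<phi>" using assms(1) by (intro DERIV_continuous_on) auto
  have "((\<lambda>u. integral (cbox 0 1) (\<lambda>s. s ^ n * \<phi> (s * u))) has_real_derivative
      integral (cbox 0 1) (\<lambda>s. s ^ (n + 1) * \<phi>1 (s * u))) (at u within UNIV)"
  proof (rule leibniz_rule_field_derivative)
    show "((\<lambda>u. s ^ n * \<phi> (s * u)) has_real_derivative s ^ (n + 1) * \<phi>1 (s * u)) (at u within UNIV)" for u s
      by (rule DERIV_cong[OF DERIV_cmult[OF DERIV_chain2[OF assms(1) DERIV_cmult[OF DERIV_ident]]]]) simp
    show "(\<lambda>s. s ^ n * \<phi> (s * u)) integrable_on cbox 0 1" for u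
      using vg_average_integrable[OF cont] by simp
    show "continuous_on (UNIV \<times> cbox 0 1) (\<lambda>(u, s). s ^ (n + 1) * \<phi>1 (s * u))"
      by (auto simp: case_prod_unfold intro!: continuous_intros continuous_on_UNIV_compose[OF assms(2)])
  qed auto
  then show ?thesis by (simp add: vg_average_def[abs_def])
qed

lemma vg_average_eq_integral:
  assumes "continuous_on UNIV \<phi>" "u > 0"
  shows "u ^ (n + 1) * vg_average n \<phi> u = integral {0..u} (\<lambda>y. y ^ n * \<phi> y)"
proof -
  let ?f = "\<lambda>y. y ^ n * \<phi> y"
  have "continuous_on {0..u} ?f" by (intro continuous_intros continuous_on_subset[OF assms(1)]) auto
  then have "(?f has_integral integral {0..u} ?f) (cbox 0 u)"
    by (simp add: integrable_integral integrable_continuous_interval)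
  from has_integral_cmul[OF has_integral_affinity[OF this, of u 0], of u] assms(2)
  have "((\<lambda>s. u * ?f (u * s)) has_integral u * (inverse u * integral {0..u} ?f)) {0..1}"
    by (simp add: divide_inverse mult.commute[of _ "inverse u"])
  also have "u * (inverse u * integral {0..u} ?f) = integral {0..u} ?f"
    using assms(2) by (simp flip: mult.assoc)
  finally have "integral {0..1} (\<lambda>s. u * ?f (u * s)) = integral {0..u} ?f"
    by (rule integral_unique)
  moreover have "(\<lambda>s. u * ?f (u * s)) = (\<lambda>s. u ^ (n + 1) * (s ^ n * \<phi> (s * u)))"
    by (simp add: power_mult_distrib mult_ac)
  ultimately show ?thesis by (simp add: vg_average_def)
qed

text \<open>The integrated form of the Stein equation of order \<open>n\<close>: unlike the differential form, it
  makes sense at \<open>u = 0\<close> and yields the regularity of the solution there.\<close>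

definition vg_solves :: "nat \<Rightarrow> (real \<Rightarrow> real) \<Rightarrow> (real \<Rightarrow> real) \<Rightarrow> (real \<Rightarrow> real) \<Rightarrow> bool" where
  "vg_solves n \<phi> \<phi>1 R \<longleftrightarrow> n \<ge> 1 \<and> continuous_on UNIV R \<and>
     (\<forall>u. (\<phi> has_real_derivative \<phi>1 u) (at u)) \<and>
     (\<forall>u. \<phi>1 u = u * vg_average n \<phi> u + vg_average (n - 1) R u)"

lemma vg_solvesD:
  assumes "vg_solves n \<phi> \<phi>1 R"
  shows "n \<ge> 1" "continuous_on UNIV R" "(\<phi> has_real_derivative \<phi>1 u) (at u)"
    "\<phi>1 u = u * vg_average n \<phi> u + vg_average (n - 1) R u"
    "continuous_on UNIV \<phi>" "continuous_on UNIV \<phi>1"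
proof -
  show 1: "n \<ge> 1" "continuous_on UNIV R" "(\<phi> has_real_derivative \<phi>1 u) (at u)" for u
    using assms by (auto simp: vg_solves_def)
  show 2: "\<phi>1 u = u * vg_average n \<phi> u + vg_average (n - 1) R u" for u
    using assms by (auto simp: vg_solves_def)
  show 3: "continuous_on UNIV \<phi>" using 1(3) by (intro DERIV_continuous_on) auto
  have "continuous_on UNIV (\<lambda>u. u * vg_average n \<phi> u + vg_average (n - 1) R u)"
    by (intro continuous_intros continuous_on_vg_average 1 3)
  then show "continuous_on UNIV \<phi>1" unfolding 2[symmetric] .
qed

text \<open>Every term of u \<phi>'' + n \<phi>' - u \<phi> changes sign when u is replaced by -u,
  hence the sign of the new right-hand side. Estimates are therefore needed for u > 0 only.\<close>

lemma vg_solves_reflect: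
  assumes "vg_solves n \<phi> \<phi>1 R"
  shows "vg_solves n (\<lambda>u. \<phi> (- u)) (\<lambda>u. - \<phi>1 (- u)) (\<lambda>u. - R (- u))"
  unfolding vg_solves_def
proof (intro conjI allI)
  note s = vg_solvesD[OF assms]
  show "n \<ge> 1" by (rule s)
  show "continuous_on UNIV (\<lambda>u. - R (- u))" by (intro continuous_intros continuous_on_UNIV_compose[OF s(2)])
  show "((\<lambda>u. \<phi> (- u)) has_real_derivative - \<phi>1 (- u)) (at u)" for u
    using DERIV_chain2[OF s(3) DERIV_minus[OF DERIV_ident], of u] by simp
  show "- \<phi>1 (- u) = u * vg_average n (\<lambda>u. \<phi> (- u)) u + vg_average (n - 1) (\<lambda>u. - R (- u)) u" for u
    unfolding s(4)[of "- u"] by (simp add: vg_average_def)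
qed

text \<open>Multiplication by u^n turns the averages into integrals from 0 to u, to which the
  fundamental theorem of calculus applies; dividing by u^n again requires u to be nonzero.\<close>

lemma vg_solves_second_derivative_pos:
  assumes "vg_solves n \<phi> \<phi>1 R" "u > 0"
  shows "(\<phi>1 has_real_derivative \<phi> u + R u / u - n * \<phi>1 u / u) (at u)"
proof -
  note s = vg_solvesD[OF assms(1)]
  have pow: "x ^ n = x * x ^ (n - 1)" for x :: real using s(1) by (simp add: power_eq_if[of x n])
  let ?N = "\<lambda>u. integral {0..u} (\<lambda>y. y ^ n * \<phi> y) + integral {0..u} (\<lambda>y. y ^ (n - 1) * R y)"
  have N: "?N x = x ^ n * \<phi>1 x" if "x > 0" for x
    using vg_average_eq_integral[OF s(5) that, of n] vg_average_eq_integral[OF s(2) that, of "n - 1"] s(1)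
    unfolding s(4) by (simp add: algebra_simps)
  have "((\<lambda>u. integral {0..u} (\<lambda>y. y ^ m * \<psi> y)) has_real_derivative u ^ m * \<psi> u) (at u)"
    if "continuous_on UNIV \<psi>" for m \<psi>
  proof -
    have "((\<lambda>u. integral {0..u} (\<lambda>y. y ^ m * \<psi> y)) has_real_derivative u ^ m * \<psi> u) (at u within {0..u + 1})"
      using assms(2) by (intro integral_has_real_derivative continuous_intros continuous_on_subset[OF that]) auto
    then show ?thesis using assms(2) by (subst (asm) at_within_interior) auto
  qed
  note DERIV_add[OF this[OF s(5), of n] this[OF s(2), of "n - 1"]]
  from DERIV_divide[OF this DERIV_pow[of n]] assms(2)
  have "((\<lambda>x. ?N x / x ^ n) has_real_derivative
      ((u ^ n * \<phi> u + u ^ (n - 1) * R u) * u ^ n - ?N u * (real n * u ^ (n - Suc 0))) / (u ^ n * u ^ n)) (at u)"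
    by simp
  then have "((\<lambda>x. ?N x / x ^ n) has_real_derivative \<phi> u + R u / u - n * \<phi>1 u / u) (at u)"
  proof (rule DERIV_cong)
    show "((u ^ n * \<phi> u + u ^ (n - 1) * R u) * u ^ n - ?N u * (real n * u ^ (n - Suc 0))) / (u ^ n * u ^ n) =
        \<phi> u + R u / u - n * \<phi>1 u / u"
      unfolding N[OF assms(2)] using assms(2) by (simp add: pow field_simps)
  qed
  moreover have "\<forall>\<^sub>F x in nhds u. x \<in> {0<..}"
    using assms by (intro eventually_nhds_in_open) auto
  then have "\<forall>\<^sub>F x in nhds u. ?N x / x ^ n = \<phi>1 x"
  proof eventually_elim
    case (elim x)
    then have "x > 0" by simp
    then show ?case unfolding N[OF \<open>x > 0\<close>] by simp
  qed
  ultimately show ?thesis by (subst (asm) DERIV_cong_ev) auto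
qed

lemma vg_solves_second_derivative:
  assumes "vg_solves n \<phi> \<phi>1 R" "u \<noteq> 0"
  shows "(\<phi>1 has_real_derivative \<phi> u + R u / u - n * \<phi>1 u / u) (at u)"
proof (cases "u > 0")
  case True
  then show ?thesis using assms(1) by (rule vg_solves_second_derivative_pos[rotated])
next
  case False
  then have "- u > 0" using assms(2) by simp
  note D = vg_solves_second_derivative_pos[OF vg_solves_reflect[OF assms(1)] this]
  from DERIV_minus[OF DERIV_chain2[OF D DERIV_minus[OF DERIV_ident]]]
  show ?thesis by (simp add: field_simps)
qed

text \<open>At 0 the term with \<open>\<phi>\<close> is multiplied by u = 0, so
  \<open>\<phi>1 0 = R 0 / n\<close>; the factor 2 only matches the bound off 0.\<close>

lemma vg_solves_bound_0:
  assumes "vg_solves n \<phi> \<phi>1 R" "\<And>u. \<bar>R u\<bar> \<le> M"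
  shows "\<bar>\<phi>1 0\<bar> \<le> 2 / n * M"
proof -
  note s = vg_solvesD[OF assms(1)]
  have "\<phi>1 0 = R 0 / n" using s(1) by (simp add: s(4) vg_average_0 of_nat_diff)
  then have "\<bar>\<phi>1 0\<bar> = \<bar>R 0\<bar> / n" by simp
  also have "\<dots> \<le> 2 * M / n"
    using assms(2)[of 0] by (intro divide_right_mono) auto
  finally show ?thesis by simp
qed

lemma vg_solves_bound:
  assumes "vg_solves n \<phi> \<phi>1 R" "bounded (range \<phi>)" "bounded (range \<phi>1)" "\<And>u. \<bar>R u\<bar> \<le> M"
  shows "\<bar>\<phi>1 u\<bar> \<le> 2 / n * M"
proof -
  have pos: "\<bar>\<phi>1 u\<bar> \<le> 2 / n * M"
    if sol: "vg_solves n \<phi> \<phi>1 R" and bd: "bounded (range \<phi>)" "bounded (range \<phi>1)" and R: "\<And>u. \<bar>R u\<bar> \<le> M" and "u > 0"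
    for \<phi> \<phi>1 R and u :: real
  proof -
    obtain a b where ab: "\<And>u. \<bar>\<phi> u\<bar> \<le> a" "\<And>u. \<bar>\<phi>1 u\<bar> \<le> b"
      using bd by (auto simp: bounded_iff)
    show ?thesis
    proof (rule vg_gradient_bound[where C = "max a b" and \<phi> = \<phi> and R = R and u = u and ?\<phi>1.0 = \<phi>1 and ?\<phi>2.0 = "\<lambda>x. \<phi> x + R x / x - n * \<phi>1 x / x"])
      show "(\<phi>1 has_real_derivative \<phi> x + R x / x - n * \<phi>1 x / x) (at x)" if "x > 0" for x
        using sol that by (rule vg_solves_second_derivative_pos)
      show "x * (\<phi> x + R x / x - n * \<phi>1 x / x) + n * \<phi>1 x - x * \<phi> x = R x" if "x > 0" for x
        using that by (simp add: field_simps)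
    qed (use ab R \<open>u > 0\<close> vg_solvesD[OF sol] in \<open>auto intro: max.coboundedI1 max.coboundedI2\<close>)
  qed
  consider "u > 0" | "u = 0" | "u < 0" by linarith
  then show ?thesis
  proof cases
    case 1
    then show ?thesis by (intro pos[OF assms])
  next
    case 2
    then show ?thesis using vg_solves_bound_0[OF assms(1,4)] by simp
  next
    case 3
    have "\<bar>- \<phi>1 (- (- u))\<bar> \<le> 2 / n * M"
    proof (rule pos[OF vg_solves_reflect[OF assms(1)]])
      show "bounded (range (\<lambda>u. \<phi> (- u)))" using assms(2) by (auto simp: bounded_iff)
      show "bounded (range (\<lambda>u. - \<phi>1 (- u)))" using assms(3) by (auto simp: bounded_iff)
    qed (use 3 assms(4) in auto)
    then show ?thesis by simp
  qed
qed

text \<open>The product rule leaves an extra average of \<open>\<phi>\<close>, which therefore joins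
  the right-hand side. Boundedness of \<open>\<phi>2\<close> is what admits
  \<open>vg_solves_bound\<close> at the next order: compactness gives it on [-1, 1], and outside the
  equation does, as 1/|u| \<le> 1 there.\<close>

lemma vg_solves_step:
  assumes sol: "vg_solves n \<phi> \<phi>1 R" and R: "\<And>u. (R has_real_derivative R1 u) (at u)" "continuous_on UNIV R1"
    and bd: "bounded (range \<phi>)" "bounded (range \<phi>1)" "bounded (range R)"
  obtains \<phi>2 where "vg_solves (n + 1) \<phi>1 \<phi>2 (\<lambda>u. R1 u + \<phi> u)" "bounded (range \<phi>2)"
proof -
  note s = vg_solvesD[OF sol]
  define \<phi>2 where "\<phi>2 = (\<lambda>u. u * vg_average (n + 1) \<phi>1 u + vg_average n (\<lambda>u. R1 u + \<phi> u) u)"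
  have d: "(\<phi>1 has_real_derivative \<phi>2 u) (at u)" for u
  proof -
    have "((\<lambda>u. u * vg_average n \<phi> u + vg_average (n - 1) R u) has_real_derivative
        1 * vg_average n \<phi> u + vg_average (n + 1) \<phi>1 u * u + vg_average (n - 1 + 1) R1 u) (at u)"
      by (intro DERIV_add DERIV_mult DERIV_ident vg_average_has_real_derivative s(3,6) R)
    also have "1 * vg_average n \<phi> u + vg_average (n + 1) \<phi>1 u * u + vg_average (n - 1 + 1) R1 u = \<phi>2 u"
      unfolding \<phi>2_def vg_average_add[OF R(2) s(5)] using s(1) by simp
    finally show ?thesis unfolding s(4)[symmetric] .
  qed
  have sol2: "vg_solves (n + 1) \<phi>1 \<phi>2 (\<lambda>u. R1 u + \<phi> u)"
    unfolding vg_solves_def using d by (auto simp: \<phi>2_def intro!: continuous_intros R(2) s(5))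
  have "bounded (range \<phi>2)"
  proof -
    obtain a b c where abc: "\<And>u. \<bar>\<phi> u\<bar> \<le> a" "\<And>u. \<bar>\<phi>1 u\<bar> \<le> b" "\<And>u. \<bar>R u\<bar> \<le> c"
      using bd by (auto simp: bounded_iff)
    have "compact (\<phi>2 ` {-1..1})"
      by (intro compact_continuous_image continuous_on_subset[OF vg_solvesD(6)[OF sol2]]) auto
    then have "bounded (\<phi>2 ` {-1..1})" by (rule compact_imp_bounded)
    then obtain K where "\<forall>x \<in> \<phi>2 ` {-1..1}. norm x \<le> K" unfolding bounded_iff by blast
    then have K: "\<And>u. u \<in> {-1..1} \<Longrightarrow> \<bar>\<phi>2 u\<bar> \<le> K" by auto
    have "\<bar>\<phi>2 u\<bar> \<le> max K (a + c + n * b)" for u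
    proof (cases "u \<in> {-1..1}")
      case False
      then have u: "\<bar>u\<bar> \<ge> 1" "u \<noteq> 0" by auto
      have div: "\<bar>z / u\<bar> \<le> \<bar>z\<bar>" for z
        using u mult_left_mono[of 1 "\<bar>u\<bar>" "\<bar>z\<bar>"] by (simp add: abs_divide divide_le_eq)
      have tri: "\<bar>x + y - z\<bar> \<le> \<bar>x\<bar> + \<bar>y\<bar> + \<bar>z\<bar>" for x y z :: real by linarith
      have "\<phi>2 u = \<phi> u + R u / u - n * \<phi>1 u / u"
        by (rule DERIV_unique[OF d vg_solves_second_derivative[OF sol u(2)]])
      then have "\<bar>\<phi>2 u\<bar> \<le> \<bar>\<phi> u\<bar> + \<bar>R u / u\<bar> + \<bar>n * \<phi>1 u / u\<bar>"
        using tri[of "\<phi> u" "R u / u" "n * \<phi>1 u / u"] by simp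
      also have "\<dots> \<le> a + c + n * b"
        using div[of "R u"] div[of "n * \<phi>1 u"] abc[of u] mult_left_mono[OF abc(2)[of u], of "real n"]
        by (auto simp: abs_mult)
      finally show ?thesis by simp
    qed (use K in \<open>auto intro: max.coboundedI1\<close>)
    then show ?thesis by (auto simp: bounded_iff)
  qed
  with sol2 show ?thesis by (rule that)
qed

text \<open>With W an antiderivative of w, g - W is constant on each side of 0, and continuity makes
  the two constants equal.\<close>

lemma DERIV_removable:
  fixes g w :: "real \<Rightarrow> real"
  assumes "continuous_on UNIV g" "continuous_on UNIV w" "\<And>u. u \<noteq> 0 \<Longrightarrow> (g has_real_derivative w u) (at u)"
  shows "(g has_real_derivative w u) (at u)"
proof -
  define W where "W = (\<lambda>x. LBINT y=0..ereal x. w y)"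
  have W: "(W has_real_derivative w x) (at x)" for x
  proof -
    define a where "a = \<bar>x\<bar> + 1"
    have "(W has_vector_derivative w x) (at x within {-a..a})"
      unfolding W_def zero_ereal_def
      by (rule interval_integral_FTC2) (auto simp: a_def intro: continuous_on_subset[OF assms(2)])
    then show ?thesis
      by (subst (asm) at_within_interior) (auto simp: a_def has_real_derivative_iff_has_vector_derivative)
  qed
  have d0: "((\<lambda>x. g x - W x) has_real_derivative 0) (at x)" if "x \<noteq> 0" for x
    using DERIV_diff[OF assms(3)[OF that] W] by simp
  have cont: "continuous_on A (\<lambda>x. g x - W x)" for A
    using W by (intro continuous_intros continuous_on_subset[OF assms(1)] DERIV_continuous_on)
      (auto intro: has_field_derivative_at_within)
  have "g x - W x = g 0 - W 0" for x
  proof (cases x "0::real" rule: linorder_cases)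
    case less
    have "g 0 - W 0 = g x - W x" by (rule DERIV_isconst_end[OF less cont]) (auto intro: d0)
    then show ?thesis by simp
  next
    case greater
    then show ?thesis by (intro DERIV_isconst_end[OF greater cont]) (auto intro: d0)
  qed simp
  then have "g = (\<lambda>x. W x + (g 0 - W 0))" by (auto simp: fun_eq_iff algebra_simps)
  then show ?thesis using DERIV_add[OF W DERIV_const] by (metis add.right_neutral)
qed

text \<open>Along the ray s u, the function s^r g1(s u) is an antiderivative of the averaged
  integrand, so integrating over [0, 1] gives the integrated form off 0. Its right side is
  continuous, hence is the derivative at 0 as well by \<open>DERIV_removable\<close>.\<close>

lemma vg_solvesI:
  assumes r: "r \<ge> 1" and cont: "continuous_on UNIV g" "continuous_on UNIV R" and bd: "\<And>u. \<bar>g1 u\<bar> \<le> C"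
    and d0: "\<And>u. u \<noteq> 0 \<Longrightarrow> (g has_real_derivative g1 u) (at u)"
    and d1: "\<And>u. u \<noteq> 0 \<Longrightarrow> (g1 has_real_derivative g u + R u / u - r * g1 u / u) (at u)"
  shows "vg_solves r g (\<lambda>u. u * vg_average r g u + vg_average (r - 1) R u) R"
  unfolding vg_solves_def
proof (intro conjI allI r cont(2) refl)
  have eq: "g1 u = u * vg_average r g u + vg_average (r - 1) R u" if u: "u \<noteq> 0" for u
  proof -
    let ?F = "\<lambda>s. s ^ r * g1 (s * u)"
    let ?f = "\<lambda>s. u * (s ^ r * g (s * u)) + s ^ (r - 1) * R (s * u)"
    have "(?f has_integral ?F 1 - ?F 0) {0..1}"
    proof (rule fundamental_theorem_of_calculus_interior)
      have dF: "(?F has_real_derivative ?f s) (at s)" if "s > 0" for s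
      proof (rule DERIV_cong[OF DERIV_mult[OF DERIV_pow DERIV_chain2[OF d1 DERIV_cmult_right[OF DERIV_ident]]]])
        have "s ^ r = s * s ^ (r - 1)" using r by (simp add: power_eq_if[of s r])
        then show "real r * s ^ (r - Suc 0) * g1 (s * u) +
            (g (s * u) + R (s * u) / (s * u) - real r * g1 (s * u) / (s * u)) * (1 * u) * s ^ r = ?f s"
          using that u by (simp add: field_simps)
      qed (use that u in simp)
      then show "(?F has_vector_derivative ?f s) (at s)" if "s \<in> {0<..<1}" for s
        using that by (simp flip: has_real_derivative_iff_has_vector_derivative)
      have "isCont ?F s" if "s \<in> {0..1}" for s
      proof (cases "s = 0")
        case True
        \<comment> \<open>No continuity of \<open>g1\<close> at 0 is available; its boundedness and
          r \<ge> 1 make the boundary term at s = 0 vanish.\<close>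
        have "(?F \<longlongrightarrow> 0) (at 0)"
        proof (rule Lim_null_comparison)
          show "\<forall>\<^sub>F s in at 0. norm (?F s) \<le> C * \<bar>s\<bar> ^ r"
            using bd by (auto simp: abs_mult power_abs mult.commute[of C] intro!: always_eventually mult_left_mono)
          have "((\<lambda>s::real. C * \<bar>s\<bar> ^ r) \<longlongrightarrow> C * \<bar>0\<bar> ^ r) (at 0)" by (intro tendsto_intros)
          then show "((\<lambda>s::real. C * \<bar>s\<bar> ^ r) \<longlongrightarrow> 0) (at 0)" using r by (simp add: power_0_left)
        qed
        then show ?thesis using True r by (simp add: isCont_def power_0_left)
      next
        case False
        then show ?thesis using that dF[of s] DERIV_isCont by auto
      qed
      then show "continuous_on {0..1} ?F" by (intro continuous_at_imp_continuous_on ballI)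
    qed simp
    then have "integral {0..1} ?f = g1 u" using r by (simp add: integral_unique power_0_left)
    moreover have "integral {0..1} ?f = u * vg_average r g u + vg_average (r - 1) R u"
      unfolding vg_average_def
      using vg_average_integrable[OF cont(1), of r u] vg_average_integrable[OF cont(2), of "r - 1" u]
      by (subst integral_add) (auto intro: integrable_on_mult_right)
    ultimately show ?thesis by simp
  qed
  show "(g has_real_derivative u * vg_average r g u + vg_average (r - 1) R u) (at u)" for u
  proof (rule DERIV_removable[OF cont(1)])
    show "continuous_on UNIV (\<lambda>u. u * vg_average r g u + vg_average (r - 1) R u)"
      by (intro continuous_intros continuous_on_vg_average cont)
    show "(g has_real_derivative u * vg_average r g u + vg_average (r - 1) R u) (at u)" if "u \<noteq> 0" for u
      using d0[OF that] unfolding eq[OF that] .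
  qed
qed

section \<open>The solution on the whole line\<close>

lemma lborel_integral_reflect:
  fixes f :: "real \<Rightarrow> real"
  shows "integrable lborel (\<lambda>x. f (- x)) \<longleftrightarrow> integrable lborel f" "(LINT x|lborel. f (- x)) = (LINT x|lborel. f x)"
  using lborel_integrable_real_affine_iff[of "-1" f 0] lborel_integral_real_affine[of "-1" f 0] by simp_all

lemma lborel_integral_two_sided:
  fixes f :: "real \<Rightarrow> real"
  assumes "set_integrable lborel {0<..} f" "set_integrable lborel {0<..} (\<lambda>y. f (- y))"
  shows "integrable lborel f" "(LINT y|lborel. f y) = (LBINT y:{0<..}. f y) + (LBINT y:{0<..}. f (- y))"
proof -
  let ?p = "\<lambda>y. indicator {0<..} y *\<^sub>R f y" and ?n = "\<lambda>y. indicator {0<..} (- y) *\<^sub>R f y" and ?z = "\<lambda>y. indicator {0 :: real} y *\<^sub>R f 0"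
  have p: "integrable lborel ?p" using assms(1) by (simp add: set_integrable_def)
  have n: "integrable lborel ?n"
    using lborel_integral_reflect(1)[of ?n] assms(2) by (simp add: set_integrable_def)
  have z: "integrable lborel ?z" "(LINT y|lborel. ?z y) = 0" by auto
  have eq: "f = (\<lambda>y. ?p y + ?n y + ?z y)"
    by (rule ext) (auto simp: indicator_def)
  have "integrable lborel (\<lambda>y. ?p y + ?n y + ?z y)" by (intro Bochner_Integration.integrable_add p n z)
  then show "integrable lborel f" by (simp only: eq[symmetric])
  have "(LINT y|lborel. ?p y + ?n y + ?z y) = (LINT y|lborel. ?p y + ?n y) + (LINT y|lborel. ?z y)"
    by (rule Bochner_Integration.integral_add[OF Bochner_Integration.integrable_add[OF p n] z(1)])
  also have "(LINT y|lborel. ?p y + ?n y) = (LINT y|lborel. ?p y) + (LINT y|lborel. ?n y)"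
    by (rule Bochner_Integration.integral_add[OF p n])
  also have "(LINT y|lborel. ?n y) = (LBINT y:{0<..}. f (- y))"
    using lborel_integral_reflect(2)[of ?n] by (simp add: set_lebesgue_integral_def)
  finally show "(LINT y|lborel. f y) = (LBINT y:{0<..}. f y) + (LBINT y:{0<..}. f (- y))"
    unfolding z(2) by (simp only: eq[symmetric]) (simp add: set_lebesgue_integral_def)
qed

text \<open>The negative half is obtained from the reflection symmetry of the equation together with
  linearity in R. The value at 0 is the limit of \<open>vg_half\<close> from the right; agreement
  with the limit from the left has to be proved.\<close>

definition vg_two_sided :: "nat \<Rightarrow> (real \<Rightarrow> real) \<Rightarrow> real \<Rightarrow> real" where
  "vg_two_sided r R u =
     (if u > 0 then vg_half r R u
      else if u < 0 then - vg_half r (\<lambda>y. R (- y)) (- u)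
      else - (vgP r 0 * (LBINT y:{0<..}. y ^ (r - 1) * vgQ r y * R y)))"

text \<open>The value at 0 is a placeholder that keeps the function bounded. The derivative there
  turns out to be \<open>R 0 / r\<close> and is supplied by the integrated equation.\<close>

definition vg_two_sided' :: "nat \<Rightarrow> (real \<Rightarrow> real) \<Rightarrow> real \<Rightarrow> real" where
  "vg_two_sided' r R u = (if u > 0 then vg_half' r R u else if u < 0 then vg_half' r (\<lambda>y. R (- y)) (- u) else 0)"

lemma reflect_continuous_bounded:
  fixes R :: "real \<Rightarrow> real"
  assumes "continuous_on UNIV R" "\<And>y. \<bar>R y\<bar> \<le> M"
  shows "continuous_on UNIV (\<lambda>y. R (- y))" "\<bar>R (- y)\<bar> \<le> M"
  using assms by (auto intro!: continuous_intros continuous_on_UNIV_compose[OF assms(1)])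

context
  fixes r :: nat and R :: "real \<Rightarrow> real" and M :: real
  assumes r: "r \<ge> 1" and R: "continuous_on UNIV R" "\<And>y. \<bar>R y\<bar> \<le> M"
begin

lemma vg_two_sided_has_real_derivative:
  assumes "u \<noteq> 0"
  shows "(vg_two_sided r R has_real_derivative vg_two_sided' r R u) (at u)"
    and "(vg_two_sided' r R has_real_derivative vg_two_sided r R u + R u / u - r * vg_two_sided' r R u / u) (at u)"
proof -
  consider "u > 0" | "u < 0" using assms by linarith
  then have "(vg_two_sided r R has_real_derivative vg_two_sided' r R u) (at u) \<and>
    (vg_two_sided' r R has_real_derivative vg_two_sided r R u + R u / u - r * vg_two_sided' r R u / u) (at u)"
  proof cases
    case 1
    then have ev: "\<forall>\<^sub>F x in nhds u. x \<in> {0<..}" by (intro eventually_nhds_in_open) auto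
    have "\<forall>\<^sub>F x in nhds u. vg_two_sided r R x = vg_half r R x"
      using ev by eventually_elim (simp add: vg_two_sided_def)
    moreover have "\<forall>\<^sub>F x in nhds u. vg_two_sided' r R x = vg_half' r R x"
      using ev by eventually_elim (simp add: vg_two_sided'_def)
    ultimately show ?thesis
      using vg_half_has_real_derivative[OF r R 1] vg_half'_has_real_derivative[OF r R 1] 1
      by (simp add: DERIV_cong_ev[OF refl _ refl] vg_two_sided_def vg_two_sided'_def)
  next
    case 2
    then have ev: "\<forall>\<^sub>F x in nhds u. x \<in> {..<0}" by (intro eventually_nhds_in_open) auto
    have e: "\<forall>\<^sub>F x in nhds u. vg_two_sided r R x = - vg_half r (\<lambda>y. R (- y)) (- x)"
      using ev by eventually_elim (simp add: vg_two_sided_def)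
    have e': "\<forall>\<^sub>F x in nhds u. vg_two_sided' r R x = vg_half' r (\<lambda>y. R (- y)) (- x)"
      using ev by eventually_elim (simp add: vg_two_sided'_def)
    have pos: "- u > 0" using 2 by simp
    note D = vg_half_has_real_derivative[OF r reflect_continuous_bounded[OF R] pos] vg_half'_has_real_derivative[OF r reflect_continuous_bounded[OF R] pos]
    have "((\<lambda>x. - vg_half r (\<lambda>y. R (- y)) (- x)) has_real_derivative vg_half' r (\<lambda>y. R (- y)) (- u)) (at u)"
      by (rule DERIV_cong[OF DERIV_minus[OF DERIV_chain2[OF D(1) DERIV_minus[OF DERIV_ident]]]]) simp
    moreover have "((\<lambda>x. vg_half' r (\<lambda>y. R (- y)) (- x)) has_real_derivative
        - vg_half r (\<lambda>y. R (- y)) (- u) + R u / u - r * vg_half' r (\<lambda>y. R (- y)) (- u) / u) (at u)"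
      by (rule DERIV_cong[OF DERIV_chain2[OF D(2) DERIV_minus[OF DERIV_ident]]]) (use 2 in \<open>simp add: field_simps\<close>)
    ultimately show ?thesis
      using 2 unfolding DERIV_cong_ev[OF refl e refl] DERIV_cong_ev[OF refl e' refl]
      by (simp add: vg_two_sided_def vg_two_sided'_def)
  qed
  then show "(vg_two_sided r R has_real_derivative vg_two_sided' r R u) (at u)"
    "(vg_two_sided' r R has_real_derivative vg_two_sided r R u + R u / u - r * vg_two_sided' r R u / u) (at u)" by auto
qed

lemma vg_two_sided'_bound: "\<bar>vg_two_sided' r R u\<bar> \<le> 2 / r * M"
proof -
  have "M \<ge> 0" using R(2)[of 0] by simp
  then show ?thesis
    using vg_half'_bound[OF r R, of u] vg_half'_bound[OF r reflect_continuous_bounded[OF R], of "- u"] by (simp add: vg_two_sided'_def)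
qed

text \<open>The limit from the right is -\<open>vgP r 0\<close> times the integral against R, the
  one from the left is \<open>vgP r 0\<close> times the integral against the reflected R; the
  hypothesis makes them equal.\<close>

lemma vg_two_sided_continuous_on:
  assumes "(LBINT y:{0<..}. y ^ (r - 1) * vgQ r y * R y) + (LBINT y:{0<..}. y ^ (r - 1) * vgQ r y * R (- y)) = 0"
  shows "continuous_on UNIV (vg_two_sided r R)"
proof (rule continuous_at_imp_continuous_on, rule ballI)
  fix u :: real
  show "isCont (vg_two_sided r R) u"
  proof (cases "u = 0")
    case False
    then show ?thesis by (rule DERIV_isCont[OF vg_two_sided_has_real_derivative(1)])
  next
    case True
    have "(vg_two_sided r R \<longlongrightarrow> vg_two_sided r R 0) (at_right 0)"
    proof (rule Lim_transform_eventually)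
      show "(vg_half r R \<longlongrightarrow> vg_two_sided r R 0) (at_right 0)"
        using vg_half_tendsto[OF r R] by (simp add: vg_two_sided_def)
      show "\<forall>\<^sub>F u in at_right 0. vg_half r R u = vg_two_sided r R u"
        using eventually_at_right_less[of 0] by eventually_elim (simp add: vg_two_sided_def)
    qed
    moreover have "(vg_two_sided r R \<longlongrightarrow> vg_two_sided r R 0) (at_left 0)"
    proof -
      have "(LBINT y:{0<..}. y ^ (r - 1) * vgQ r y * R (- y)) = - (LBINT y:{0<..}. y ^ (r - 1) * vgQ r y * R y)"
        using assms by linarith
      then have "((\<lambda>u. - vg_half r (\<lambda>y. R (- y)) u) \<longlongrightarrow> vg_two_sided r R 0) (at_right 0)"
        using tendsto_minus[OF vg_half_tendsto[OF r reflect_continuous_bounded[OF R]]] by (simp add: vg_two_sided_def)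
      then have "((\<lambda>u. vg_two_sided r R (- u)) \<longlongrightarrow> vg_two_sided r R 0) (at_right 0)"
      proof (rule Lim_transform_eventually)
        show "\<forall>\<^sub>F u in at_right 0. - vg_half r (\<lambda>y. R (- y)) u = vg_two_sided r R (- u)"
          using eventually_at_right_less[of 0] by eventually_elim (simp add: vg_two_sided_def)
      qed
      then show ?thesis using filterlim_at_left_to_right[of "vg_two_sided r R" _ 0] by simp
    qed
    ultimately show ?thesis unfolding True isCont_def by (rule filterlim_split_at_real[rotated])
  qed
qed

lemma vg_two_sided_bound:
  assumes "continuous_on UNIV (vg_two_sided r R)"
  shows "\<bar>vg_two_sided r R u\<bar> \<le> sqrt pi / 2 * Gamma (real r / 2) / Gamma (real r / 2 + 1 / 2) * M"
proof -
  have pos: "\<bar>vg_two_sided r R u\<bar> \<le> sqrt pi / 2 * Gamma (real r / 2) / Gamma (real r / 2 + 1 / 2) * M" if "u \<noteq> 0" for u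
    using vg_half_bound[OF r R, of u] vg_half_bound[OF r reflect_continuous_bounded[OF R], of "- u"] that
    by (auto simp: vg_two_sided_def)
  have "\<bar>vg_two_sided r R 0\<bar> \<le> sqrt pi / 2 * Gamma (real r / 2) / Gamma (real r / 2 + 1 / 2) * M"
  proof (rule tendsto_upperbound)
    show "((\<lambda>u. \<bar>vg_two_sided r R u\<bar>) \<longlongrightarrow> \<bar>vg_two_sided r R 0\<bar>) (at 0)"
      using assms by (intro tendsto_rabs) (auto simp: continuous_on_eq_continuous_at isCont_def)
    show "\<forall>\<^sub>F u in at 0. \<bar>vg_two_sided r R u\<bar> \<le> sqrt pi / 2 * Gamma (real r / 2) / Gamma (real r / 2 + 1 / 2) * M"
      using pos by (auto simp: eventually_at_filter intro: always_eventually)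
  qed simp
  with pos show ?thesis by (cases "u = 0") auto
qed

end

section \<open>Translating the integrals of the Stein formula\<close>

lemma vgP_eq:
  assumes "r \<ge> 1" "u > 0"
  shows "vgP r u = besselI ((real r - 1) / 2) u / u powr ((real r - 1) / 2)"
  using assms by (simp add: vgP_def besselI_conv_series powr_divide)

lemma vgP_weight_eq:
  assumes "r \<ge> 1" "u > 0"
  shows "u ^ (r - 1) * vgP r u = u powr ((real r - 1) / 2) * besselI ((real r - 1) / 2) u"
proof -
  have "u ^ (r - 1) = u powr (real r - 1)"
    using assms powr_realpow[of u "r - 1"] by (simp add: of_nat_diff)
  also have "\<dots> = u powr ((real r - 1) / 2) * u powr ((real r - 1) / 2)"
    by (simp flip: powr_add)
  finally show ?thesis using assms by (simp add: vgP_eq)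
qed

lemma vg_lower_eq_interval_integral:
  assumes "r \<ge> 1" "continuous_on UNIV R" "u > 0"
  shows "(LBINT y=0..ereal u. \<bar>y\<bar> powr ((real r - 1) / 2) * besselI ((real r - 1) / 2) \<bar>y\<bar> * R y) = vg_lower r R u"
proof -
  have "(LBINT y=ereal 0..ereal u. \<bar>y\<bar> powr ((real r - 1) / 2) * besselI ((real r - 1) / 2) \<bar>y\<bar> * R y) =
      (LBINT y=ereal 0..ereal u. y ^ (r - 1) * vgP r y * R y)"
    using assms by (intro interval_integral_cong) (auto simp: vgP_weight_eq[symmetric] einterval_def min_def max_def)
  also have "\<dots> = integral {0..u} (\<lambda>y. y ^ (r - 1) * vgP r y * R y)"
    using assms(3)
    by (intro interval_integral_eq_integral borel_integrable_atLeastAtMost' continuous_intros vgP_continuous_on assms(1)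
        continuous_on_subset[OF assms(2)]) auto
  finally show ?thesis by (simp add: vg_lower_def zero_ereal_def)
qed

lemma set_integral_greaterThan_eq_atLeast:
  fixes f :: "real \<Rightarrow> real"
  assumes "set_integrable lborel {a..} f"
  shows "(LBINT y:{a<..}. f y) = (LBINT y:{a..}. f y)"
  unfolding set_lebesgue_integral_def
proof (rule integral_cong_AE)
  have "set_integrable lborel {a<..} f" using assms by (rule set_integrable_subset) auto
  then show "(\<lambda>y. indicator {a<..} y *\<^sub>R f y) \<in> borel_measurable lborel" "(\<lambda>y. indicator {a..} y *\<^sub>R f y) \<in> borel_measurable lborel"
    using assms unfolding set_integrable_def by (intro borel_measurable_integrable; simp)+
  show "AE y in lborel. indicator {a<..} y *\<^sub>R f y = indicator {a..} y *\<^sub>R f y"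
    using AE_lborel_singleton[of a] by eventually_elim (auto simp: indicator_def)
qed

section \<open>Comparison with the explicit formula\<close>

text \<open>The unnormalised density for \<sigma> = 1 and \<mu> = 0. A right-hand side is centred
  when its integral against this kernel vanishes.\<close>

definition vg_kernel :: "nat \<Rightarrow> real \<Rightarrow> real" where
  "vg_kernel r y = \<bar>y\<bar> powr ((real r - 1) / 2) * besselK ((real r - 1) / 2) \<bar>y\<bar>"

lemma vg_kernel_minus [simp]: "vg_kernel r (- y) = vg_kernel r y"
  by (simp add: vg_kernel_def)

lemma vg_kernel_nonneg: "vg_kernel r y \<ge> 0"
  by (simp add: vg_kernel_def besselK_nonneg)

lemma vg_kernel_pos_eq: "r \<ge> 1 \<Longrightarrow> y > 0 \<Longrightarrow> vg_kernel r y = y ^ (r - 1) * vgQ r y"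
  using vgQ_eq[of r y] by (simp add: vg_kernel_def)

lemma vg_kernel_integral:
  assumes r: "r \<ge> 1" and R: "continuous_on UNIV R" "\<And>y. \<bar>R y\<bar> \<le> M"
  shows "integrable lborel (\<lambda>y. vg_kernel r y * R y)"
    and "(LINT y|lborel. vg_kernel r y * R y) =
      (LBINT y:{0<..}. y ^ (r - 1) * vgQ r y * R y) + (LBINT y:{0<..}. y ^ (r - 1) * vgQ r y * R (- y))"
proof -
  have half: "set_integrable lborel {0<..} (\<lambda>y. vg_kernel r y * S y) \<and>
      (LBINT y:{0<..}. vg_kernel r y * S y) = (LBINT y:{0<..}. y ^ (r - 1) * vgQ r y * S y)"
    if S: "continuous_on UNIV S" "\<And>y. \<bar>S y\<bar> \<le> M" for S
  proof
    have "set_integrable lborel {0<..} (\<lambda>y. y ^ (r - 1) * vgQ r y * S y)"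
      by (rule vgQ_weighted_integrable[OF r S])
    then show "set_integrable lborel {0<..} (\<lambda>y. vg_kernel r y * S y)"
      by (rule set_integrable_cong[THEN iffD1, rotated -1]) (auto simp: vg_kernel_pos_eq r[simplified])
    show "(LBINT y:{0<..}. vg_kernel r y * S y) = (LBINT y:{0<..}. y ^ (r - 1) * vgQ r y * S y)"
      by (rule set_lebesgue_integral_cong) (auto simp: vg_kernel_pos_eq r[simplified])
  qed
  note 1 = half[OF R]
  have 2: "set_integrable lborel {0<..} (\<lambda>y. vg_kernel r (- y) * R (- y)) \<and>
      (LBINT y:{0<..}. vg_kernel r (- y) * R (- y)) = (LBINT y:{0<..}. y ^ (r - 1) * vgQ r y * R (- y))"
    using half[OF reflect_continuous_bounded[OF R]] by simp
  note two = lborel_integral_two_sided[of "\<lambda>y. vg_kernel r y * R y", OF conjunct1[OF 1] conjunct1[OF 2]]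
  show "integrable lborel (\<lambda>y. vg_kernel r y * R y)" by (rule two(1))
  show "(LINT y|lborel. vg_kernel r y * R y) =
      (LBINT y:{0<..}. y ^ (r - 1) * vgQ r y * R y) + (LBINT y:{0<..}. y ^ (r - 1) * vgQ r y * R (- y))"
    unfolding two(2) conjunct2[OF 1] conjunct2[OF 2] ..
qed

lemma vg_kernel_total:
  assumes "r \<ge> 1"
  shows "(LINT y|lborel. vg_kernel r y) = 2 powr ((real r - 1) / 2) * sqrt pi * Gamma (real r / 2)"
  using vg_kernel_integral(2)[OF assms, of "\<lambda>_. 1" 1] vgQ_weighted_integral(2)[OF assms] by (simp add: powr_diff)

text \<open>After the substitution x = \<mu> + \<sigma> y the constant of the density is the
  reciprocal of the total mass in \<open>vg_kernel_total\<close>. The product form is the one that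
  cancels when the mean is subtracted.\<close>

lemma vg_expectation_eq:
  assumes r: "r \<ge> 1" and \<sigma>: "\<sigma> > 0" and h: "continuous_on UNIV h" "\<And>x. \<bar>h x\<bar> \<le> M"
  shows "vg_expectation (real r) \<sigma> \<mu> h * (LINT y|lborel. vg_kernel r y) = (LINT y|lborel. vg_kernel r y * h (\<sigma> * y + \<mu>))"
proof -
  let ?\<nu> = "(real r - 1) / 2"
  define C where "C = 1 / (sqrt pi * Gamma (real r / 2) * 2 powr ?\<nu>)"
  have G: "Gamma (real r / 2) > 0" using r by (intro Gamma_real_pos) auto
  have dens: "vg_density (real r) \<sigma> \<mu> x = C / \<sigma> * vg_kernel r ((x - \<mu>) / \<sigma>)" for x
  proof -
    have "(\<bar>x - \<mu>\<bar> / (2 * \<sigma>)) powr ?\<nu> = (\<bar>x - \<mu>\<bar> / \<sigma>) powr ?\<nu> / 2 powr ?\<nu>"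
      using \<sigma> by (simp add: powr_divide powr_mult)
    then show ?thesis using \<sigma> by (simp add: vg_density_def vg_kernel_def C_def abs_divide)
  qed
  have meas: "vg_kernel r \<in> borel_measurable borel"
    using vg_kernel_integral(1)[OF r, of "\<lambda>_. 1" 1] by (auto dest: borel_measurable_integrable)
  have h_meas: "h \<in> borel_measurable borel" using h(1) by (rule borel_measurable_continuous_onI)
  have nonneg: "vg_density (real r) \<sigma> \<mu> x \<ge> 0" for x
    unfolding dens C_def using G \<sigma> vg_kernel_nonneg by (intro mult_nonneg_nonneg divide_nonneg_nonneg) auto
  have dens_meas: "vg_density (real r) \<sigma> \<mu> \<in> borel_measurable borel"
    unfolding dens[abs_def] using meas by simp
  have "vg_expectation (real r) \<sigma> \<mu> h = (LINT x|lborel. vg_density (real r) \<sigma> \<mu> x *\<^sub>R h x)"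
    unfolding vg_expectation_def vg_distr_def
    by (rule integral_density) (use nonneg dens_meas h_meas in auto)
  also have "\<dots> = \<bar>\<sigma>\<bar> *\<^sub>R (LINT y|lborel. vg_density (real r) \<sigma> \<mu> (\<mu> + \<sigma> * y) *\<^sub>R h (\<mu> + \<sigma> * y))"
    using \<sigma> by (intro lborel_integral_real_affine) auto
  also have "\<dots> = (LINT y|lborel. C * (vg_kernel r y * h (\<sigma> * y + \<mu>)))"
  proof -
    have "vg_density (real r) \<sigma> \<mu> (\<mu> + \<sigma> * y) *\<^sub>R h (\<mu> + \<sigma> * y) = C / \<sigma> * (vg_kernel r y * h (\<sigma> * y + \<mu>))" for y
      using \<sigma> by (simp add: dens add.commute)
    then show ?thesis using \<sigma> by simp
  qed
  also have "\<dots> = C * (LINT y|lborel. vg_kernel r y * h (\<sigma> * y + \<mu>))" by simp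
  finally show ?thesis using G by (simp add: vg_kernel_total[OF r] C_def)
qed

lemma vg_centred_kernel_integral:
  assumes r: "r \<ge> 1" and \<sigma>: "\<sigma> > 0" and h: "continuous_on UNIV h" "\<And>x. \<bar>h x\<bar> \<le> M"
  shows "(LINT y|lborel. vg_kernel r y * vg_centred (real r) \<sigma> \<mu> h (\<sigma> * y + \<mu>)) = 0"
proof -
  have hc: "continuous_on UNIV (\<lambda>y. h (\<sigma> * y + \<mu>))"
    by (intro continuous_intros continuous_on_UNIV_compose[OF h(1)])
  have "(LINT y|lborel. vg_kernel r y * vg_centred (real r) \<sigma> \<mu> h (\<sigma> * y + \<mu>)) =
      (LINT y|lborel. vg_kernel r y * h (\<sigma> * y + \<mu>) - vg_kernel r y * vg_expectation (real r) \<sigma> \<mu> h)"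
    by (simp add: vg_centred_def right_diff_distrib)
  also have "\<dots> = (LINT y|lborel. vg_kernel r y * h (\<sigma> * y + \<mu>)) - (LINT y|lborel. vg_kernel r y * vg_expectation (real r) \<sigma> \<mu> h)"
    by (intro Bochner_Integration.integral_diff vg_kernel_integral(1)[OF r hc, of M] h(2)
        vg_kernel_integral(1)[OF r continuous_on_const, of _ "\<bar>vg_expectation (real r) \<sigma> \<mu> h\<bar>"]) auto
  also have "\<dots> = 0"
    using vg_expectation_eq[OF r \<sigma> h, of \<mu>] by (simp add: mult.commute)
  finally show ?thesis .
qed

text \<open>For u > 0 the formula is \<open>vg_half\<close> up to the factor 1/\<sigma>. For u < 0
  its second integral runs across 0; centring replaces it by minus the integral over (-infinity, u),
  which reflection turns into an upper integral on the positive axis.\<close>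

lemma vg_stein_formula_eq:
  assumes r: "r \<ge> 1" and \<sigma>: "\<sigma> > 0" and h: "continuous_on UNIV h" "\<And>x. \<bar>h x\<bar> \<le> M" and "x \<noteq> \<mu>"
  defines "R \<equiv> \<lambda>y. vg_centred (real r) \<sigma> \<mu> h (\<sigma> * y + \<mu>)"
  shows "vg_stein_formula (real r) \<sigma> \<mu> h x = vg_two_sided r R ((x - \<mu>) / \<sigma>) / \<sigma>"
proof -
  let ?\<nu> = "(real r - 1) / 2"
  define u where "u = (x - \<mu>) / \<sigma>"
  have "u \<noteq> 0" using assms by (simp add: u_def)
  define M' where "M' = M + \<bar>vg_expectation (real r) \<sigma> \<mu> h\<bar>"
  have R: "continuous_on UNIV R" "\<And>y. \<bar>R y\<bar> \<le> M'"
  proof -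
    show "continuous_on UNIV R" unfolding R_def vg_centred_def
      by (intro continuous_intros continuous_on_UNIV_compose[OF h(1)])
    show "\<bar>R y\<bar> \<le> M'" for y
      unfolding R_def vg_centred_def M'_def using h(2)[of "\<sigma> * y + \<mu>"] by linarith
  qed
  have int: "set_integrable lborel S (\<lambda>y. vg_kernel r y * R y)" if "S \<in> sets borel" for S
    unfolding set_integrable_def
    by (rule integrable_mult_indicator[OF _ vg_kernel_integral(1)[OF r R]]) (use that in simp)
  define I1 where "I1 = (LBINT y=0..ereal u. \<bar>y\<bar> powr ?\<nu> * besselI ?\<nu> \<bar>y\<bar> * R y)"
  define I2 where "I2 = (LBINT y=ereal u..\<infinity>. vg_kernel r y * R y)"
  have I2: "I2 = (LBINT y:{u..}. vg_kernel r y * R y)"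
  proof -
    have "I2 = (LBINT y:{u<..}. vg_kernel r y * R y)"
      by (simp add: I2_def interval_integral_to_infinity_eq)
    then show ?thesis using set_integral_greaterThan_eq_atLeast[OF int, of u] by simp
  qed
  have formula: "vg_stein_formula (real r) \<sigma> \<mu> h x = (- (vgQ r \<bar>u\<bar> * I1) - vgP r \<bar>u\<bar> * I2) / \<sigma>"
    using \<open>u \<noteq> 0\<close> r \<sigma>
    by (simp add: vg_stein_formula_def Let_def u_def[symmetric] I1_def I2_def R_def vg_kernel_def vgQ_def vgP_eq
        field_simps)
  have upper: "(LBINT y:{v..}. vg_kernel r y * S y) = vg_upper r S v" if "v > 0" for v S
    unfolding vg_upper_def by (rule set_lebesgue_integral_cong) (use that in \<open>auto simp: vg_kernel_pos_eq r[simplified]\<close>)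
  consider "u > 0" | "u < 0" using \<open>u \<noteq> 0\<close> by linarith
  then show ?thesis
  proof cases
    case 1
    have "I1 = vg_lower r R u" unfolding I1_def by (rule vg_lower_eq_interval_integral[OF r R(1) 1])
    then show ?thesis
      unfolding formula I2 u_def[symmetric] upper[OF 1] using 1 by (simp add: vg_two_sided_def vg_half_def)
  next
    case 2
    then have v: "- u > 0" by simp
    have "I1 = (LBINT y=ereal (- u)..0. \<bar>y\<bar> powr ?\<nu> * besselI ?\<nu> \<bar>y\<bar> * R (- y))"
      unfolding I1_def by (subst interval_integral_reflect) simp
    also have "\<dots> = - (LBINT y=0..ereal (- u). \<bar>y\<bar> powr ?\<nu> * besselI ?\<nu> \<bar>y\<bar> * R (- y))"
      by (rule interval_integral_endpoints_reverse)
    also have "\<dots> = - vg_lower r (\<lambda>y. R (- y)) (- u)"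
      by (subst vg_lower_eq_interval_integral[OF r _ v]) (auto intro!: continuous_intros continuous_on_UNIV_compose[OF R(1)])
    finally have I1: "I1 = - vg_lower r (\<lambda>y. R (- y)) (- u)" .
    have "0 = (LBINT y:{..<u} \<union> {u..}. vg_kernel r y * R y)"
    proof -
      have "{..<u} \<union> {u..} = UNIV" by auto
      then show ?thesis
        using vg_centred_kernel_integral[OF r \<sigma> h, of \<mu>] by (simp add: set_lebesgue_integral_def R_def)
    qed
    also have "\<dots> = (LBINT y:{..<u}. vg_kernel r y * R y) + I2"
      unfolding I2 by (intro set_integral_Un int) auto
    also have "(LBINT y:{..<u}. vg_kernel r y * R y) = (LBINT y:{- u<..}. vg_kernel r y * R (- y))"
    proof -
      have "indicator {..<u} (- y) = (indicator {- u<..} y :: real)" for y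
        by (auto simp: indicator_def)
      then show ?thesis
        using lborel_integral_reflect(2)[of "\<lambda>y. indicator {..<u} y *\<^sub>R (vg_kernel r y * R y)"]
        by (simp add: set_lebesgue_integral_def)
    qed
    also have "\<dots> = (LBINT y:{- u..}. vg_kernel r y * R (- y))"
    proof (rule set_integral_greaterThan_eq_atLeast)
      have "integrable lborel (\<lambda>y. vg_kernel r y * R (- y))"
        by (rule vg_kernel_integral(1)[OF r reflect_continuous_bounded[OF R]])
      then show "set_integrable lborel {- u..} (\<lambda>y. vg_kernel r y * R (- y))"
        unfolding set_integrable_def by (intro integrable_mult_indicator) auto
    qed
    also have "\<dots> = vg_upper r (\<lambda>y. R (- y)) (- u)" by (rule upper[OF v])
    finally have I2': "I2 = - vg_upper r (\<lambda>y. R (- y)) (- u)" by simp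
    show ?thesis
      unfolding formula I1 I2' u_def[symmetric] using 2 by (simp add: vg_two_sided_def vg_half_def)
  qed
qed

section \<open>Derivative bounds\<close>

text \<open>Passing from n to n + 2 multiplies the ratio by x / (x + 1/2) with x = n/2, which is at
  most 1, so the larger base value sqrt(pi), at r = 1, bounds all. This makes the sup bound on the
  solution uniform in r.\<close>

lemma Gamma_half_ratio_le:
  fixes r :: nat
  assumes "r \<ge> 1"
  shows "Gamma (real r / 2) / Gamma (real r / 2 + 1 / 2) \<le> sqrt pi"
  using assms
proof (induction r rule: less_induct)
  case (less r)
  consider "r = 1" | "r = 2" | n where "r = n + 2" "n \<ge> 1"
    using less.prems by (metis Suc_1 add_2_eq_Suc' le_SucE le_add1 One_nat_def add.commute le_Suc_ex not_less_eq_eq numeral_2_eq_2)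
  then show ?case
  proof cases
    case 1
    then show ?thesis by (simp add: Gamma_one_half_real)
  next
    case 2
    have "Gamma (1 / 2 + 1 :: real) = 1 / 2 * Gamma (1 / 2)"
      by (intro Gamma_plus1) (auto elim!: nonpos_Ints_cases)
    then have G: "Gamma (3 / 2 :: real) = sqrt pi / 2" by (simp add: Gamma_one_half_real)
    have "2 \<le> sqrt pi * sqrt pi" using pi_ge_two by simp
    then have "2 / sqrt pi \<le> sqrt pi" by (simp add: field_simps)
    then show ?thesis using 2 by (simp add: G)
  next
    case 3
    define x where "x = real n / 2"
    have x: "x > 0" using 3 by (simp add: x_def)
    have pos: "Gamma x > 0" "Gamma (x + 1 / 2) > 0" using x by (auto intro!: Gamma_real_pos)
    have e: "real r / 2 = x + 1" "x + 1 + 1 / 2 = x + 1 / 2 + 1" using 3 by (auto simp: x_def field_simps)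
    have G: "Gamma (x + 1) = x * Gamma x" "Gamma (x + 1 / 2 + 1) = (x + 1 / 2) * Gamma (x + 1 / 2)"
      using x by (intro Gamma_plus1; auto elim!: nonpos_Ints_cases)+
    have "x * Gamma x / ((x + 1 / 2) * Gamma (x + 1 / 2)) = x / (x + 1 / 2) * (Gamma x / Gamma (x + 1 / 2))"
      by simp
    also have "\<dots> \<le> 1 * (Gamma x / Gamma (x + 1 / 2))"
      using x pos by (intro mult_right_mono) auto
    also have "\<dots> \<le> sqrt pi" using less.IH[of n] 3 by (simp add: x_def)
    finally show ?thesis unfolding e G .
  qed
qed

text \<open>Links the prefactor 2/r of the gradient bound to the one in the bounds for derivatives
  of order two to four; it reduces to 1/r^2 \<le> pi/(2 r).\<close>

lemma stein_constant_ge: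
  fixes r :: nat
  assumes "r \<ge> 1"
  shows "2 / r \<le> sqrt (pi / (2 * r)) + 1 / r"
proof -
  have "(1 / r)\<^sup>2 \<le> pi / (2 * r)"
  proof -
    have "(1 / r)\<^sup>2 \<le> 1 / real r" using assms by (simp add: power2_eq_square divide_le_eq)
    also have "\<dots> \<le> pi / (2 * r)" using assms pi_ge_two by (simp add: field_simps)
    finally show ?thesis .
  qed
  then have "1 / r \<le> sqrt (pi / (2 * r))" by (rule real_le_rsqrt)
  then show ?thesis by simp
qed

lemma abs_le_sup_norm: "bounded (range g) \<Longrightarrow> \<bar>g x\<bar> \<le> sup_norm g"
  unfolding sup_norm_def
  by (rule cSUP_upper) (auto simp: bounded_iff bdd_above_def)

lemma sup_norm_le: "(\<And>x. \<bar>g x\<bar> \<le> c) \<Longrightarrow> sup_norm g \<le> c"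
  unfolding sup_norm_def by (rule cSUP_least) auto

text \<open>The constants come from |g| \<le> 2 a0 (as pi/2 \<le> 2), |g1| \<le> 2 a0 and |g2| \<le>
  2 (a1 + 2 a0), which enter the successive right-hand sides H1 + g, H2 + 2 g1 and H3 + 3
  g2.\<close>

lemma vg_solution_exists:
  fixes H H1 H2 H3 :: "real \<Rightarrow> real"
  assumes r: "r \<ge> 1"
    and H: "\<And>u. (H has_real_derivative H1 u) (at u)" "\<And>u. (H1 has_real_derivative H2 u) (at u)"
      "\<And>u. (H2 has_real_derivative H3 u) (at u)" "continuous_on UNIV H3"
    and bd: "\<And>u. \<bar>H u\<bar> \<le> a0" "\<And>u. \<bar>H1 u\<bar> \<le> a1" "\<And>u. \<bar>H2 u\<bar> \<le> a2" "\<And>u. \<bar>H3 u\<bar> \<le> a3"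
    and centred: "(LINT y|lborel. vg_kernel r y * H y) = 0"
  obtains g1 g2 g3 g4 where
    "\<And>u. (vg_two_sided r H has_real_derivative g1 u) (at u)" "\<And>u. (g1 has_real_derivative g2 u) (at u)"
    "\<And>u. (g2 has_real_derivative g3 u) (at u)" "\<And>u. (g3 has_real_derivative g4 u) (at u)"
    "\<And>u. u * g2 u + r * g1 u - u * vg_two_sided r H u = H u"
    "\<And>u. \<bar>vg_two_sided r H u\<bar> \<le> sqrt pi / 2 * Gamma (real r / 2) / Gamma (real r / 2 + 1 / 2) * a0"
    "\<And>u. \<bar>g1 u\<bar> \<le> 2 / r * a0" "\<And>u. \<bar>g2 u\<bar> \<le> 2 / r * (a1 + 2 * a0)"
    "\<And>u. \<bar>g3 u\<bar> \<le> 2 / r * (a2 + 4 * a0)" "\<And>u. \<bar>g4 u\<bar> \<le> 2 / r * (a3 + 6 * a1 + 12 * a0)"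
proof -
  let ?g = "vg_two_sided r H"
  let ?c = "sqrt pi / 2 * Gamma (real r / 2) / Gamma (real r / 2 + 1 / 2)"
  have a: "a0 \<ge> 0" "a1 \<ge> 0" "a2 \<ge> 0" "a3 \<ge> 0" using bd[of 0] by auto
  have H_cont: "continuous_on UNIV H" "continuous_on UNIV H1" "continuous_on UNIV H2"
    using H(1-3) by (auto intro: DERIV_continuous_on)
  have g_cont: "continuous_on UNIV ?g"
    by (rule vg_two_sided_continuous_on[OF r H_cont(1) bd(1)])
       (use vg_kernel_integral(2)[OF r H_cont(1) bd(1)] centred in simp)
  have g_bd: "\<bar>?g u\<bar> \<le> ?c * a0" for u
    by (rule vg_two_sided_bound[OF r H_cont(1) bd(1) g_cont])
  define g1 where "g1 = (\<lambda>u. u * vg_average r ?g u + vg_average (r - 1) H u)"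
  have sol0: "vg_solves r ?g g1 H"
    unfolding g1_def
    by (rule vg_solvesI[OF r g_cont H_cont(1) vg_two_sided'_bound[OF r H_cont(1) bd(1)]
          vg_two_sided_has_real_derivative[OF r H_cont(1) bd(1)]])
  have bounded_if: "bounded (range f)" if "\<And>u. \<bar>f u\<bar> \<le> k" for f :: "real \<Rightarrow> real" and k
    using that by (auto simp: bounded_iff)
  have g1_bd: "\<bar>g1 u\<bar> \<le> 2 / r * a0" for u
  proof (cases "u = 0")
    case True
    then show ?thesis using vg_solves_bound_0[OF sol0 bd(1)] by simp
  next
    case False
    have "g1 u = vg_two_sided' r H u"
      by (rule DERIV_unique[OF vg_solvesD(3)[OF sol0] vg_two_sided_has_real_derivative(1)[OF r H_cont(1) bd(1) False]])
    then show ?thesis using vg_two_sided'_bound[OF r H_cont(1) bd(1)] by simp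
  qed
  note bg = bounded_if[OF g_bd] bounded_if[OF g1_bd]
  obtain g2 where sol1: "vg_solves (r + 1) g1 g2 (\<lambda>u. H1 u + ?g u)" and bg2: "bounded (range g2)"
    by (rule vg_solves_step[OF sol0 H(1) H_cont(2) bg bounded_if[OF bd(1)]])
  have "?c = sqrt pi / 2 * (Gamma (real r / 2) / Gamma (real r / 2 + 1 / 2))" by simp
  also have "\<dots> \<le> sqrt pi / 2 * sqrt pi"
    using r by (intro mult_left_mono Gamma_half_ratio_le) auto
  also have "\<dots> \<le> 2" using pi_less_4 by simp
  finally have "?c * a0 \<le> 2 * a0" using a(1) by (rule mult_right_mono)
  then have g_bd': "\<bar>?g u\<bar> \<le> 2 * a0" for u using g_bd[of u] by linarith
  have b1: "\<bar>H1 u + ?g u\<bar> \<le> a1 + 2 * a0" for u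
    using bd(2)[of u] g_bd'[of u] by linarith
  \<comment> \<open>The k-th derivative solves the equation of order r + k; its smaller prefactor
    2/(r + k) is relaxed to 2/r.\<close>
  have mono: "2 / real (r + k) * x \<le> 2 / r * x" if "x \<ge> 0" for k x
    using r that by (intro mult_right_mono divide_left_mono) auto
  have g2_bd: "\<bar>g2 u\<bar> \<le> 2 / r * (a1 + 2 * a0)" for u
    using vg_solves_bound[OF sol1 bg(2) bg2 b1, of u] mono[of "a1 + 2 * a0" 1] a by linarith
  have r2: "2 / real r \<le> 2" using r by (simp add: divide_le_eq)
  have g1_bd': "\<bar>g1 u\<bar> \<le> 2 * a0" for u
    using g1_bd[of u] mult_right_mono[OF r2 a(1)] by linarith
  have g2_bd': "\<bar>g2 u\<bar> \<le> 2 * (a1 + 2 * a0)" for u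
    using g2_bd[of u] mult_right_mono[OF r2, of "a1 + 2 * a0"] a by linarith
  obtain g3 where sol2: "vg_solves (r + 1 + 1) g2 g3 (\<lambda>u. (H2 u + g1 u) + g1 u)" and bg3: "bounded (range g3)"
  proof (rule vg_solves_step[OF sol1])
    show "((\<lambda>u. H1 u + ?g u) has_real_derivative H2 u + g1 u) (at u)" for u
      by (rule DERIV_add[OF H(2) vg_solvesD(3)[OF sol0]])
    show "continuous_on UNIV (\<lambda>u. H2 u + g1 u)"
      by (rule continuous_on_add[OF H_cont(3) vg_solvesD(6)[OF sol0]])
  qed (use bg bg2 bounded_if[OF b1] in auto)
  have b2: "\<bar>H2 u + g1 u + g1 u\<bar> \<le> a2 + 4 * a0" for u
    using bd(3)[of u] g1_bd'[of u] by linarith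
  have g3_bd: "\<bar>g3 u\<bar> \<le> 2 / r * (a2 + 4 * a0)" for u
    using vg_solves_bound[OF sol2 bg2 bg3 b2, of u] mono[of "a2 + 4 * a0" 2] a by simp
  obtain g4 where sol3: "vg_solves (r + 1 + 1 + 1) g3 g4 (\<lambda>u. (H3 u + g2 u + g2 u) + g2 u)" and bg4: "bounded (range g4)"
  proof (rule vg_solves_step[OF sol2])
    show "((\<lambda>u. H2 u + g1 u + g1 u) has_real_derivative H3 u + g2 u + g2 u) (at u)" for u
      by (intro DERIV_add H(3) vg_solvesD(3)[OF sol1])
    show "continuous_on UNIV (\<lambda>u. H3 u + g2 u + g2 u)"
      by (intro continuous_on_add H(4) vg_solvesD(6)[OF sol1])
  qed (use bg2 bg3 bounded_if[OF b2] in auto)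
  have b3: "\<bar>H3 u + g2 u + g2 u + g2 u\<bar> \<le> a3 + 6 * a1 + 12 * a0" for u
  proof -
    have "\<bar>x + y + y + y\<bar> \<le> \<bar>x\<bar> + 3 * \<bar>y\<bar>" for x y :: real by linarith
    then show ?thesis by (rule order_trans) (use add_mono[OF bd(4)[of u] mult_left_mono[OF g2_bd'[of u], of 3]] in \<open>simp add: algebra_simps\<close>)
  qed
  have g4_bd: "\<bar>g4 u\<bar> \<le> 2 / r * (a3 + 6 * a1 + 12 * a0)" for u
    using vg_solves_bound[OF sol3 bg3 bg4 b3, of u] mono[of "a3 + 6 * a1 + 12 * a0" 3] a by (simp add: add.commute)
  have ode: "u * g2 u + r * g1 u - u * ?g u = H u" for u
  proof (cases "u = 0")
    case True
    then show ?thesis using r by (simp add: vg_solvesD(4)[OF sol0] vg_average_0 of_nat_diff)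
  next
    case False
    have e: "g2 u = ?g u + H u / u - r * g1 u / u"
      by (rule DERIV_unique[OF vg_solvesD(3)[OF sol1] vg_solves_second_derivative[OF sol0 False]])
    show ?thesis unfolding e using False by (simp add: field_simps)
  qed
  show ?thesis
    by (rule that[OF vg_solvesD(3)[OF sol0] vg_solvesD(3)[OF sol1] vg_solvesD(3)[OF sol2] vg_solvesD(3)[OF sol3]
          ode g_bd g1_bd g2_bd g3_bd g4_bd])
qed

text \<open>The outer division by \<sigma> is the one in the Stein formula, so the k-th derivative
  carries \<sigma>^(k+1).\<close>

lemma deriv_iterate_scaled:
  fixes G :: "nat \<Rightarrow> real \<Rightarrow> real"
  assumes "\<And>k u. k < n \<Longrightarrow> (G k has_real_derivative G (Suc k) u) (at u)" and \<sigma>: "\<sigma> \<noteq> 0"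
  shows "k \<le> n \<Longrightarrow> (deriv ^^ k) (\<lambda>x. G 0 ((x - \<mu>) / \<sigma>) / \<sigma>) = (\<lambda>x. G k ((x - \<mu>) / \<sigma>) / \<sigma> ^ Suc k)"
    and "k < n \<Longrightarrow> ((\<lambda>x. G k ((x - \<mu>) / \<sigma>) / \<sigma> ^ Suc k) has_real_derivative G (Suc k) ((x - \<mu>) / \<sigma>) / \<sigma> ^ Suc (Suc k)) (at x)"
proof -
  have D: "((\<lambda>x. G k ((x - \<mu>) / \<sigma>) / \<sigma> ^ Suc k) has_real_derivative G (Suc k) ((x - \<mu>) / \<sigma>) / \<sigma> ^ Suc (Suc k)) (at x)" if "k < n" for k x
  proof -
    have "((\<lambda>x. (x - \<mu>) / \<sigma>) has_real_derivative 1 / \<sigma>) (at x)" using \<sigma> by (auto intro!: derivative_eq_intros)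
    from DERIV_cdivide[OF DERIV_chain2[OF assms(1)[OF that] this], of "\<sigma> ^ Suc k"]
    show ?thesis by simp
  qed
  then show "k < n \<Longrightarrow> ((\<lambda>x. G k ((x - \<mu>) / \<sigma>) / \<sigma> ^ Suc k) has_real_derivative G (Suc k) ((x - \<mu>) / \<sigma>) / \<sigma> ^ Suc (Suc k)) (at x)" .
  show "k \<le> n \<Longrightarrow> (deriv ^^ k) (\<lambda>x. G 0 ((x - \<mu>) / \<sigma>) / \<sigma>) = (\<lambda>x. G k ((x - \<mu>) / \<sigma>) / \<sigma> ^ Suc k)"
  proof (induction k)
    case (Suc k)
    then show ?case using D[of k] by (auto intro!: ext DERIV_imp_deriv simp del: power_Suc)
  qed simp
qed

theorem theorem3p6:
  fixes r :: nat and \<sigma> \<mu> :: real and h :: "real \<Rightarrow> real"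
  assumes "r \<ge> 1" and "\<sigma> > 0" and "h \<in> Cb3"
  defines "ht \<equiv> vg_centred (real r) \<sigma> \<mu> h"
  defines "f \<equiv> vg_stein_solution (real r) \<sigma> \<mu> h"
  shows "(\<forall>k<4. \<forall>x. (deriv ^^ k) f differentiable (at x)) \<and>
     (\<forall>x. \<sigma>\<^sup>2 * (x - \<mu>) * (deriv ^^ 2) f x + \<sigma>\<^sup>2 * real r * deriv f x - (x - \<mu>) * f x
            = h x - vg_expectation (real r) \<sigma> \<mu> h) \<and>
     (\<forall>k\<le>4. bounded (range ((deriv ^^ k) f))) \<and>
     sup_norm f \<le> 1 / \<sigma> * (1 / real r
         + pi * Gamma (real r / 2) / (2 * Gamma (real r / 2 + 1 / 2))) * sup_norm ht \<and>
     sup_norm (deriv f) \<le> 2 / (\<sigma>\<^sup>2 * real r) * sup_norm ht \<and>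
     sup_norm ((deriv ^^ 2) f) \<le> 1 / \<sigma>\<^sup>2 * (sqrt (pi / (2 * real r)) + 1 / real r)
         * (3 * sup_norm (deriv h) + 4 / \<sigma> * sup_norm ht) \<and>
     sup_norm ((deriv ^^ 3) f) \<le> 1 / \<sigma>\<^sup>2 * (sqrt (pi / (2 * real r)) + 1 / real r)
         * (5 * sup_norm ((deriv ^^ 2) h) + 18 / \<sigma> * sup_norm (deriv h)
            + 19 / \<sigma>\<^sup>2 * sup_norm ht) \<and>
     sup_norm ((deriv ^^ 4) f) \<le> 1 / \<sigma>\<^sup>2 * (sqrt (pi / (2 * real r)) + 1 / real r)
         * (8 * sup_norm ((deriv ^^ 3) h) + 52 / \<sigma> * sup_norm ((deriv ^^ 2) h)
            + 124 / \<sigma>\<^sup>2 * sup_norm (deriv h) + 124 / \<sigma>^3 * sup_norm ht)"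
proof -
  have r: "r \<ge> 1" and \<sigma>: "\<sigma> > 0" by fact+
  define d where "d = (\<lambda>k. (deriv ^^ k) h)"
  have d0: "d 0 = h" and d1: "d 1 = deriv h" by (auto simp: d_def)
  have d_deriv: "(d k has_real_derivative d (Suc k) x) (at x)" if "k < 3" for k x
  proof -
    have "d k differentiable (at x)" using assms(3) that by (auto simp: Cb3_def d_def)
    then show ?thesis by (simp add: d_def DERIV_deriv_iff_real_differentiable)
  qed
  have d_cont: "continuous_on UNIV (d 3)" using assms(3) by (simp add: Cb3_def d_def)
  have d_bd: "\<bar>d k x\<bar> \<le> sup_norm (d k)" if "k \<le> 3" for k x
    using assms(3) that by (intro abs_le_sup_norm) (auto simp: Cb3_def d_def)
  have h_cont: "continuous_on UNIV h"
    using d_deriv[of 0] by (intro DERIV_continuous_on[of UNIV h "d 1"]) (simp add: d0)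
  have h_bd: "\<bar>h x\<bar> \<le> sup_norm h" for x using d_bd[of 0] by (simp add: d0)
  have ht_bd: "\<bar>ht x\<bar> \<le> sup_norm ht" for x
  proof (rule abs_le_sup_norm)
    have "\<bar>ht x\<bar> \<le> sup_norm h + \<bar>vg_expectation (real r) \<sigma> \<mu> h\<bar>" for x
      using h_bd[of x] unfolding ht_def vg_centred_def by linarith
    then show "bounded (range ht)" by (auto simp: bounded_iff)
  qed
  define H where "H = (\<lambda>y. ht (\<sigma> * y + \<mu>))"
  \<comment> \<open>The chain rule contributes \<sigma>^k; set against the division by
    \<sigma>^(k+1) in the derivatives of \<open>f\<close>, it produces the powers of \<sigma> in the
    bounds.\<close>
  define Hd where "Hd = (\<lambda>k y. \<sigma> ^ k * d k (\<sigma> * y + \<mu>))"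
  have aff: "((\<lambda>y. \<sigma> * y + \<mu>) has_real_derivative \<sigma>) (at y)" for y
    by (auto intro!: derivative_eq_intros)
  have H_deriv: "(H has_real_derivative Hd 1 y) (at y)" for y
  proof -
    have D0: "(d 0 has_real_derivative d 1 x) (at x)" for x using d_deriv[of 0 x] by simp
    have "((\<lambda>y. d 0 (\<sigma> * y + \<mu>) - vg_expectation (real r) \<sigma> \<mu> h) has_real_derivative d 1 (\<sigma> * y + \<mu>) * \<sigma> - 0) (at y)"
      by (intro DERIV_diff DERIV_const DERIV_chain2[OF D0 aff])
    then show ?thesis by (simp add: H_def Hd_def ht_def vg_centred_def[abs_def] d0 mult.commute)
  qed
  have Hd_deriv: "(Hd k has_real_derivative Hd (Suc k) y) (at y)" if "k < 3" for k y
    unfolding Hd_def using DERIV_cmult[OF DERIV_chain2[OF d_deriv[OF that] aff], of "\<sigma> ^ k" y] by (simp add: mult_ac)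
  have Hd_bd: "\<bar>Hd k y\<bar> \<le> \<sigma> ^ k * sup_norm (d k)" if "k \<le> 3" for k y
    using \<sigma> d_bd[OF that] by (simp add: Hd_def abs_mult)
  have Hd_cont: "continuous_on UNIV (Hd 3)"
    unfolding Hd_def by (intro continuous_intros continuous_on_UNIV_compose[OF d_cont])
  have H_bd: "\<bar>H y\<bar> \<le> sup_norm ht" for y by (simp add: H_def ht_bd)
  have centred: "(LINT y|lborel. vg_kernel r y * H y) = 0"
    unfolding H_def ht_def by (rule vg_centred_kernel_integral[OF r \<sigma> h_cont h_bd])
  have Hd12: "(Hd 1 has_real_derivative Hd 2 y) (at y)" "(Hd 2 has_real_derivative Hd 3 y) (at y)" for y
    using Hd_deriv[of 1 y] Hd_deriv[of 2 y] by (simp_all add: eval_nat_numeral)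
  have B: "\<bar>Hd 1 y\<bar> \<le> \<sigma> ^ 1 * sup_norm (d 1)" "\<bar>Hd 2 y\<bar> \<le> \<sigma> ^ 2 * sup_norm (d 2)"
    "\<bar>Hd 3 y\<bar> \<le> \<sigma> ^ 3 * sup_norm (d 3)" for y
    by (rule Hd_bd; simp)+
  let ?g = "vg_two_sided r H"
  let ?c = "sqrt pi / 2 * Gamma (real r / 2) / Gamma (real r / 2 + 1 / 2)"
  obtain g1 g2 g3 g4 :: "real \<Rightarrow> real" where g:
    "\<And>u. (?g has_real_derivative g1 u) (at u)" "\<And>u. (g1 has_real_derivative g2 u) (at u)"
    "\<And>u. (g2 has_real_derivative g3 u) (at u)" "\<And>u. (g3 has_real_derivative g4 u) (at u)"
    and ode: "\<And>u. u * g2 u + r * g1 u - u * ?g u = H u"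
    and b: "\<And>u. \<bar>?g u\<bar> \<le> ?c * sup_norm ht"
    "\<And>u. \<bar>g1 u\<bar> \<le> 2 / r * sup_norm ht"
    "\<And>u. \<bar>g2 u\<bar> \<le> 2 / r * (\<sigma> ^ 1 * sup_norm (d 1) + 2 * sup_norm ht)"
    "\<And>u. \<bar>g3 u\<bar> \<le> 2 / r * (\<sigma> ^ 2 * sup_norm (d 2) + 4 * sup_norm ht)"
    "\<And>u. \<bar>g4 u\<bar> \<le> 2 / r * (\<sigma> ^ 3 * sup_norm (d 3) + 6 * (\<sigma> ^ 1 * sup_norm (d 1)) + 12 * sup_norm ht)"
    by (rule vg_solution_exists[OF r H_deriv Hd12 Hd_cont H_bd B centred]) (rule that; assumption)
  have f_eq: "f = (\<lambda>x. ?g ((x - \<mu>) / \<sigma>) / \<sigma>)"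
  proof
    fix x
    have formula: "vg_stein_formula (real r) \<sigma> \<mu> h x = ?g ((x - \<mu>) / \<sigma>) / \<sigma>" if "x \<noteq> \<mu>" for x
      using vg_stein_formula_eq[OF r \<sigma> h_cont h_bd that] by (simp add: H_def[abs_def] ht_def)
    \<comment> \<open>Continuity of \<open>?g\<close> at 0 evaluates the limit that defines the
      solution at \<open>\<mu>\<close>, so the scaled form holds there too.\<close>
    have "((\<lambda>x. ?g ((x - \<mu>) / \<sigma>) / \<sigma>) \<longlongrightarrow> ?g ((\<mu> - \<mu>) / \<sigma>) / \<sigma>) (at \<mu>)"
      using \<sigma> by (intro tendsto_intros isCont_tendsto_compose[OF DERIV_isCont[OF g(1)]]) auto
    then have "(vg_stein_formula (real r) \<sigma> \<mu> h \<longlongrightarrow> ?g ((\<mu> - \<mu>) / \<sigma>) / \<sigma>) (at \<mu>)"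
      by (rule Lim_transform_eventually) (auto simp: formula eventually_at_filter intro: always_eventually)
    then have "Lim (at \<mu>) (vg_stein_formula (real r) \<sigma> \<mu> h) = ?g ((\<mu> - \<mu>) / \<sigma>) / \<sigma>"
      by (intro tendsto_Lim) auto
    then show "f x = ?g ((x - \<mu>) / \<sigma>) / \<sigma>"
      using formula by (simp add: f_def vg_stein_solution_def)
  qed
  define G where "G = (\<lambda>k::nat. [?g, g1, g2, g3, g4] ! k)"
  have G_simps: "G 0 = ?g" "G 1 = g1" "G 2 = g2" "G 3 = g3" "G 4 = g4" "G (Suc 0) = g1"
    by (auto simp: G_def eval_nat_numeral)
  have G_deriv: "(G k has_real_derivative G (Suc k) u) (at u)" if "k < 4" for k u
  proof -
    have "k = 0 \<or> k = 1 \<or> k = 2 \<or> k = 3" using that by auto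
    then show ?thesis using g by (auto simp: G_def eval_nat_numeral)
  qed
  have f_eq_G: "f = (\<lambda>x. G 0 ((x - \<mu>) / \<sigma>) / \<sigma>)" unfolding G_simps by (rule f_eq)
  have f_deriv: "(deriv ^^ k) f = (\<lambda>x. G k ((x - \<mu>) / \<sigma>) / \<sigma> ^ Suc k)" if "k \<le> 4" for k
    unfolding f_eq_G by (rule deriv_iterate_scaled(1)[where G = G and n = 4, OF G_deriv _ that]) (use \<sigma> in auto)
  have F: "(deriv ^^ 2) f x = g2 ((x - \<mu>) / \<sigma>) / \<sigma> ^ 3" "(deriv ^^ 3) f x = g3 ((x - \<mu>) / \<sigma>) / \<sigma> ^ 4"
    "(deriv ^^ 4) f x = g4 ((x - \<mu>) / \<sigma>) / \<sigma> ^ 5" "deriv f x = g1 ((x - \<mu>) / \<sigma>) / \<sigma>\<^sup>2" for x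
  proof -
    have e: "Suc 2 = 3" "Suc 3 = 4" "Suc 4 = 5" by auto
    show "(deriv ^^ 2) f x = g2 ((x - \<mu>) / \<sigma>) / \<sigma> ^ 3" "(deriv ^^ 3) f x = g3 ((x - \<mu>) / \<sigma>) / \<sigma> ^ 4"
      "(deriv ^^ 4) f x = g4 ((x - \<mu>) / \<sigma>) / \<sigma> ^ 5"
      using f_deriv[of 2] f_deriv[of 3] f_deriv[of 4] unfolding G_simps e by simp_all
    show "deriv f x = g1 ((x - \<mu>) / \<sigma>) / \<sigma>\<^sup>2"
      using f_deriv[of 1] by (simp add: G_simps power2_eq_square)
  qed
  have f_diff: "(deriv ^^ k) f differentiable (at x)" if "k < 4" for k x
    using deriv_iterate_scaled(2)[where G = G and n = 4, OF G_deriv _ that, of \<sigma> \<mu> x] \<sigma> that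
    by (auto simp: f_deriv real_differentiable_def)
  define X where "X = sqrt (pi / (2 * r)) + 1 / r"
  have X: "2 / r \<le> X" unfolding X_def by (rule stein_constant_ge[OF r])
  have N: "sup_norm ht \<ge> 0" "sup_norm (d k) \<ge> 0" if "k \<le> 3" for k
    using ht_bd[of 0] d_bd[OF that, of 0] by auto
  have scale: "\<bar>z / \<sigma> ^ k\<bar> \<le> c / \<sigma> ^ k" if "\<bar>z\<bar> \<le> c" for z c :: real and k
    using that \<sigma> by (simp add: abs_divide divide_right_mono)
  have f0: "\<bar>(deriv ^^ 0) f x\<bar> \<le> 1 / \<sigma> * (1 / real r + pi * Gamma (real r / 2) / (2 * Gamma (real r / 2 + 1 / 2))) * sup_norm ht" for x
  proof -
    have "Gamma (real r / 2) > 0" "Gamma (real r / 2 + 1 / 2) > 0"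
      using r by (auto intro!: Gamma_real_pos add_pos_pos)
    then have p: "0 \<le> Gamma (real r / 2) / Gamma (real r / 2 + 1 / 2)" by simp
    \<comment> \<open>The sup bound has sqrt(pi)/2 where the claim has pi/2, and 1/r is a
      nonnegative addition.\<close>
    have "sqrt pi \<le> pi" using pi_ge_two by (intro real_le_lsqrt) (auto simp: power2_eq_square)
    then have "sqrt pi / 2 * (Gamma (real r / 2) / Gamma (real r / 2 + 1 / 2)) \<le> pi / 2 * (Gamma (real r / 2) / Gamma (real r / 2 + 1 / 2))"
      using p by (intro mult_right_mono) auto
    then have "?c \<le> 1 / real r + pi * Gamma (real r / 2) / (2 * Gamma (real r / 2 + 1 / 2))"
      by (simp add: add_increasing)
    then have "?c * sup_norm ht \<le> (1 / real r + pi * Gamma (real r / 2) / (2 * Gamma (real r / 2 + 1 / 2))) * sup_norm ht"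
      using N(1)[of 0] by (intro mult_right_mono) auto
    with b(1)[of "(x - \<mu>) / \<sigma>"] have "\<bar>?g ((x - \<mu>) / \<sigma>)\<bar> \<le> (1 / real r + pi * Gamma (real r / 2) / (2 * Gamma (real r / 2 + 1 / 2))) * sup_norm ht"
      by linarith
    from scale[OF this, of 1] show ?thesis by (simp add: f_eq)
  qed
  have f1: "\<bar>(deriv ^^ 1) f x\<bar> \<le> 2 / (\<sigma>\<^sup>2 * real r) * sup_norm ht" for x
    using scale[OF b(2)[of "(x - \<mu>) / \<sigma>"], of 2] by (simp add: F mult_ac)
  have up: "2 / r * y \<le> X * z" if "y \<le> z" "0 \<le> z" for y z
  proof -
    have "2 / r * y \<le> 2 / r * z" using that by (intro mult_left_mono) auto
    also have "\<dots> \<le> X * z" using X that by (intro mult_right_mono) auto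
    finally show ?thesis .
  qed
  have f2: "\<bar>(deriv ^^ 2) f x\<bar> \<le> 1 / \<sigma>\<^sup>2 * X * (3 * sup_norm (deriv h) + 4 / \<sigma> * sup_norm ht)" for x
  proof -
    \<comment> \<open>The coefficients 1 and 2 from the recursion are relaxed to 3 and 4.\<close>
    have "2 / r * (\<sigma> ^ 1 * sup_norm (d 1) + 2 * sup_norm ht) \<le> X * (3 * (\<sigma> * sup_norm (d 1)) + 4 * sup_norm ht)"
      by (rule up) (use N[of 1] \<sigma> in auto)
    with b(3)[of "(x - \<mu>) / \<sigma>"]
    have "\<bar>g2 ((x - \<mu>) / \<sigma>)\<bar> \<le> X * (3 * (\<sigma> * sup_norm (d 1)) + 4 * sup_norm ht)" by linarith
    from scale[OF this, of 3]
    have "\<bar>(deriv ^^ 2) f x\<bar> \<le> X * (3 * (\<sigma> * sup_norm (d 1)) + 4 * sup_norm ht) / \<sigma> ^ 3"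
      unfolding F .
    also have "\<dots> = 1 / \<sigma>\<^sup>2 * X * (3 * sup_norm (deriv h) + 4 / \<sigma> * sup_norm ht)"
      using \<sigma> unfolding d1 by (simp add: field_simps eval_nat_numeral)
    finally show ?thesis .
  qed
  have f3: "\<bar>(deriv ^^ 3) f x\<bar> \<le> 1 / \<sigma>\<^sup>2 * X * (5 * sup_norm ((deriv ^^ 2) h) + 18 / \<sigma> * sup_norm (deriv h) + 19 / \<sigma>\<^sup>2 * sup_norm ht)" for x
  proof -
    \<comment> \<open>Coefficients 1 and 4 are raised to 5 and 19; the term in \<open>d 1\<close> is
      nonnegative and enlarges the sum.\<close>
    let ?S = "5 * (\<sigma> ^ 2 * sup_norm (d 2)) + 18 * (\<sigma> * sup_norm (d 1)) + 19 * sup_norm ht"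
    have "2 / r * (\<sigma> ^ 2 * sup_norm (d 2) + 4 * sup_norm ht) \<le> X * ?S"
      by (rule up) (use N[of 1] N[of 2] \<sigma> in \<open>auto intro!: add_mono\<close>)
    with b(4)[of "(x - \<mu>) / \<sigma>"]
    have "\<bar>g3 ((x - \<mu>) / \<sigma>)\<bar> \<le> X * ?S" by linarith
    from scale[OF this, of 4]
    have "\<bar>(deriv ^^ 3) f x\<bar> \<le> X * ?S / \<sigma> ^ 4"
      unfolding F .
    also have "\<dots> = 1 / \<sigma>\<^sup>2 * X * (5 * sup_norm (d 2) + 18 / \<sigma> * sup_norm (d 1) + 19 / \<sigma>\<^sup>2 * sup_norm ht)"
      using \<sigma> by (simp add: field_simps eval_nat_numeral)
    finally show ?thesis unfolding d1 by (simp add: d_def)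
  qed
  have f4: "\<bar>(deriv ^^ 4) f x\<bar> \<le> 1 / \<sigma>\<^sup>2 * X * (8 * sup_norm ((deriv ^^ 3) h) + 52 / \<sigma> * sup_norm ((deriv ^^ 2) h)
      + 124 / \<sigma>\<^sup>2 * sup_norm (deriv h) + 124 / \<sigma>^3 * sup_norm ht)" for x
  proof -
    \<comment> \<open>Coefficients 1, 6 and 12 are raised to 8, 124 and 124; here the nonnegative
      addition is the term in \<open>d 2\<close>.\<close>
    let ?S = "8 * (\<sigma> ^ 3 * sup_norm (d 3)) + 52 * (\<sigma> ^ 2 * sup_norm (d 2)) + 124 * (\<sigma> * sup_norm (d 1)) + 124 * sup_norm ht"
    have "0 \<le> \<sigma> ^ 3 * sup_norm (d 3)" "0 \<le> \<sigma> ^ 2 * sup_norm (d 2)" "0 \<le> \<sigma> * sup_norm (d 1)"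
      using N[of 1] N[of 2] N[of 3] \<sigma> by auto
    then have "2 / r * (\<sigma> ^ 3 * sup_norm (d 3) + 6 * (\<sigma> ^ 1 * sup_norm (d 1)) + 12 * sup_norm ht) \<le> X * ?S"
      using N(1)[of 0, simplified] unfolding power_one_right by (intro up; linarith)
    with b(5)[of "(x - \<mu>) / \<sigma>"]
    have "\<bar>g4 ((x - \<mu>) / \<sigma>)\<bar> \<le> X * ?S" by linarith
    from scale[OF this, of 5]
    have "\<bar>(deriv ^^ 4) f x\<bar> \<le> X * ?S / \<sigma> ^ 5"
      unfolding F .
    also have "\<dots> = 1 / \<sigma>\<^sup>2 * X * (8 * sup_norm (d 3) + 52 / \<sigma> * sup_norm (d 2) + 124 / \<sigma>\<^sup>2 * sup_norm (d 1) + 124 / \<sigma> ^ 3 * sup_norm ht)"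
      using \<sigma> by (simp add: field_simps eval_nat_numeral)
    finally show ?thesis unfolding d1 by (simp add: d_def)
  qed
  have stein: "\<sigma>\<^sup>2 * (x - \<mu>) * (deriv ^^ 2) f x + \<sigma>\<^sup>2 * real r * deriv f x - (x - \<mu>) * f x
      = h x - vg_expectation (real r) \<sigma> \<mu> h" for x
  proof -
    define u where "u = (x - \<mu>) / \<sigma>"
    have x: "x - \<mu> = \<sigma> * u" "x = \<sigma> * u + \<mu>" using \<sigma> by (auto simp: u_def)
    have e: "(deriv ^^ 2) f x = g2 u / \<sigma> ^ 3" "deriv f x = g1 u / \<sigma>\<^sup>2" "f x = ?g u / \<sigma>"
      by (simp_all only: F u_def) (simp only: f_eq)
    have "\<sigma>\<^sup>2 * (x - \<mu>) * (deriv ^^ 2) f x + \<sigma>\<^sup>2 * real r * deriv f x - (x - \<mu>) * f x = u * g2 u + r * g1 u - u * ?g u"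
      unfolding x(1) e using \<sigma> by (simp add: power2_eq_square power3_eq_cube field_simps)
    also have "\<dots> = ht x" unfolding ode by (simp only: H_def x(2)[symmetric])
    finally show ?thesis by (simp add: ht_def vg_centred_def)
  qed
  have bounded: "bounded (range ((deriv ^^ k) f))" if "k \<le> 4" for k
  proof -
    have "k = 0 \<or> k = 1 \<or> k = 2 \<or> k = 3 \<or> k = 4" using that by auto
    then have "\<exists>c. \<forall>x. \<bar>(deriv ^^ k) f x\<bar> \<le> c" using f0 f1 f2 f3 f4 by blast
    then show ?thesis by (auto simp: bounded_iff)
  qed
  show ?thesis
    using f_diff stein bounded sup_norm_le[of "(deriv ^^ 0) f", OF f0] sup_norm_le[of "(deriv ^^ 1) f", OF f1]
      sup_norm_le[OF f2] sup_norm_le[OF f3] sup_norm_le[OF f4]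
    unfolding X_def by simp
qed

end
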